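(* Consider the stochastic volatility model $X_{it}=\sigma_{it}Z_{it}$ and fix $p\ge1$. Assume: (1) $Z$ is regularly varying with index $\alpha\in(0,4)\setminus\{2\}$ (in the sense $\mathbb P(Z>x)\sim p_+L(x)x^{-\alpha}$, $\mathbb P(Z<-x)\sim p_-L(x)x^{-\alpha}$, $p_++p_-=1$, $L$ slowly varying); (2) the $\mathbb R^p$-valued sequence $((\sigma_{1t},\dots,\sigma_{pt}))_{t=1,2,\dots}$ is strongly mixing with rate function $(\alpha_h)$ such that $\sum_{h=0}^\infty \alpha_h^{\delta/(2+\delta)}<\infty$ for some $\delta>0$; (3) $\mathbb E[\sigma^{2\max(2+\delta,\alpha+\epsilon)}]<\infty$ for the same $\delta$ and some $\epsilon>0$. Then $$a_n^{-2}\big(S_1-c_n,\dots,S_p-c_n\big)\xrightarrow{d}(\xi_{1,\alpha/2},\dots,\xi_{p,\alpha/2}),$$ where $\xi_{1,\alpha/2},\dots,\xi_{p,\alpha/2}$ are iid $\alpha/2$-stable random variables totally skewed to the right, $c_n=0$ if $\alpha\in(0,2)$ and $c_n=n\,\mathbb E[X^2]$ if $\alpha\in(2,4)$, and $(a_n)$ satisfies $n\,\mathbb P(|X|>a_n)\to1$.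
   Context: Stochastic volatility model: $X_{it}=\sigma_{it}Z_{it}$, $i,t\in\mathbb Z$, with $(Z_{it})$ an iid random field independent of a strictly stationary ergodic field $(\sigma_{it})$ of non-negative random variables; $Z,\sigma,X$ denote generic elements. For $n\ge1$, $S_{ij}=\sum_{t=1}^n X_{it}X_{jt}$ and $S_i=S_{ii}$, $1\le i,j\le p$ (entries of the non-normalized sample covariance matrix $\mathbf X^n(\mathbf X^n)'$ where $\mathbf X^n=(X_{it})_{1\le i\le p,1\le t\le n}$). *)

theory Defs
  imports "HOL-Probability.Probability" "HOL-Library.Landau_Symbols"
begin

definition sv_X :: "(int \<Rightarrow> int \<Rightarrow> 'a \<Rightarrow> real) \<Rightarrow> (int \<Rightarrow> int \<Rightarrow> 'a \<Rightarrow> real) \<Rightarrow> int \<Rightarrow> int \<Rightarrow> 'a \<Rightarrow> real"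
  where "sv_X \<sigma> Z i t \<omega> = \<sigma> i t \<omega> * Z i t \<omega>"

text \<open>S_i = sum_{t=1}^n X_it^2 (diagonal of the non-normalized sample covariance matrix).\<close>
definition sv_S :: "(int \<Rightarrow> int \<Rightarrow> 'a \<Rightarrow> real) \<Rightarrow> (int \<Rightarrow> int \<Rightarrow> 'a \<Rightarrow> real) \<Rightarrow> nat \<Rightarrow> nat \<Rightarrow> 'a \<Rightarrow> real"
  where "sv_S \<sigma> Z n i \<omega> = (\<Sum>t=1..n. (sv_X \<sigma> Z (int i) (int t) \<omega>)\<^sup>2)"

definition field_law :: "'a measure \<Rightarrow> (int \<Rightarrow> int \<Rightarrow> 'a \<Rightarrow> real) \<Rightarrow> (int \<times> int \<Rightarrow> real) measure"
  where "field_law M F = distr M (PiM UNIV (\<lambda>_. borel)) (\<lambda>\<omega>. \<lambda>(i,t). F i t \<omega>)"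

definition field_shift :: "int \<Rightarrow> int \<Rightarrow> (int \<times> int \<Rightarrow> real) \<Rightarrow> (int \<times> int \<Rightarrow> real)"
  where "field_shift h k x = (\<lambda>(i,t). x (i + h, t + k))"

definition strictly_stationary_field :: "'a measure \<Rightarrow> (int \<Rightarrow> int \<Rightarrow> 'a \<Rightarrow> real) \<Rightarrow> bool"
  where "strictly_stationary_field M F \<longleftrightarrow>
     (\<forall>h k. distr M (PiM UNIV (\<lambda>_. borel)) (\<lambda>\<omega>. \<lambda>(i,t). F (i + h) (t + k) \<omega>) = field_law M F)"

definition ergodic_field :: "'a measure \<Rightarrow> (int \<Rightarrow> int \<Rightarrow> 'a \<Rightarrow> real) \<Rightarrow> bool"
  where "ergodic_field M F \<longleftrightarrow>
     (\<forall>A \<in> sets (PiM (UNIV :: (int \<times> int) set) (\<lambda>_. borel)).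
        (\<forall>h k. field_shift h k -` A = A) \<longrightarrow> measure (field_law M F) A \<in> {0, 1})"

definition slowly_varying :: "(real \<Rightarrow> real) \<Rightarrow> bool"
  where "slowly_varying L \<longleftrightarrow> (\<forall>\<^sub>F x in at_top. L x > 0) \<and>
     (\<forall>c>0. ((\<lambda>x. L (c * x) / L x) \<longlongrightarrow> 1) at_top)"

text \<open>P(Z > x) ~ p+ L(x) x^-alpha and P(Z < -x) ~ p- L(x) x^-alpha, where f ~ c g
  means f/g -> c (this handles p+ = 0 or p- = 0).\<close>
definition regularly_varying_rv :: "'a measure \<Rightarrow> ('a \<Rightarrow> real) \<Rightarrow> real \<Rightarrow> bool"
  where "regularly_varying_rv M Z \<alpha> \<longleftrightarrow>
     (\<exists>pp pm L. pp \<ge> 0 \<and> pm \<ge> 0 \<and> pp + pm = 1 \<and> slowly_varying L \<and>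
        ((\<lambda>x. measure M {\<omega> \<in> space M. Z \<omega> > x} / (L x * x powr (-\<alpha>))) \<longlongrightarrow> pp) at_top \<and>
        ((\<lambda>x. measure M {\<omega> \<in> space M. Z \<omega> < - x} / (L x * x powr (-\<alpha>))) \<longlongrightarrow> pm) at_top)"

definition sigma_gen :: "'a measure \<Rightarrow> (int \<Rightarrow> int \<Rightarrow> 'a \<Rightarrow> real) \<Rightarrow> nat \<Rightarrow> int set \<Rightarrow> 'a set set"
  where "sigma_gen M F p T = sigma_sets (space M)
     (\<Union>i\<in>{1..int p}. \<Union>t\<in>T. {F i t -` B \<inter> space M | B. B \<in> sets borel})"

definition mixing_coef :: "'a measure \<Rightarrow> (int \<Rightarrow> int \<Rightarrow> 'a \<Rightarrow> real) \<Rightarrow> nat \<Rightarrow> nat \<Rightarrow> real"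
  where "mixing_coef M F p h = Sup {\<bar>measure M (A \<inter> B) - measure M A * measure M B\<bar> | A B k.
     (k::int) \<ge> 1 \<and> A \<in> sigma_gen M F p {1..k} \<and> B \<in> sigma_gen M F p {k + int h..}}"

definition strongly_mixing_with_rate :: "'a measure \<Rightarrow> (int \<Rightarrow> int \<Rightarrow> 'a \<Rightarrow> real) \<Rightarrow> nat \<Rightarrow> (nat \<Rightarrow> real) \<Rightarrow> bool"
  where "strongly_mixing_with_rate M F p r \<longleftrightarrow>
     (\<forall>h. mixing_coef M F p h \<le> r h) \<and> r \<longlonglongrightarrow> 0"

section \<open>Stable laws (Samorodnitsky--Taqqu parametrization)\<close>

text \<open>beta: stability index in (0,2], b: skewness in [-1,1], c > 0: scale, mu: shift.\<close>
definition stable_law :: "real \<Rightarrow> real \<Rightarrow> real measure \<Rightarrow> bool"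
  where "stable_law \<beta> b \<nu> \<longleftrightarrow> real_distribution \<nu> \<and>
     (\<exists>c>0. \<exists>\<mu>. \<forall>u. char \<nu> u =
        (if \<beta> \<noteq> 1 then
           exp (- complex_of_real (c powr \<beta> * \<bar>u\<bar> powr \<beta>)
                  * (1 - \<i> * complex_of_real (b * sgn u * tan (pi * \<beta> / 2)))
                + \<i> * complex_of_real (\<mu> * u))
         else
           exp (- complex_of_real (c * \<bar>u\<bar>)
                  * (1 + \<i> * complex_of_real (b * (2 / pi) * sgn u * ln \<bar>u\<bar>))
                + \<i> * complex_of_real (\<mu> * u))))"

definition stable_totally_right_skewed :: "real \<Rightarrow> real measure \<Rightarrow> bool"
  where "stable_totally_right_skewed \<beta> \<nu> \<longleftrightarrow> stable_law \<beta> 1 \<nu>"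

definition pad_vec :: "nat \<Rightarrow> (nat \<Rightarrow> real) \<Rightarrow> (nat \<Rightarrow> real)"
  where "pad_vec p x = (\<lambda>i. if i \<in> {1..p} then x i else 0)"

definition conv_in_distr_vec :: "'a measure \<Rightarrow> (nat \<Rightarrow> 'a \<Rightarrow> nat \<Rightarrow> real) \<Rightarrow> nat \<Rightarrow> (nat \<Rightarrow> real) measure \<Rightarrow> bool"
  where "conv_in_distr_vec M Y p \<mu> \<longleftrightarrow>
     (\<forall>g :: (nat \<Rightarrow> real) \<Rightarrow> real. continuous_on UNIV g \<and> bounded (range g) \<longrightarrow>
        ((\<lambda>n. \<integral>\<omega>. g (pad_vec p (Y n \<omega>)) \<partial>M) \<longlongrightarrow> (\<integral>x. g (pad_vec p x) \<partial>\<mu>)) sequentially)"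

end

theory Submission
  imports Defs
begin

text \<open>
  Conditionally on the volatility field the sums \<open>S_i\<close> are independent, and each is a weighted sum of
  iid variables \<open>Z^2\<close> with regularly varying tail of index \<open>\<beta> = \<alpha>/2\<close>. With \<open>G(s) = P(s Z^2 > 1)\<close>
  and \<open>\<psi>\<close> the (centred) characteristic function of \<open>Z^2\<close> minus one, \<open>\<psi>(u s) \<sim> K(u) G(s)\<close> as
  \<open>s \<rightarrow> 0+\<close>, so the conditional characteristic function \<open>\<Prod>_t (1 + \<psi>(u \<sigma>_{it}^2/a_n^2))\<close> is close
  to \<open>exp (K(u) \<Sum>_t G(\<sigma>_{it}^2/a_n^2))\<close>. The sum in the exponent is the conditional expected number
  of exceedances of \<open>a_n\<close>: its mean is \<open>n P(|X| > a_n) \<rightarrow> 1\<close>, and mixing makes its variance vanish.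
  For \<open>\<alpha> > 2\<close> the centring leaves the term \<open>E Z^2 \<Sum>_t (\<sigma>_{it}^2 - E \<sigma>^2) / a_n^2\<close>, whose variance is
  \<open>O(n / a_n^4)\<close> by a Davydov type covariance inequality. Along almost surely convergent subsequences
  the conditional laws therefore converge to a fixed product of stable laws; independence in the
  limit comes from the limit of the exponent being deterministic.
\<close>

text \<open>The hypotheses control only moments of the volatility, so weights are compared with one
  another through Potter bounds: for \<open>l\<close> at least 1, \<open>G (l * s)\<close> is at
  most a constant times \<open>l powr \<gamma> * G s\<close>, for any \<gamma> above \<beta>. The
  moment order \<kappa> = max (2 + \<delta>) (\<alpha> + \<epsilon>) exceeds 2\<beta>, so \<gamma>
  can be chosen with 2\<gamma> < \<kappa>; then \<open>n * G (w / b n)\<close> has a moment of order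
  above 2 that stays bounded in n, and its covariances decay with the mixing rate. The exponent
  \<delta> / (2 + \<delta>) is (q - 2) / q at q = 2 + \<delta>, the rate that truncation at an
  optimal level gives for variables with q moments. The value \<alpha> = 2 separates two regimes.
  Below it there is no mean to subtract and the oscillatory integral of the tail converges only
  conditionally; above it subtracting the mean restores absolute convergence. The stable law is not
  built from a density: the existence half of Levy's continuity theorem yields it as a limit of
  conditional laws along one volatility path, and its parameters are read off the characteristic
  function.\<close>

section \<open>Regular variation at zero\<close>

text \<open>Tails are parametrised by the reciprocal level, \<open>G s = P(s Y > 1)\<close>, so that regular variation at infinity
  becomes regular variation at \<open>0+\<close> and a vanishing weight \<open>s = 0\<close> needs no separate treatment.\<close>

locale rv_tail =
  fixes G :: "real \<Rightarrow> real" and \<beta> :: real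
  assumes mono_G: "0 \<le> x \<Longrightarrow> x \<le> y \<Longrightarrow> G x \<le> G y"
    and G_le_1: "G x \<le> 1"
    and G_pos: "0 < x \<Longrightarrow> 0 < G x"
    and G_0: "G 0 = 0"
    and \<beta>_pos: "0 < \<beta>"
    and rv: "0 < c \<Longrightarrow> ((\<lambda>s. G (c * s) / G s) \<longlongrightarrow> c powr \<beta>) (at_right 0)"
begin

lemma G_nonneg: "0 \<le> x \<Longrightarrow> 0 \<le> G x"
  using G_pos[of x] G_0 by (cases "x = 0") auto

lemma potter_large:
  assumes "\<beta> < \<gamma>"
  obtains C where "C > 0" "\<And>s l. 0 < s \<Longrightarrow> 1 \<le> l \<Longrightarrow> G (l * s) \<le> C * l powr \<gamma> * G s"
proof -
  have "\<forall>\<^sub>F s in at_right 0. G (2 * s) / G s < 2 powr \<gamma>"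
    using order_tendstoD(2)[OF rv[of 2], of "2 powr \<gamma>"] assms by simp
  then obtain s0 where s0: "s0 > 0" "\<And>s. 0 < s \<Longrightarrow> s < s0 \<Longrightarrow> G (2 * s) / G s < 2 powr \<gamma>"
    unfolding eventually_at_right_field by auto
  define H where "H s = G (min s s0)" for s
  have H2: "H (2 * s) \<le> 2 powr \<gamma> * H s" if "s > 0" for s
  proof (cases "s < s0")
    case True
    have "H (2 * s) \<le> G (2 * s)" using that s0 by (auto simp: H_def intro!: mono_G)
    also have "\<dots> \<le> 2 powr \<gamma> * G s" using s0(2)[OF that True] G_pos[OF that] by (simp add: field_simps)
    finally show ?thesis using True by (simp add: H_def)
  next
    case False
    have "1 * G s0 \<le> 2 powr \<gamma> * G s0"
      using assms \<beta>_pos G_pos[OF s0(1)] by (intro mult_right_mono) (auto simp: ge_one_powr_ge_zero)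
    then show ?thesis using False that s0 by (simp add: H_def min_def)
  qed
  have Hk: "H (2 ^ k * s) \<le> (2 ^ k) powr \<gamma> * H s" if "s > 0" for s k
  proof (induction k)
    case (Suc k)
    have "H (2 ^ Suc k * s) \<le> 2 powr \<gamma> * H (2 ^ k * s)"
      using H2[of "2 ^ k * s"] that by (simp add: mult.assoc)
    also have "\<dots> \<le> 2 powr \<gamma> * ((2 ^ k) powr \<gamma> * H s)" by (intro mult_left_mono Suc) auto
    also have "\<dots> = (2 ^ Suc k) powr \<gamma> * H s" by (simp add: powr_mult)
    finally show ?case .
  qed simp
  have GH: "G s \<le> H s / G s0" if "s > 0" for s
  proof (cases "s < s0")
    case True
    then show ?thesis using G_pos[OF that] G_pos[OF s0(1)] G_le_1[of s0]
      by (simp add: H_def field_simps mult_left_le)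
  next
    case False
    then show ?thesis using G_pos[OF s0(1)] G_le_1[of s] by (simp add: H_def)
  qed
  show ?thesis
  \<comment> \<open>\<open>2 powr \<gamma>\<close> pays for rounding \<open>l\<close> up to a power
    of 2, \<open>1 / G s0\<close> for unfreezing \<open>H\<close>.\<close>
  proof (rule that[of "2 powr \<gamma> / G s0"])
    show "2 powr \<gamma> / G s0 > 0" using G_pos[OF s0(1)] by simp
    fix s l :: real assume s: "0 < s" and l: "1 \<le> l"
    define k where "k = nat \<lceil>log 2 l\<rceil>"
    have log0: "log 2 l \<ge> 0" using l by simp
    have k: "log 2 l \<le> real k" "real k \<le> log 2 l + 1" unfolding k_def using log0 by linarith+
    have k1: "l \<le> 2 ^ k" using k(1) l by (simp add: log_le_iff powr_realpow)
    have "2 powr real k \<le> 2 powr (log 2 l + 1)" using k(2) by simp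
    then have k2: "2 ^ k \<le> 2 * l" using l by (simp add: powr_add powr_realpow)
    have "G (l * s) \<le> G (2 ^ k * s)" using s l k1 by (intro mono_G) auto
    also have "\<dots> \<le> H (2 ^ k * s) / G s0" using s by (intro GH) auto
    also have "\<dots> \<le> (2 ^ k) powr \<gamma> * H s / G s0"
      using G_pos[OF s0(1)] Hk[OF s] by (simp add: divide_right_mono)
    also have "\<dots> \<le> (2 * l) powr \<gamma> * G s / G s0"
      using G_pos[OF s0(1)] k2 assms \<beta>_pos s s0
      by (intro divide_right_mono mult_mono powr_mono2) (auto simp: H_def intro!: mono_G G_nonneg)
    also have "\<dots> = 2 powr \<gamma> / G s0 * l powr \<gamma> * G s" using l by (simp add: powr_mult)
    finally show "G (l * s) \<le> 2 powr \<gamma> / G s0 * l powr \<gamma> * G s" .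
  qed
qed

text \<open>Halving replaces doubling. The iterates of an argument below \<open>s0\<close> stay
  below it, so the ratio bound applies at every step and nothing has to be frozen.\<close>

lemma potter_small:
  assumes "0 \<le> \<gamma>" "\<gamma> < \<beta>"
  obtains C s0 where "C > 0" "s0 > 0"
    "\<And>s l. 0 < s \<Longrightarrow> s < s0 \<Longrightarrow> 0 < l \<Longrightarrow> l \<le> 1 \<Longrightarrow> G (l * s) \<le> C * l powr \<gamma> * G s"
proof -
  have "\<forall>\<^sub>F s in at_right 0. G (1/2 * s) / G s < (1/2) powr \<gamma>"
    using order_tendstoD(2)[OF rv[of "1/2"], of "(1/2) powr \<gamma>"] assms
    by (auto simp: powr_less_mono' powr_divide field_simps)
  then obtain s0 where s0: "s0 > 0" "\<And>s. 0 < s \<Longrightarrow> s < s0 \<Longrightarrow> G (1/2 * s) / G s < (1/2) powr \<gamma>"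
    unfolding eventually_at_right_field by auto
  have Hk: "G ((1/2) ^ k * s) \<le> ((1/2) ^ k) powr \<gamma> * G s" if "s > 0" "s < s0" for s k
  proof (induction k)
    case (Suc k)
    have ks: "(1/2) ^ k * s < s0" "(1/2) ^ k * s > 0" 
    proof -
      have "(1/2) ^ k * s \<le> 1 * s" using that by (intro mult_right_mono power_le_one) auto
      then show "(1/2) ^ k * s < s0" using that by linarith
    qed (use that in auto)
    have "G ((1/2) ^ Suc k * s) \<le> (1/2) powr \<gamma> * G ((1/2) ^ k * s)"
      using s0(2)[OF ks(2,1)] G_pos[OF ks(2)] by (simp add: pos_divide_less_eq mult.assoc)
    also have "\<dots> \<le> (1/2) powr \<gamma> * (((1/2) ^ k) powr \<gamma> * G s)" by (intro mult_left_mono Suc) auto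
    also have "\<dots> = ((1/2) ^ Suc k) powr \<gamma> * G s" unfolding power_Suc by (subst powr_mult) auto
    finally show ?case .
  qed simp
  show ?thesis
  proof (rule that[of "2 powr \<gamma>" s0])
    fix s l :: real assume s: "0 < s" "s < s0" and l: "0 < l" "l \<le> 1"
    \<comment> \<open>Rounding down puts \<open>(1/2) ^ k\<close> between \<open>l\<close> and
      \<open>2 * l\<close>, whence the constant \<open>2 powr \<gamma>\<close>.\<close>
    define k where "k = nat \<lfloor>log 2 (1/l)\<rfloor>"
    have log0: "log 2 (1/l) \<ge> 0" using l by simp
    have k: "log 2 (1/l) \<ge> real k" "real k + 1 \<ge> log 2 (1/l)" unfolding k_def using log0 by linarith+
    have "2 powr real k \<le> 2 powr (log 2 (1/l))" using k(1) by simp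
    then have k1: "2 ^ k \<le> 1 / l" using l by (simp add: powr_realpow)
    have "2 powr (log 2 (1/l)) \<le> 2 powr (real k + 1)" using k(2) by simp
    then have k2: "1 / l \<le> 2 * 2 ^ k" using l by (simp add: powr_add powr_realpow)
    have k1': "l \<le> (1/2) ^ k" and k2': "(1/2)^k \<le> 2 * l" using k1 k2 l by (simp_all add: field_simps power_one_over)
    have "G (l * s) \<le> G ((1/2) ^ k * s)" using s l k1' by (intro mono_G) auto
    also have "\<dots> \<le> ((1/2) ^ k) powr \<gamma> * G s" by (rule Hk[OF s])
    also have "\<dots> \<le> (2 * l) powr \<gamma> * G s"
      using k2' assms s l by (intro mult_right_mono powr_mono2 G_nonneg) auto
    also have "\<dots> = 2 powr \<gamma> * l powr \<gamma> * G s" using l by (simp add: powr_mult)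
    finally show "G (l * s) \<le> 2 powr \<gamma> * l powr \<gamma> * G s" .
  qed (use s0 in auto)
qed

text \<open>\<open>potter_large\<close> with multiplier \<open>1 / s\<close> moves \<open>s\<close>
  to the fixed point 1. The bound makes quadratic errors negligible against \<open>G s\<close>, and
  turns bounds on \<open>n * G (1 / b n)\<close> into growth of \<open>b n\<close>.\<close>

lemma G_lower:
  assumes "\<beta> < \<gamma>"
  obtains c where "c > 0" "\<And>s. 0 < s \<Longrightarrow> s \<le> 1 \<Longrightarrow> c * s powr \<gamma> \<le> G s"
proof -
  obtain C where C: "C > 0" "\<And>s l. 0 < s \<Longrightarrow> 1 \<le> l \<Longrightarrow> G (l * s) \<le> C * l powr \<gamma> * G s"
    using potter_large[OF assms] by metis
  show ?thesis
  proof (rule that[of "G 1 / C"])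
    show "G 1 / C > 0" using C(1) G_pos[of 1] by simp
    fix s :: real assume s: "0 < s" "s \<le> 1"
    have "G (1 / s * s) \<le> C * (1 / s) powr \<gamma> * G s" using C(2)[of s "1/s"] s by simp
    then show "G 1 / C * s powr \<gamma> \<le> G s"
      using s C(1) by (simp add: powr_divide field_simps)
  qed
qed

end

section \<open>Integrals behind the stable exponent\<close>

lemma set_lebesgue_integral_of_nn_integral:
  fixes f :: "real \<Rightarrow> real"
  assumes "f \<in> borel_measurable borel" "\<And>x. 0 < x \<Longrightarrow> 0 \<le> f x"
    and "(\<integral>\<^sup>+x\<in>{0<..}. ennreal (f x) \<partial>lborel) = ennreal r" "0 \<le> r"
  shows "set_integrable lborel {0<..} f" "(LINT x:{0<..}|lborel. f x) = r"
proof -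
  have "has_bochner_integral lborel (\<lambda>x. indicator {0<..} x *\<^sub>R f x) r"
  proof (rule has_bochner_integral_nn_integral)
    have "(\<integral>\<^sup>+ x. ennreal (indicator {0<..} x *\<^sub>R f x) \<partial>lborel) = (\<integral>\<^sup>+x\<in>{0<..}. ennreal (f x) \<partial>lborel)"
      by (intro nn_integral_cong) (auto split: split_indicator)
    then show "(\<integral>\<^sup>+ x. ennreal (indicator {0<..} x *\<^sub>R f x) \<partial>lborel) = ennreal r" using assms by simp
  qed (use assms in \<open>auto split: split_indicator\<close>)
  then show "set_integrable lborel {0<..} f" "(LINT x:{0<..}|lborel. f x) = r"
    by (auto simp: set_integrable_def set_lebesgue_integral_def has_bochner_integral_iff)
qed


section \<open>Gamma and Beta integrals\<close>

lemma nn_integral_Gamma_scaled: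
  fixes a l :: real
  assumes a: "a > 0" and l: "l > 0"
  shows "(\<integral>\<^sup>+t\<in>{0<..}. ennreal (t powr (a - 1) * exp (- (l * t))) \<partial>lborel) = ennreal (Gamma a / l powr a)"
proof -
  have "ennreal (Gamma a) = (\<integral>\<^sup>+t. ennreal (indicator {0..} t * t powr (a - 1) / exp t) \<partial>lborel)"
    by (rule Gamma_conv_nn_integral_real[OF a])
  also have "\<dots> = ennreal l * (\<integral>\<^sup>+x. ennreal (indicator {0..} (l * x) * (l * x) powr (a - 1) / exp (l * x)) \<partial>lborel)"
    using l by (subst nn_integral_real_affine[where c = l and t = 0]) auto
  \<comment> \<open>The half-lines \<open>{0..}\<close> and \<open>{0<..}\<close> differ by a null
    set.\<close>
  also have "(\<integral>\<^sup>+x. ennreal (indicator {0..} (l * x) * (l * x) powr (a - 1) / exp (l * x)) \<partial>lborel) =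
     (\<integral>\<^sup>+x. ennreal (l powr (a - 1)) * (ennreal (x powr (a - 1) * exp (- (l * x))) * indicator {0<..} x) \<partial>lborel)"
    using l by (intro nn_integral_cong_AE AE_I[where N = "{0}"])
      (auto split: split_indicator simp: powr_mult zero_le_mult_iff exp_minus field_simps ennreal_mult'[symmetric])
  also have "\<dots> = ennreal (l powr (a - 1)) * (\<integral>\<^sup>+t\<in>{0<..}. ennreal (t powr (a - 1) * exp (- (l * t))) \<partial>lborel)"
    by (subst nn_integral_cmult) auto
  finally have "ennreal (1 / l powr a) * ennreal (Gamma a) = ennreal (1 / l powr a) *
     (ennreal l * (ennreal (l powr (a - 1)) * (\<integral>\<^sup>+t\<in>{0<..}. ennreal (t powr (a - 1) * exp (- (l * t))) \<partial>lborel)))"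
    by simp
  also have "\<dots> = ennreal (1 / l powr a * l * l powr (a - 1)) * (\<integral>\<^sup>+t\<in>{0<..}. ennreal (t powr (a - 1) * exp (- (l * t))) \<partial>lborel)"
    using l by (subst ennreal_mult, simp, simp, subst ennreal_mult, simp, simp) (simp only: mult.assoc)
  also have "1 / l powr a * l * l powr (a - 1) = 1" using l by (simp add: powr_diff)
  finally show ?thesis using Gamma_real_pos[OF a] by (simp add: ennreal_mult'[symmetric])
qed

text \<open>Substituting the square of the variable reduces this to
  \<open>nn_integral_Gamma_scaled\<close> at \<open>a / 2\<close>. The substitution is made for the
  Henstock-Kurzweil integral, and nonnegativity carries the value from and back to the Lebesgue
  integral.\<close>

lemma nn_integral_Gamma_square:
  fixes a l :: real
  assumes a: "a > 0" and l: "l > 0"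
  shows "(\<integral>\<^sup>+t\<in>{0<..}. ennreal (t powr (a - 1) * exp (- (l * t\<^sup>2))) \<partial>lborel) = ennreal (Gamma (a / 2) / (2 * l powr (a / 2)))"
proof -
  \<comment> \<open>Cancels the factor 2 of the Jacobian \<open>2 * x\<close>.\<close>
  define c :: real where "c = 1 / 2"
  have c0: "0 \<le> c" by (simp add: c_def)
  define f where "f t = c * (t powr (a / 2 - 1) * exp (- (l * t)))" for t
  have fp: "f t \<ge> 0" for t by (simp add: f_def c_def)
  have [measurable]: "f \<in> borel_measurable borel" unfolding f_def by measurable
  have nf: "(\<integral>\<^sup>+t\<in>{0<..}. ennreal (f t) \<partial>lborel) = ennreal (Gamma (a / 2) / (2 * l powr (a / 2)))"
  proof -
    have "(\<integral>\<^sup>+t\<in>{0<..}. ennreal (f t) \<partial>lborel) =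
        (\<integral>\<^sup>+t. ennreal c * (ennreal (t powr (a/2 - 1) * exp (- (l * t))) * indicator {0<..} t) \<partial>lborel)"
      by (intro nn_integral_cong) (simp add: f_def ennreal_mult'[OF c0] mult.assoc)
    also have "\<dots> = ennreal c * ennreal (Gamma (a/2) / l powr (a/2))"
      using nn_integral_Gamma_scaled[of "a/2" l] a l by (subst nn_integral_cmult) auto
    also have "\<dots> = ennreal (Gamma (a / 2) / (2 * l powr (a / 2)))"
      by (subst ennreal_mult'[symmetric]) (auto simp: c_def)
    finally show ?thesis .
  qed
  have hi: "(f has_integral (Gamma (a / 2) / (2 * l powr (a / 2)))) {0<..}"
    using set_lebesgue_integral_of_nn_integral[OF _ _ nf] set_borel_integral_eq_integral[of "{0<..}" f] a
    by (auto simp: fp Gamma_real_nonneg has_integral_iff)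
  have img: "(\<lambda>x::real. x\<^sup>2) ` {0<..} = {0<..}"
  proof safe
    fix x :: real assume "x > 0"
    then show "x \<in> (\<lambda>x::real. x\<^sup>2) ` {0<..}" by (intro image_eqI[of _ _ "sqrt x"]) auto
  qed auto
  have "(\<lambda>x. \<bar>2 * x\<bar> * f (x\<^sup>2)) absolutely_integrable_on {0<..} \<and>
      integral {0<..} (\<lambda>x. \<bar>2 * x\<bar> * f (x\<^sup>2)) = Gamma (a / 2) / (2 * l powr (a / 2))"
  proof (subst has_absolute_integral_change_of_variables_1'[where g = "\<lambda>x. x\<^sup>2" and g' = "\<lambda>x. 2 * x"])
    show "inj_on (\<lambda>x::real. x\<^sup>2) {0<..}" by (auto simp: inj_on_def)
    show "f absolutely_integrable_on (\<lambda>x::real. x\<^sup>2) ` {0<..} \<and> integral ((\<lambda>x::real. x\<^sup>2) ` {0<..}) f = Gamma (a / 2) / (2 * l powr (a / 2))"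
      unfolding img using hi fp by (auto intro!: nonnegative_absolutely_integrable_1 simp: has_integral_iff)
  qed (auto intro!: derivative_eq_intros)
  then have "((\<lambda>x. \<bar>2 * x\<bar> * f (x\<^sup>2)) has_integral Gamma (a / 2) / (2 * l powr (a / 2))) {0<..}"
    by (simp add: has_integral_iff absolutely_integrable_on_def)
  then have "(\<integral>\<^sup>+x. ennreal (indicator {0<..} x * (\<bar>2 * x\<bar> * f (x\<^sup>2))) \<partial>lborel) = ennreal (Gamma (a / 2) / (2 * l powr (a / 2)))"
    by (intro nn_integral_has_integral_lebesgue) (auto simp: fp)
  also have "(\<integral>\<^sup>+x. ennreal (indicator {0<..} x * (\<bar>2 * x\<bar> * f (x\<^sup>2))) \<partial>lborel) = (\<integral>\<^sup>+t\<in>{0<..}. ennreal (t powr (a - 1) * exp (- (l * t\<^sup>2))) \<partial>lborel)"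
  proof (intro nn_integral_cong)
    fix x :: real
    have "x * (x\<^sup>2) powr (a / 2 - 1) = x powr (a - 1)" if "x > 0"
    proof -
      have "x\<^sup>2 = x powr 2" using that by simp
      then have "x * (x\<^sup>2) powr (a / 2 - 1) = x powr 1 * x powr (2 * (a / 2 - 1))" using that by (simp only: powr_powr powr_one)
      also have "\<dots> = x powr (1 + 2 * (a / 2 - 1))" by (rule powr_add[symmetric])
      also have "1 + 2 * (a / 2 - 1) = a - 1" by simp
      finally show ?thesis .
    qed
    then show "ennreal (indicator {0<..} x * (\<bar>2 * x\<bar> * f (x\<^sup>2))) = ennreal (x powr (a - 1) * exp (- (l * x\<^sup>2))) * indicator {0<..} x"
      by (auto split: split_indicator simp: f_def c_def)
  qed
  finally show ?thesis .
qed

text \<open>Integers are covered too: there one of the two Gamma values is a pole, set to 0, and the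
  right side is a division by zero.\<close>

lemma Gamma_reflection_real_nonint:
  fixes a :: real
  shows "Gamma a * Gamma (1 - a) = pi / sin (pi * a)"
proof -
  have "complex_of_real (Gamma a * Gamma (1 - a)) = complex_of_real (pi / sin (pi * a))"
    using Gamma_reflection_complex[of "of_real a"]
    by (simp add: Gamma_complex_of_real[symmetric] sin_of_real[symmetric] del: Gamma_complex_of_real)
  then show ?thesis by (simp only: of_real_eq_iff)
qed

text \<open>\<open>1 / (1 + l\<^sup>2)\<close> is the integral of
  \<open>exp (- ((1 + l\<^sup>2) * u))\<close> over positive \<open>u\<close>. After Tonelli the
  integral in \<open>l\<close> is a Gamma integral at \<open>a / 2\<close> and the one in
  \<open>u\<close> a Gamma integral at \<open>1 - a / 2\<close>; both arguments are positive exactly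
  when \<open>a\<close> lies strictly between 0 and 2. Reflection evaluates the product.\<close>

lemma nn_integral_powr_div_one_plus_square:
  fixes a :: real
  assumes a: "0 < a" "a < 2"
  shows "(\<integral>\<^sup>+l\<in>{0<..}. ennreal (l powr (a - 1) / (1 + l\<^sup>2)) \<partial>lborel) = ennreal (pi / 2 / sin (pi * a / 2))"
proof -
  let ?f = "\<lambda>l u. ennreal (l powr (a - 1) * exp (- ((1 + l\<^sup>2) * u))) * indicator {0<..} u * indicator {0<..} l"
  have "(\<integral>\<^sup>+l\<in>{0<..}. ennreal (l powr (a - 1) / (1 + l\<^sup>2)) \<partial>lborel) =
    (\<integral>\<^sup>+l. (\<integral>\<^sup>+u. ?f l u \<partial>lborel) \<partial>lborel)"
  proof (intro nn_integral_cong)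
    fix l :: real
    have p: "1 + l\<^sup>2 > 0" by (simp add: add_pos_nonneg)
    have "(\<integral>\<^sup>+u. ?f l u \<partial>lborel)
      = (\<integral>\<^sup>+u. (ennreal (l powr (a - 1)) * indicator {0<..} l) * (ennreal (u powr (1 - 1) * exp (- ((1 + l\<^sup>2) * u))) * indicator {0<..} u) \<partial>lborel)"
      by (intro nn_integral_cong) (auto split: split_indicator simp: ennreal_mult')
    also have "\<dots> = (ennreal (l powr (a - 1)) * indicator {0<..} l) * ennreal (Gamma 1 / (1 + l\<^sup>2) powr 1)"
      by (subst nn_integral_cmult, simp, subst nn_integral_Gamma_scaled) (use p in auto)
    also have "\<dots> = ennreal (l powr (a - 1) / (1 + l\<^sup>2)) * indicator {0<..} l"
      using p by (auto split: split_indicator simp: ennreal_mult'[symmetric])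
    finally show "ennreal (l powr (a - 1) / (1 + l\<^sup>2)) * indicator {0<..} l = 
      (\<integral>\<^sup>+u. ?f l u \<partial>lborel)" ..
  qed
  also have "\<dots> = (\<integral>\<^sup>+u. (\<integral>\<^sup>+l. ?f l u \<partial>lborel) \<partial>lborel)"
    by (rule lborel_pair.Fubini') simp
  also have "\<dots> = (\<integral>\<^sup>+u. ennreal (Gamma (a/2) / 2) * (ennreal (u powr ((1 - a / 2) - 1) * exp (- (1 * u))) * indicator {0<..} u) \<partial>lborel)"
  proof (intro nn_integral_cong)
    fix u :: real
    show "(\<integral>\<^sup>+l. ?f l u \<partial>lborel) =
      ennreal (Gamma (a/2) / 2) * (ennreal (u powr ((1 - a / 2) - 1) * exp (- (1 * u))) * indicator {0<..} u)"
    proof (cases "u > 0")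
      case True
      have "(\<integral>\<^sup>+l. ?f l u \<partial>lborel) =
         (\<integral>\<^sup>+l. ennreal (exp (- u)) * (ennreal (l powr (a - 1) * exp (- (u * l\<^sup>2))) * indicator {0<..} l) \<partial>lborel)"
      proof (intro nn_integral_cong)
        fix l :: real
        have "exp (- ((1 + l\<^sup>2) * u)) = exp (- u) * exp (- (u * l\<^sup>2))"
          by (simp add: exp_add[symmetric] algebra_simps)
        then have "l powr (a - 1) * exp (- ((1 + l\<^sup>2) * u)) = exp (- u) * (l powr (a - 1) * exp (- (u * l\<^sup>2)))"
          by simp
        then show "?f l u =
           ennreal (exp (- u)) * (ennreal (l powr (a - 1) * exp (- (u * l\<^sup>2))) * indicator {0<..} l)"
          using True by (simp only: ennreal_mult'[OF exp_ge_zero]) (simp add: mult.assoc)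
      qed
      also have "\<dots> = ennreal (exp (- u)) * ennreal (Gamma (a / 2) / (2 * u powr (a / 2)))"
        using True a by (subst nn_integral_cmult, simp, subst nn_integral_Gamma_square) auto
      also have "\<dots> = ennreal (Gamma (a/2) / 2) * (ennreal (u powr ((1 - a / 2) - 1) * exp (- (1 * u))) * indicator {0<..} u)"
        using True a by (simp add: ennreal_mult'[symmetric] powr_minus field_simps Gamma_real_nonneg)
      finally show ?thesis .
    qed simp
  qed
  also have "\<dots> = ennreal (Gamma (a/2) / 2) * ennreal (Gamma (1 - a/2) / 1 powr (1 - a/2))"
    using a by (subst nn_integral_cmult, simp, subst nn_integral_Gamma_scaled) auto
  also have "\<dots> = ennreal (Gamma (a / 2) * Gamma (1 - a / 2) / 2)"
    using a by (subst ennreal_mult'[symmetric]) (auto simp: Gamma_real_nonneg)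
  also have "\<dots> = ennreal (pi / 2 / sin (pi * a / 2))"
    by (subst Gamma_reflection_real_nonint) (simp add: mult.commute)
  finally show ?thesis .
qed


section \<open>Oscillatory integrals and the constant of the stable exponent\<close>

lemma LBINT_exp_complex:
  fixes z :: complex
  assumes z: "Re z < 0"
  shows "set_integrable lborel {0<..} (\<lambda>x. exp (of_real x * z))"
    and "(LINT x:{0<..}|lborel. exp (of_real x * z)) = - 1 / z"
proof -
  have "set_integrable lborel {0<..} (\<lambda>t. t powr (1 - 1) * exp (- (- Re z * t)))"
    using z by (intro set_lebesgue_integral_of_nn_integral(1)[OF _ _ nn_integral_Gamma_scaled]) auto
  then have "set_integrable lborel {0<..} (\<lambda>t. exp (Re z * t))"
    by (rule set_integrable_cong[THEN iffD1, rotated 3]) auto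
  then show I: "set_integrable lborel {0<..} (\<lambda>x. exp (of_real x * z))"
    unfolding set_integrable_def
    by (rule Bochner_Integration.integrable_bound) (auto simp: norm_exp_eq_Re mult.commute split: split_indicator)
  have z0: "z \<noteq> 0" using z by auto
  have "(LBINT x=0..\<infinity>. exp (of_real x * z)) = 0 - 1 / z"
  proof (rule interval_integral_FTC_integrable)
    show "((\<lambda>x. exp (of_real x * z) / z) has_vector_derivative exp (of_real x * z)) (at x)" for x :: real
      using z0 by (auto intro!: derivative_eq_intros has_vector_derivative_real_field)
    show "isCont (\<lambda>x. exp (of_real x * z)) x" for x :: real by simp
    show "set_integrable lborel (einterval 0 \<infinity>) (\<lambda>x. exp (of_real x * z))"
      using I by (simp add: einterval_def greaterThan_def zero_ereal_def)
    show "(((\<lambda>x. exp (of_real x * z) / z) \<circ> real_of_ereal) \<longlongrightarrow> 1 / z) (at_right 0)"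
      unfolding zero_ereal_def ereal_tendsto_simps using z0 by (auto intro!: tendsto_eq_intros)
    show "(((\<lambda>x. exp (of_real x * z) / z) \<circ> real_of_ereal) \<longlongrightarrow> 0) (at_left \<infinity>)"
      unfolding ereal_tendsto_simps
    proof (rule tendsto_norm_zero_cancel)
      have "((\<lambda>x. exp (Re z * x)) \<longlongrightarrow> 0) at_top"
        using z by (intro filterlim_compose[OF exp_at_bot] filterlim_tendsto_neg_mult_at_bot[OF tendsto_const] filterlim_ident) auto
      then show "((\<lambda>x. norm (exp (of_real x * z) / z)) \<longlongrightarrow> 0) at_top"
        by (simp add: norm_divide norm_exp_eq_Re mult.commute tendsto_divide_zero)
    qed
  qed simp
  then show "(LINT x:{0<..}|lborel. exp (of_real x * z)) = - 1 / z"
    by (simp add: interval_lebesgue_integral_def einterval_def greaterThan_def zero_ereal_def)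
qed

lemma norm_iexp_minus_one: "norm (iexp x - 1) \<le> min 2 \<bar>x\<bar>"
  using iexp_approx1[of x 0] norm_triangle_ineq4[of "iexp x" 1] by simp

text \<open>Meant for \<gamma> strictly between 1 and 2, where the integral converges absolutely.
  With \<gamma> = \<beta> + 1 it is, up to the factor \<beta>, the Levy integral of
  \<open>iexp x - 1\<close> for \<beta> < 1; with \<gamma> = \<beta> it is, up to the factor
  \<open>\<i>\<close>, the derivative of \<open>iexp x - 1 - \<i> * x\<close> integrated against the
  tail \<open>x powr (- \<beta>)\<close>.\<close>

definition Kint :: "real \<Rightarrow> complex" where
  "Kint \<gamma> = (LINT x:{0<..}|lborel. (iexp x - 1) * of_real (x powr (- \<gamma>)))"

lemma set_integrable_nonneg_of_integrable_on:
  fixes f :: "real \<Rightarrow> real"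
  assumes "f integrable_on S" "\<And>x. x \<in> S \<Longrightarrow> 0 \<le> f x" "f \<in> borel_measurable borel" "S \<in> sets borel"
  shows "set_integrable lborel S f"
proof -
  have "set_integrable lebesgue S f" using assms by (intro nonnegative_absolutely_integrable_1)
  then show ?thesis using assms(3,4) unfolding set_integrable_def by (subst (asm) integrable_completion) auto
qed

lemma set_integrable_powr_0_1:
  fixes a :: real
  assumes "a > -1"
  shows "set_integrable lborel {0<..1} (\<lambda>x. x powr a)"
  using integrable_on_powr_from_0'[OF assms, of 1] by (intro set_integrable_nonneg_of_integrable_on) auto

lemma set_integrable_powr_1_inf:
  fixes a :: real
  assumes "a < -1"
  shows "set_integrable lborel {1<..} (\<lambda>x. x powr a)"
proof -
  have "set_integrable lborel {1..} (\<lambda>x. x powr a)"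
    using has_integral_powr_to_inf[OF assms, of 1]
    by (intro set_integrable_nonneg_of_integrable_on) (auto simp: has_integral_iff)
  then show ?thesis by (rule set_integrable_subset) auto
qed

text \<open>Up to 1 the integrand is \<open>x powr (1 - \<gamma>)\<close>, integrable because
  \<gamma> < 2; beyond 1 it is at most \<open>2 * x powr (- \<gamma>)\<close>, integrable because
  \<gamma> > 1. It dominates whatever \<open>norm_iexp_minus_one\<close> bounds.\<close>

lemma set_integrable_min_powr:
  fixes \<gamma> :: real
  assumes "1 < \<gamma>" "\<gamma> < 2"
  shows "set_integrable lborel {0<..} (\<lambda>x. min 2 x * x powr (- \<gamma>))"
proof -
  have 1: "set_integrable lborel {0<..1} (\<lambda>x. min 2 x * x powr (- \<gamma>))"
  proof (rule set_integrable_cong[THEN iffD1, OF refl refl _ set_integrable_powr_0_1[of "1 - \<gamma>"]])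
    show "x powr (1 - \<gamma>) = min 2 x * x powr - \<gamma>" if "x \<in> {0<..1}" for x
      using that by (auto simp: powr_diff powr_minus field_simps)
  qed (use assms in auto)
  have 2: "set_integrable lborel {1<..} (\<lambda>x. min 2 x * x powr (- \<gamma>))"
  proof (rule set_integrable_bound)
    show "set_integrable lborel {1<..} (\<lambda>x. 2 * x powr (- \<gamma>))"
      using set_integrable_powr_1_inf[of "- \<gamma>"] assms by simp
  qed (auto simp: set_borel_measurable_def abs_mult mult_right_mono)
  have "{0<..} = {0<..1} \<union> {1::real<..}" by auto
  then show ?thesis using set_integrable_Un[OF 1 2] by simp
qed

lemma set_integrable_Kint:
  assumes "1 < \<gamma>" "\<gamma> < 2"
  shows "set_integrable lborel {0<..} (\<lambda>x. (iexp x - 1) * of_real (x powr (- \<gamma>)))"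
proof (rule set_integrable_bound[OF set_integrable_min_powr[OF assms]])
  show "AE x in lborel. x \<in> {0<..} \<longrightarrow> norm ((iexp x - 1) * of_real (x powr - \<gamma>)) \<le> norm (min 2 x * x powr - \<gamma>)"
  proof (intro AE_I2 impI)
    fix x :: real assume "x \<in> {0<..}"
    then show "norm ((iexp x - 1) * of_real (x powr - \<gamma>)) \<le> norm (min 2 x * x powr - \<gamma>)"
      using norm_iexp_minus_one[of x] by (simp add: norm_mult abs_mult mult_right_mono del: min.bounded_iff)
  qed
qed (simp add: set_borel_measurable_def)

text \<open>Write \<open>x powr (-\<gamma>)\<close> as a Gamma integral in \<open>l\<close>; after exchanging the integrals the inner one is
  \<open>1 / (l - \<i>) - 1 / l\<close>, which leaves two Beta integrals.\<close>

lemma Kint_eq: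
  assumes \<gamma>: "1 < \<gamma>" "\<gamma> < 2"
  shows "Kint \<gamma> = of_real (pi / (2 * Gamma \<gamma>)) * (- of_real (1 / sin (pi * (\<gamma> - 1) / 2)) + \<i> * of_real (1 / sin (pi * \<gamma> / 2)))"
proof -
  define a b where "a = 1 / sin (pi * (\<gamma> - 1) / 2)" and "b = 1 / sin (pi * \<gamma> / 2)"
  have G0: "Gamma \<gamma> > 0" using \<gamma> by (intro Gamma_real_pos) auto
  define f where "f l x = indicator {0<..} l *\<^sub>R indicator {0<..} x *\<^sub>R ((iexp x - 1) * of_real (l powr (\<gamma> - 1) * exp (- (x * l))))" for l x :: real
  have f_meas[measurable]: "(\<lambda>(l,x). f l x) \<in> borel_measurable (lborel \<Otimes>\<^sub>M lborel)"
    unfolding f_def by measurable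
  have fl: "set_integrable lborel {0<..} (\<lambda>l. l powr (\<gamma> - 1) * exp (- (x * l)))"
      "(LINT l:{0<..}|lborel. l powr (\<gamma> - 1) * exp (- (x * l))) = Gamma \<gamma> * x powr (- \<gamma>)" if "x > 0" for x
    using set_lebesgue_integral_of_nn_integral[OF _ _ nn_integral_Gamma_scaled[of \<gamma> x]] that \<gamma> G0
    by (auto simp: powr_minus field_simps)
  have fl': "integrable lborel (\<lambda>l. f l x)" for x
    unfolding f_def using fl(1)[of x]
    by (cases "x > 0") (auto simp: set_integrable_def scaleR_conv_of_real mult.assoc
        intro!: integrable_mult_right simp flip: of_real_mult simp del: of_real_mult
        dest!: integrable_of_real[where 'a=complex] simp: mult.left_commute[of "of_real _" "iexp x - 1"])
  have fl_val: "(\<integral>l. f l x \<partial>lborel) = of_real (Gamma \<gamma>) * (indicator {0<..} x *\<^sub>R ((iexp x - 1) * of_real (x powr (- \<gamma>))))" for x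
  proof (cases "x > 0")
    case True
    have "(\<integral>l. f l x \<partial>lborel) = (\<integral>l. (iexp x - 1) * of_real (indicator {0<..} l *\<^sub>R (l powr (\<gamma> - 1) * exp (- (x * l)))) \<partial>lborel)"
      using True by (intro Bochner_Integration.integral_cong) (auto simp: f_def split: split_indicator)
    also have "\<dots> = (iexp x - 1) * of_real (LINT l:{0<..}|lborel. l powr (\<gamma> - 1) * exp (- (x * l)))"
      unfolding set_lebesgue_integral_def by (simp only: integral_mult_right_zero integral_complex_of_real)
    finally show ?thesis using True by (simp add: fl(2))
  qed (simp add: f_def)
  have norm_val: "(\<integral>l. norm (f l x) \<partial>lborel) = Gamma \<gamma> * (indicator {0<..} x *\<^sub>R (norm (iexp x - 1) * x powr (- \<gamma>)))" for x
  proof (cases "x > 0")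
    case True
    have "(\<integral>l. norm (f l x) \<partial>lborel) = (\<integral>l. norm (iexp x - 1) * (indicator {0<..} l *\<^sub>R (l powr (\<gamma> - 1) * exp (- (x * l)))) \<partial>lborel)"
      using True by (intro Bochner_Integration.integral_cong) (auto simp: f_def norm_mult split: split_indicator)
    also have "\<dots> = norm (iexp x - 1) * (LINT l:{0<..}|lborel. l powr (\<gamma> - 1) * exp (- (x * l)))"
      unfolding set_lebesgue_integral_def by (simp only: integral_mult_right_zero)
    finally show ?thesis using True by (simp add: fl(2))
  qed (simp add: f_def)
  \<comment> \<open>Integrating the norm over \<open>l\<close> first returns a multiple of
    \<open>norm (iexp x - 1) * x powr (- \<gamma>)\<close>, so absolute convergence of the double
    integral is that of \<open>Kint\<close> itself.\<close>
  have int: "integrable (lborel \<Otimes>\<^sub>M lborel) (\<lambda>(l,x). f l x)"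
  proof (subst lborel_pair.integrable_product_swap_iff[symmetric], rule lborel_pair.Fubini_integrable)
    show "AE x in lborel. integrable lborel (\<lambda>y. case (x, y) of (x, y) \<Rightarrow> case (y, x) of (l, x) \<Rightarrow> f l x)"
      using fl' by simp
    have "integrable lborel (\<lambda>x. Gamma \<gamma> * (indicator {0<..} x *\<^sub>R (norm (iexp x - 1) * x powr (- \<gamma>))))"
      using set_integrable_norm[OF set_integrable_Kint[OF \<gamma>]]
      by (intro integrable_mult_right) (simp add: set_integrable_def norm_mult)
    then show "integrable lborel (\<lambda>x. \<integral>y. norm (case (x, y) of (x, y) \<Rightarrow> case (y, x) of (l, x) \<Rightarrow> f l x) \<partial>lborel)"
      by (simp add: norm_val)
  qed simp
  \<comment> \<open>In the real part a division by \<open>l\<close> lowers the power by one: the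
    Beta integral is taken at \<open>\<gamma> - 1\<close> there and at \<open>\<gamma>\<close> in
    the imaginary part, both parameters lying strictly between 0 and 2.\<close>
  have fx_val: "(\<integral>x. f l x \<partial>lborel) = indicator {0<..} l *\<^sub>R (of_real (l powr ((\<gamma> - 1) - 1) / (1 + l\<^sup>2)) * (- 1) + \<i> * of_real (l powr (\<gamma> - 1) / (1 + l\<^sup>2)))" for l
  proof (cases "l > 0")
    case True
    have a: "set_integrable lborel {0<..} (\<lambda>x. exp (of_real x * Complex (-l) 1))" "set_integrable lborel {0<..} (\<lambda>x. exp (of_real x * Complex (-l) 0))"
      using LBINT_exp_complex(1)[of "Complex (-l) 1"] LBINT_exp_complex(1)[of "Complex (-l) 0"] True by auto
    have e: "(iexp x - 1) * of_real (exp (- (x * l))) = exp (of_real x * Complex (-l) 1) - exp (of_real x * Complex (-l) 0)" for x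
      by (simp add: left_diff_distrib exp_of_real[symmetric] exp_add[symmetric] Complex_eq algebra_simps)
    have "(\<integral>x. f l x \<partial>lborel) = (\<integral>x. of_real (l powr (\<gamma> - 1)) * (indicator {0<..} x *\<^sub>R (exp (of_real x * Complex (-l) 1) - exp (of_real x * Complex (-l) 0))) \<partial>lborel)"
      using True by (intro Bochner_Integration.integral_cong) (auto simp: f_def e[symmetric] split: split_indicator)
    also have "\<dots> = of_real (l powr (\<gamma> - 1)) * (LINT x:{0<..}|lborel. exp (of_real x * Complex (-l) 1) - exp (of_real x * Complex (-l) 0))"
      unfolding set_lebesgue_integral_def by (simp only: integral_mult_right_zero)
    also have "\<dots> = of_real (l powr (\<gamma> - 1)) * (- 1 / Complex (-l) 1 - (- 1 / Complex (-l) 0))"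
      using True a by (subst set_integral_diff) (auto simp: LBINT_exp_complex(2))
    also have "\<dots> = of_real (l powr (\<gamma> - 1) / l / (1 + l\<^sup>2)) * (- 1) + \<i> * of_real (l powr (\<gamma> - 1) / (1 + l\<^sup>2))"
    proof -
      have nz: "Complex (- l) 1 \<noteq> 0" "complex_of_real l \<noteq> 0" "1 + (complex_of_real l)\<^sup>2 \<noteq> 0"
        using True by (auto simp: complex_eq_iff power2_eq_square add_nonneg_eq_0_iff)
      have "- 1 / Complex (-l) 1 - (- 1 / Complex (-l) 0) = (\<i> * of_real l - 1) / (of_real l * (1 + (of_real l)\<^sup>2))"
        using nz True by (simp add: complex_eq_iff Re_divide Im_divide power2_eq_square) (simp add: field_simps)
      moreover have "of_real (l powr (\<gamma> - 1)) * ((\<i> * of_real l - 1) / (of_real l * (1 + (of_real l)\<^sup>2))) = of_real (l powr (\<gamma> - 1) / l / (1 + l\<^sup>2)) * (- 1) + \<i> * of_real (l powr (\<gamma> - 1) / (1 + l\<^sup>2))"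
        using nz by (simp add: divide_simps) (simp add: algebra_simps)
      ultimately show ?thesis by simp
    qed
    finally show ?thesis using True by (simp add: powr_diff power2_eq_square)
  qed (simp add: f_def)
  have A: "set_integrable lborel {0<..} (\<lambda>l. l powr (a - 1) / (1 + l\<^sup>2))" 
     "(LINT l:{0<..}|lborel. l powr (a - 1) / (1 + l\<^sup>2)) = pi / 2 / sin (pi * a / 2)" if "0 < a" "a < 2" for a
  proof -
    have "0 \<le> sin (pi * a / 2)" using that by (intro sin_ge_zero) auto
    then show "set_integrable lborel {0<..} (\<lambda>l. l powr (a - 1) / (1 + l\<^sup>2))"
        "(LINT l:{0<..}|lborel. l powr (a - 1) / (1 + l\<^sup>2)) = pi / 2 / sin (pi * a / 2)"
      using set_lebesgue_integral_of_nn_integral[OF _ _ nn_integral_powr_div_one_plus_square[OF that]] by auto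
  qed
  have "of_real (Gamma \<gamma>) * Kint \<gamma> = (\<integral>x. (\<integral>l. f l x \<partial>lborel) \<partial>lborel)"
    by (simp only: fl_val Kint_def set_lebesgue_integral_def integral_mult_right_zero)
  also have "\<dots> = (\<integral>l. (\<integral>x. f l x \<partial>lborel) \<partial>lborel)"
    by (rule lborel_pair.Fubini_integral[OF int])
  also have "\<dots> = (\<integral>l. - of_real (indicator {0<..} l *\<^sub>R (l powr ((\<gamma> - 1) - 1) / (1 + l\<^sup>2))) + \<i> * of_real (indicator {0<..} l *\<^sub>R (l powr (\<gamma> - 1) / (1 + l\<^sup>2))) \<partial>lborel)"
    by (intro Bochner_Integration.integral_cong) (auto simp: fx_val split: split_indicator)
  also have "\<dots> = - of_real (LINT l:{0<..}|lborel. l powr ((\<gamma> - 1) - 1) / (1 + l\<^sup>2)) + \<i> * of_real (LINT l:{0<..}|lborel. l powr (\<gamma> - 1) / (1 + l\<^sup>2))"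
    using A(1)[of "\<gamma> - 1"] A(1)[of \<gamma>] \<gamma> unfolding set_lebesgue_integral_def set_integrable_def
    by (subst Bochner_Integration.integral_add) (auto simp only: integral_minus integral_mult_right_zero integral_complex_of_real
      complex_of_real_integrable_eq intro!: Bochner_Integration.integrable_minus integrable_mult_right)
  also have "\<dots> = - of_real (pi / 2 * a) + \<i> * of_real (pi / 2 * b)"
    using A(2)[of "\<gamma> - 1"] A(2)[of \<gamma>] \<gamma> by (simp add: a_def b_def)
  finally have "of_real (Gamma \<gamma>) * Kint \<gamma> = - of_real (pi / 2 * a) + \<i> * of_real (pi / 2 * b)" .
  then have "Kint \<gamma> = (- of_real (pi / 2 * a) + \<i> * of_real (pi / 2 * b)) / of_real (Gamma \<gamma>)"
    using G0 by (simp add: nonzero_eq_divide_eq mult.commute)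
  then show ?thesis unfolding a_def[symmetric] b_def[symmetric] using G0 by (simp add: field_simps)
qed

text \<open>The limit of \<open>psi s / G s\<close> as \<open>s\<close> decreases to 0. For \<beta>
  < 1 it is the integral of \<open>iexp x - 1\<close> against the Levy density
  \<open>\<beta> * x powr (- (\<beta> + 1))\<close>; for \<beta> > 1 the integrand is centred by
  \<open>\<i> * x\<close> and integration by parts leaves
  \<open>\<i> * Kint \<beta>\<close>.\<close>

definition stable_const :: "real \<Rightarrow> complex" where
  "stable_const \<beta> = (if \<beta> < 1 then of_real \<beta> * Kint (\<beta> + 1) else \<i> * Kint \<beta>)"

text \<open>A shift of the parameter by one turns the sine in \<open>Kint_eq\<close> into a cosine,
  so real and imaginary part are in the ratio of a tangent, with the same formula on both sides of
  \<beta> = 1. The coefficient 1 of the tangent is what makes the limit totally skewed to the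
  right.\<close>

lemma stable_const_eq:
  assumes "0 < \<beta>" "\<beta> < 2" "\<beta> \<noteq> 1"
  obtains c where "c > 0" "stable_const \<beta> = - of_real c * (1 - \<i> * of_real (tan (pi * \<beta> / 2)))"
proof -
  define g where "g = (if \<beta> < 1 then \<beta> / Gamma (\<beta> + 1) else 1 / Gamma \<beta>)"
  have s: "sin (pi * \<beta> / 2) > 0" using assms by (intro sin_gt_zero) auto
  have g: "g > 0" using assms by (auto simp: g_def intro!: divide_pos_pos Gamma_real_pos)
  have s2: "sin (pi * (\<beta> - 1) / 2) = - cos (pi * \<beta> / 2)"
    by (simp add: right_diff_distrib diff_divide_distrib sin_diff)
  have c: "cos (pi * \<beta> / 2) \<noteq> 0"
  proof (cases "\<beta> < 1")
    case True
    then have "cos (pi * \<beta> / 2) > 0" using assms by (intro cos_gt_zero) auto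
    then show ?thesis by simp
  next
    case False
    have "sin (pi * (\<beta> - 1) / 2) > 0" using assms False by (intro sin_gt_zero) auto
    then show ?thesis using s2 by simp
  qed
  have s1: "sin (pi * (\<beta> + 1) / 2) = cos (pi * \<beta> / 2)" 
    by (simp add: distrib_left add_divide_distrib sin_add)
  show ?thesis
  proof (rule that[of "g * (pi / 2) / sin (pi * \<beta> / 2)"])
    show "0 < g * (pi / 2) / sin (pi * \<beta> / 2)" using g s by simp
    show "stable_const \<beta> = - of_real (g * (pi / 2) / sin (pi * \<beta> / 2)) * (1 - \<i> * of_real (tan (pi * \<beta> / 2)))"
    proof (cases "\<beta> < 1")
      case True
      have "Kint (\<beta> + 1) = of_real (pi / (2 * Gamma (\<beta> + 1))) * (- of_real (1 / sin (pi * \<beta> / 2)) + \<i> * of_real (1 / cos (pi * \<beta> / 2)))"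
        using Kint_eq[of "\<beta> + 1"] True assms s1 by simp
      then show ?thesis using True s c assms unfolding stable_const_def g_def tan_def
        by (simp add: complex_eq_iff)
    next
      case False
      have "Kint \<beta> = of_real (pi / (2 * Gamma \<beta>)) * (- of_real (1 / (- cos (pi * \<beta> / 2))) + \<i> * of_real (1 / sin (pi * \<beta> / 2)))"
        using Kint_eq[of "\<beta>"] False assms s2 by simp
      then show ?thesis using False s c assms unfolding stable_const_def g_def tan_def
        by (simp add: complex_eq_iff)
    qed
  qed
qed

text \<open>Used with \<open>k = 1\<close> for the centred exponential and with \<open>k = 0\<close>
  for the plain one.\<close>

lemma LBINT_iexp_derivative:
  assumes "0 \<le> m"
  shows "(LINT x:{0<..<m}|lborel. \<i> * (iexp x - of_real k)) = iexp m - 1 - \<i> * of_real (k * m)"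
proof -
  have "(LBINT x=ereal 0..ereal m. \<i> * (iexp x - of_real k)) = (iexp m - \<i> * of_real (k * m)) - (iexp 0 - \<i> * of_real (k * 0))"
    using assms
    by (intro interval_integral_FTC_finite)
       (auto intro!: continuous_intros derivative_eq_intros has_vector_derivative_real_field
             simp: has_vector_derivative_complex_iff algebra_simps)
  then show ?thesis using assms by (simp add: interval_lebesgue_integral_def einterval_def greaterThanLessThan_def greaterThan_def lessThan_def Collect_conj_eq)
qed

text \<open>Integration by parts: \<open>(iexp x - 1) * x powr (- \<beta>)\<close> is an
  antiderivative of the difference of the two integrands. Near 0 it is bounded by
  \<open>x powr (1 - \<beta>)\<close>, so only the boundary term at \<open>A\<close>
  remains.\<close>

lemma truncated_stable_integral:
  assumes "0 < \<beta>" "\<beta> < 1" "0 < A"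
  shows "(LINT x:{0<..<A}|lborel. \<i> * iexp x * of_real (x powr (- \<beta>))) =
     (iexp A - 1) * of_real (A powr (- \<beta>)) + of_real \<beta> * (LINT x:{0<..<A}|lborel. (iexp x - 1) * of_real (x powr (- (\<beta> + 1))))"
proof -
  have i2: "set_integrable lborel {0<..<A} (\<lambda>x. (iexp x - 1) * of_real (x powr (- (\<beta> + 1))))"
    by (rule set_integrable_subset[OF set_integrable_Kint]) (use assms in auto)
  have p: "set_integrable lborel {0<..<A} (\<lambda>x. x powr (- \<beta>))"
    using integrable_on_powr_from_0'[of "- \<beta>" A] assms
    by (intro set_integrable_subset[OF set_integrable_nonneg_of_integrable_on[where S = "{0<..A}"]]) auto
  have i1: "set_integrable lborel {0<..<A} (\<lambda>x. \<i> * iexp x * of_real (x powr (- \<beta>)))"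
    by (rule set_integrable_bound[OF p]) (auto simp: norm_mult set_borel_measurable_def)
  define f where "f x = \<i> * iexp x * of_real (x powr (- \<beta>)) - of_real \<beta> * ((iexp x - 1) * of_real (x powr (- (\<beta> + 1))))" for x
  have fi: "set_integrable lborel {0<..<A} f"
    unfolding f_def[abs_def] by (intro set_integral_diff(1) i1 set_integrable_mult_right impI i2)
  have "(LBINT x=ereal 0..ereal A. f x) = (iexp A - 1) * of_real (A powr (- \<beta>)) - 0"
  proof (rule interval_integral_FTC_integrable)
    show "((\<lambda>x. (iexp x - 1) * of_real (x powr (- \<beta>))) has_vector_derivative f x) (at x)"
      if "ereal 0 < ereal x" "ereal x < ereal A" for x
      using that unfolding f_def
      by (auto intro!: derivative_eq_intros simp: has_vector_derivative_complex_iff powr_diff powr_minus field_simps)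
    show "isCont f x" if "ereal 0 < ereal x" "ereal x < ereal A" for x
      using that unfolding f_def by (auto intro!: continuous_intros)
    show "set_integrable lborel (einterval (ereal 0) (ereal A)) f"
      using fi by (simp add: einterval_def greaterThanLessThan_def greaterThan_def lessThan_def Collect_conj_eq)
    show "(((\<lambda>x. (iexp x - 1) * of_real (x powr (- \<beta>))) \<circ> real_of_ereal) \<longlongrightarrow> 0) (at_right (ereal 0))"
      unfolding ereal_tendsto_simps
    proof (rule tendsto_norm_zero_cancel, rule tendsto_sandwich[OF always_eventually _ tendsto_const])
      show "\<forall>\<^sub>F x in at_right 0. norm ((iexp x - 1) * of_real (x powr (- \<beta>))) \<le> x powr (1 - \<beta>)"
        unfolding eventually_at_right_field
      proof (intro exI[of _ 1] conjI allI impI)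
        fix x :: real assume "0 < x" "x < 1"
        then show "norm ((iexp x - 1) * of_real (x powr (- \<beta>))) \<le> x powr (1 - \<beta>)"
          using norm_iexp_minus_one[of x] mult_right_mono[of "norm (iexp x - 1)" x "x powr (- \<beta>)"] powr_add[of x 1 "- \<beta>"]
          by (simp add: norm_mult)
      qed simp
      show "((\<lambda>x. x powr (1 - \<beta>)) \<longlongrightarrow> 0) (at_right 0)"
        using assms by (auto intro!: tendsto_eq_intros simp: eventually_at_right_field intro!: exI[of _ 1])
    qed auto
    show "(((\<lambda>x. (iexp x - 1) * of_real (x powr (- \<beta>))) \<circ> real_of_ereal) \<longlongrightarrow> (iexp A - 1) * of_real (A powr (- \<beta>))) (at_left (ereal A))"
      unfolding ereal_tendsto_simps using assms by (auto intro!: tendsto_intros)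
  qed (use assms in auto)
  then have "(LINT x:{0<..<A}|lborel. f x) = (iexp A - 1) * of_real (A powr (- \<beta>))"
    using assms by (simp add: interval_lebesgue_integral_def einterval_def greaterThanLessThan_def greaterThan_def lessThan_def Collect_conj_eq)
  moreover have "(LINT x:{0<..<A}|lborel. f x) = (LINT x:{0<..<A}|lborel. \<i> * iexp x * of_real (x powr (- \<beta>))) -
      (LINT x:{0<..<A}|lborel. of_real \<beta> * ((iexp x - 1) * of_real (x powr (- (\<beta> + 1)))))"
    unfolding f_def[abs_def] by (intro set_integral_diff(2) i1 set_integrable_mult_right impI i2)
  ultimately show ?thesis by (simp only: set_integral_mult_right) (simp add: algebra_simps)
qed

section \<open>Characteristic functions of regularly varying laws\<close>

text \<open>To be instantiated with the law of the squared noise. The tail function is written out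
  in the assumptions because \<open>G\<close> exists only inside the locale; the sublocale below
  then supplies the Potter bounds.\<close>

locale rv_distribution = real_distribution F for F :: "real measure" +
  fixes \<beta> :: real
  assumes nonneg: "AE y in F. 0 \<le> y"
    and \<beta>0: "0 < \<beta>"
    and unbounded: "0 < s \<Longrightarrow> 0 < measure F {y. 1 < s * y}"
    and regvar: "0 < c \<Longrightarrow> ((\<lambda>s. measure F {y. 1 < (c * s) * y} / measure F {y. 1 < s * y}) \<longlongrightarrow> c powr \<beta>) (at_right 0)"
begin

definition G :: "real \<Rightarrow> real" where "G s = measure F {y. 1 < s * y}"

lemma AE_pos_set: "0 \<le> s \<Longrightarrow> measure F {y. 1 < s * y} = measure F {y. 0 \<le> y \<and> 1 < s * y}"
  using nonneg by (intro finite_measure_eq_AE) auto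

sublocale rv_tail G \<beta>
proof
  show "G x \<le> G y" if "0 \<le> x" "x \<le> y" for x y
  proof -
    have "measure F {z. 0 \<le> z \<and> 1 < x * z} \<le> measure F {z. 0 \<le> z \<and> 1 < y * z}"
      using that by (intro finite_measure_mono) (auto intro: less_le_trans mult_right_mono)
    then show ?thesis using that by (simp add: G_def AE_pos_set)
  qed
qed (use \<beta>0 unbounded regvar in \<open>auto simp: G_def\<close>)

lemma G_div: "0 < x \<Longrightarrow> measure F {y. x < v * y} = G (v / x)"
  by (simp add: G_def field_simps)

lemma borel_measurable_G_div [measurable]: "0 \<le> v \<Longrightarrow> (\<lambda>x. indicator {0<..} x * G (v / x)) \<in> borel_measurable borel"
proof -
  assume v: "0 \<le> v"
  have "(\<lambda>x. indicator {0<..} x * G (v / x)) = (\<lambda>x. indicator {0<..} x * measure F {y. x < v * y})"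
    by (auto simp: fun_eq_iff G_div split: split_indicator)
  also have "\<dots> \<in> borel_measurable borel"
  proof (intro borel_measurable_times)
    have "mono (\<lambda>x. - measure F {y. x < v * y})"
      by (intro monoI) (auto intro!: finite_measure_mono)
    then have "(\<lambda>x. - measure F {y. x < v * y}) \<in> borel_measurable borel" by (rule borel_measurable_mono)
    then show "(\<lambda>x. measure F {y. x < v * y}) \<in> borel_measurable borel" by simp
  qed simp
  finally show ?thesis .
qed

text \<open>Fubini on the region where \<open>x < v * y\<close>: the mean of an antiderivative of
  \<open>h\<close>, taken at \<open>v * y\<close>, is the integral of \<open>h\<close> against the
  tail \<open>G (v / x)\<close>. This is how tail information enters characteristic
  functions.\<close>

lemma layer_cake:
  fixes h :: "real \<Rightarrow> complex"
  assumes v: "0 \<le> v" and h [measurable]: "h \<in> borel_measurable borel"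
    and int: "set_integrable lborel {0<..} (\<lambda>x. norm (h x) * G (v / x))"
  shows "integrable F (\<lambda>y. LINT x:{0<..<v * y}|lborel. h x)"
    and "(\<integral>y. (LINT x:{0<..<v * y}|lborel. h x) \<partial>F) = (LINT x:{0<..}|lborel. h x * of_real (G (v / x)))"
proof -
  interpret P: pair_sigma_finite lborel F ..
  define f where "f x y = indicator {0<..} x *\<^sub>R (indicator {p. fst p < v * snd p} (x, y) *\<^sub>R h x)" for x y
  have [measurable]: "(\<lambda>(x, y). f x y) \<in> borel_measurable (lborel \<Otimes>\<^sub>M F)"
    unfolding f_def by measurable
  have int_ind: "integrable F (\<lambda>y. indicator {p. fst p < v * snd p} (x, y) :: real)" for x
    by (rule integrable_const_bound[where B = 1]) (auto split: split_indicator)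
  have ind: "(\<integral>y. indicator {p. fst p < v * snd p} (x, y) \<partial>F) = G (v / x)" if "x > 0" for x
  proof -
    have "(\<integral>y. indicat_real {p. fst p < v * snd p} (x, y) \<partial>F) = (\<integral>y. indicat_real {y. x < v * y} y \<partial>F)"
      by (intro Bochner_Integration.integral_cong) (auto split: split_indicator)
    then show ?thesis using that by (simp add: G_div)
  qed
  have intf: "integrable F (f x)" for x
    unfolding f_def by (intro integrable_scaleR_right integrable_scaleR_left int_ind)
  have fval: "(\<integral>y. f x y \<partial>F) = indicator {0<..} x *\<^sub>R (h x * of_real (G (v / x)))" for x
  proof (cases "x > 0")
    case True
    have "(\<integral>y. f x y \<partial>F) = (\<integral>y. indicator {p. fst p < v * snd p} (x, y) *\<^sub>R h x \<partial>F)"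
      using True by (simp add: f_def)
    also have "\<dots> = (\<integral>y. indicator {p. fst p < v * snd p} (x, y) \<partial>F) *\<^sub>R h x"
      by (rule integral_scaleR_left) (rule int_ind)
    finally show ?thesis using True ind[OF True] by (simp add: scaleR_conv_of_real)
  qed (simp add: f_def)
  have nval: "(\<integral>y. norm (f x y) \<partial>F) = indicator {0<..} x *\<^sub>R (norm (h x) * G (v / x))" for x
  proof (cases "x > 0")
    case True
    have "(\<integral>y. norm (f x y) \<partial>F) = (\<integral>y. indicator {p. fst p < v * snd p} (x, y) * norm (h x) \<partial>F)"
      using True by (simp add: f_def)
    also have "\<dots> = (\<integral>y. indicator {p. fst p < v * snd p} (x, y) \<partial>F) * norm (h x)"
      by (rule integral_mult_left_zero)
    finally show ?thesis using True ind[OF True] by simp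
  qed (simp add: f_def)
  have I: "integrable (lborel \<Otimes>\<^sub>M F) (\<lambda>(x, y). f x y)"
    using int intf by (intro P.Fubini_integrable) (auto simp: nval set_integrable_def)
  have inner: "(\<integral>x. f x y \<partial>lborel) = (LINT x:{0<..<v * y}|lborel. h x)" for y
    unfolding set_lebesgue_integral_def
    by (intro Bochner_Integration.integral_cong) (auto simp: f_def split: split_indicator)
  show "integrable F (\<lambda>y. LINT x:{0<..<v * y}|lborel. h x)"
    using P.integrable_snd[OF I] by (simp add: inner)
  show "(\<integral>y. (LINT x:{0<..<v * y}|lborel. h x) \<partial>F) = (LINT x:{0<..}|lborel. h x * of_real (G (v / x)))"
    using P.Fubini_integral[OF I] by (simp add: inner fval set_lebesgue_integral_def)
qed

text \<open>Regular variation gives the pointwise limit \<open>x powr (- \<beta>)\<close> of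
  \<open>G (s / x) / G s\<close>, and \<open>w\<close>, which in both applications comes from a
  Potter bound, dominates. Both regimes of \<beta> use it, with different \<open>h\<close>.\<close>

lemma tail_integral_limit:
  fixes h :: "real \<Rightarrow> complex"
  assumes h [measurable]: "h \<in> borel_measurable borel" and s0: "0 < s0"
    and w: "set_integrable lborel {0<..} w"
    and hG: "\<And>s x. 0 < s \<Longrightarrow> s < s0 \<Longrightarrow> 0 < x \<Longrightarrow> norm (h x) * G (s / x) \<le> w x * G s"
  shows "\<And>s. 0 < s \<Longrightarrow> s < s0 \<Longrightarrow> set_integrable lborel {0<..} (\<lambda>x. norm (h x) * G (s / x))"
    and "((\<lambda>s. (LINT x:{0<..}|lborel. h x * of_real (G (s / x))) / of_real (G s)) \<longlongrightarrow>
      (LINT x:{0<..}|lborel. h x * of_real (x powr (- \<beta>)))) (at_right 0)"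
proof -
  have meas [measurable]: "(\<lambda>x. indicator {0<..} x *\<^sub>R (h x * of_real (G (s / x)))) \<in> borel_measurable lborel" if "0 < s" for s
  proof -
    have "(\<lambda>x. indicator {0<..} x *\<^sub>R (h x * of_real (G (s / x)))) = (\<lambda>x. h x * of_real (indicator {0<..} x * G (s / x)))"
      by (auto split: split_indicator)
    also have "\<dots> \<in> borel_measurable borel"
      by (rule borel_measurable_times[OF h measurable_compose[OF borel_measurable_G_div borel_measurable_of_real]]) (use that in simp)
    finally have "(\<lambda>x. indicator {0<..} x *\<^sub>R (h x * of_real (G (s / x)))) \<in> borel_measurable borel" .
    then have "(\<lambda>x. indicator {0<..} x *\<^sub>R (h x * of_real (G (s / x)))) \<in> borel_measurable lborel" by simp
    then show ?thesis .
  qed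
  show int: "set_integrable lborel {0<..} (\<lambda>x. norm (h x) * G (s / x))" if "0 < s" "s < s0" for s
  proof (rule set_integrable_bound)
    show "set_integrable lborel {0<..} (\<lambda>x. w x * G s)" using w by simp
    have "(\<lambda>x. indicator {0<..} x *\<^sub>R (norm (h x) * G (s / x))) = (\<lambda>x. norm (indicator {0<..} x *\<^sub>R (h x * of_real (G (s / x)))))"
      using that G_nonneg by (auto simp: fun_eq_iff norm_mult split: split_indicator)
    then show "set_borel_measurable lborel {0<..} (\<lambda>x. norm (h x) * G (s / x))"
      using measurable_compose[OF meas[OF that(1)] borel_measurable_norm] unfolding set_borel_measurable_def by simp
    show "AE x in lborel. x \<in> {0<..} \<longrightarrow> norm (norm (h x) * G (s / x)) \<le> norm (w x * G s)"
      using hG[OF that] that by (intro AE_I2) (auto simp: G_nonneg intro!: order_trans[OF _ abs_ge_self])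
  qed
  show "((\<lambda>s. (LINT x:{0<..}|lborel. h x * of_real (G (s / x))) / of_real (G s)) \<longlongrightarrow>
      (LINT x:{0<..}|lborel. h x * of_real (x powr (- \<beta>)))) (at_right 0)"
  \<comment> \<open>Dominated convergence is sequential, so the one-sided limit is tested along
    sequences below \<open>s0\<close>.\<close>
  proof (rule tendsto_at_right_sequentially[OF s0])
    fix S :: "nat \<Rightarrow> real" assume S: "\<And>n. 0 < S n" "\<And>n. S n < s0" "S \<longlonglongrightarrow> 0"
    have S': "filterlim S (at_right 0) sequentially"
      using S(1)[THEN less_imp_neq] S by (auto simp: filterlim_at intro!: always_eventually)
    have "(\<lambda>n. LINT x:{0<..}|lborel. h x * of_real (G (S n / x)) / of_real (G (S n))) \<longlonglongrightarrow> (LINT x:{0<..}|lborel. h x * of_real (x powr (- \<beta>)))"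
      unfolding set_lebesgue_integral_def
    proof (rule integral_dominated_convergence[where w = "\<lambda>x. indicator {0<..} x *\<^sub>R w x"])
      show "AE x in lborel. (\<lambda>n. indicator {0<..} x *\<^sub>R (h x * of_real (G (S n / x)) / of_real (G (S n)))) \<longlonglongrightarrow> indicator {0<..} x *\<^sub>R (h x * of_real (x powr (- \<beta>)))"
      proof (intro AE_I2)
        fix x :: real
        have "(\<lambda>n. h x * of_real (G (S n / x) / G (S n))) \<longlonglongrightarrow> h x * of_real (x powr (- \<beta>))" if "x > 0"
          using filterlim_compose[OF rv[of "1 / x"] S'] that
          by (intro tendsto_intros) (simp add: powr_divide powr_minus_divide)
        then show "(\<lambda>n. indicator {0<..} x *\<^sub>R (h x * of_real (G (S n / x)) / of_real (G (S n)))) \<longlonglongrightarrow> indicator {0<..} x *\<^sub>R (h x * of_real (x powr (- \<beta>)))"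
          by (cases "x > 0") auto
      qed
      show "AE x in lborel. norm (indicator {0<..} x *\<^sub>R (h x * of_real (G (S n / x)) / of_real (G (S n)))) \<le> indicator {0<..} x *\<^sub>R w x" for n
        using hG[OF S(1,2)] G_pos[OF S(1)] G_nonneg S(1)[of n]
        by (intro AE_I2) (auto simp: norm_mult norm_divide pos_divide_le_eq split: split_indicator)
      show "(\<lambda>x. indicat_real {0<..} x *\<^sub>R (h x * complex_of_real (G (S n / x)) / complex_of_real (G (S n)))) \<in> borel_measurable lborel" for n
        using borel_measurable_divide[OF meas[OF S(1)[of n]] borel_measurable_const[of "of_real (G (S n))"]] by (simp add: scaleR_conv_of_real)
    qed (use w in \<open>auto simp: set_integrable_def\<close>)
    then show "(\<lambda>n. (LINT x:{0<..}|lborel. h x * of_real (G (S n / x))) / of_real (G (S n))) \<longlonglongrightarrow> (LINT x:{0<..}|lborel. h x * of_real (x powr (- \<beta>)))"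
      by (simp only: set_integral_divide_zero)
  qed
qed

text \<open>The derivative \<open>h\<close> of the centred exponential is bounded by
  \<open>min 2 x\<close>, and Potter exponents strictly between 1 and 2 on both sides of \<beta>
  make the product with the tail integrable. The mean is finite because the tail decays faster than
  \<open>1 / x\<close>.\<close>

lemma iexp_limit_gt_1:
  assumes \<beta>: "1 < \<beta>" "\<beta> < 2"
  shows integrable_ident: "integrable F (\<lambda>y. y)"
    and "((\<lambda>s. (\<integral>y. iexp (s * y) - 1 - \<i> * of_real (s * y) \<partial>F) / of_real (G s)) \<longlongrightarrow> stable_const \<beta>) (at_right 0)"
proof -
  \<comment> \<open>\<open>\<gamma>1\<close> governs small \<open>x\<close>, where
    \<open>s / x\<close> exceeds \<open>s\<close>; \<open>\<gamma>2\<close> governs large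
    \<open>x\<close>.\<close>
  obtain \<gamma>1 \<gamma>2 where \<gamma>: "1 < \<gamma>2" "\<gamma>2 < \<beta>" "\<beta> < \<gamma>1" "\<gamma>1 < 2" using \<beta> dense by metis
  obtain C1 where C1: "C1 > 0" "\<And>s l. 0 < s \<Longrightarrow> 1 \<le> l \<Longrightarrow> G (l * s) \<le> C1 * l powr \<gamma>1 * G s"
    using potter_large[OF \<gamma>(3)] by metis
  have \<gamma>20: "0 \<le> \<gamma>2" using \<gamma> by simp
  obtain C2 s0 where C2: "C2 > 0" "s0 > 0" "\<And>s l. 0 < s \<Longrightarrow> s < s0 \<Longrightarrow> 0 < l \<Longrightarrow> l \<le> 1 \<Longrightarrow> G (l * s) \<le> C2 * l powr \<gamma>2 * G s"
    using potter_small[OF \<gamma>20 \<gamma>(2)] by metis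
  have bnd: "G (s / x) \<le> (C1 * x powr (- \<gamma>1) + C2 * x powr (- \<gamma>2)) * G s" if "0 < s" "s < s0" "0 < x" for s x
  proof (cases "x \<le> 1")
    case True
    have "G (s / x) \<le> C1 * x powr (- \<gamma>1) * G s" using C1(2)[of s "1 / x"] that True
      by (simp add: powr_divide powr_minus field_simps)
    moreover have "0 \<le> C2 * x powr (- \<gamma>2) * G s" using C2 G_pos[OF that(1)] by simp
    ultimately show ?thesis by (simp add: distrib_right)
  next
    case False
    have "G (s / x) \<le> C2 * x powr (- \<gamma>2) * G s" using C2(3)[of s "1 / x"] that False
      by (simp add: powr_divide powr_minus field_simps)
    moreover have "0 \<le> C1 * x powr (- \<gamma>1) * G s" using C1 G_pos[OF that(1)] by simp
    ultimately show ?thesis by (simp add: distrib_right)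
  qed
  define h where "h x = \<i> * (iexp x - of_real 1)" for x
  have h: "norm (h x) \<le> min 2 \<bar>x\<bar>" for x using norm_iexp_minus_one[of x] by (simp add: h_def norm_mult)
  have h_meas [measurable]: "h \<in> borel_measurable borel" unfolding h_def by measurable
  define w where "w x = C1 * (min 2 x * x powr (- \<gamma>1)) + C2 * (min 2 x * x powr (- \<gamma>2))" for x
  have w: "set_integrable lborel {0<..} w"
    unfolding w_def[abs_def] using \<gamma>
    by (intro set_integral_add(1) set_integrable_mult_right impI set_integrable_min_powr) auto
  have hG: "norm (h x) * G (s / x) \<le> w x * G s" if "0 < s" "s < s0" "0 < x" for s x
  proof -
    have "norm (h x) * G (s / x) \<le> min 2 x * ((C1 * x powr (- \<gamma>1) + C2 * x powr (- \<gamma>2)) * G s)"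
      using h[of x] bnd[OF that] that by (intro mult_mono) (auto intro!: G_nonneg)
    then show ?thesis by (simp add: w_def algebra_simps)
  qed
  have lim1: "set_integrable lborel {0<..} (\<lambda>x. norm (h x) * G (s / x))" if "0 < s" "s < s0" for s
    by (rule tail_integral_limit(1)[OF h_meas C2(2) w _ that]) (use hG in auto)
  have lim2: "((\<lambda>s. (LINT x:{0<..}|lborel. h x * of_real (G (s / x))) / of_real (G s)) \<longlongrightarrow>
      (LINT x:{0<..}|lborel. h x * of_real (x powr (- \<beta>)))) (at_right 0)"
    by (rule tail_integral_limit(2)[OF h_meas C2(2) w]) (use hG in auto)
  have E: "(\<integral>y. iexp (s * y) - 1 - \<i> * of_real (s * y) \<partial>F) = (LINT x:{0<..}|lborel. h x * of_real (G (s / x)))"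
    if "0 < s" "s < s0" for s
  proof -
    have s: "0 \<le> s" using that by simp
    have "(\<integral>y. iexp (s * y) - 1 - \<i> * of_real (s * y) \<partial>F) = (\<integral>y. (LINT x:{0<..<s * y}|lborel. h x) \<partial>F)"
    proof (rule integral_cong_AE)
      show "AE y in F. iexp (s * y) - 1 - \<i> * of_real (s * y) = (LINT x:{0<..<s * y}|lborel. h x)"
        using nonneg
      proof (elim AE_mp, intro AE_I2 impI)
        fix y :: real assume "0 \<le> y"
        then show "iexp (s * y) - 1 - \<i> * of_real (s * y) = (LINT x:{0<..<s * y}|lborel. h x)"
          using LBINT_iexp_derivative[of "s * y" 1] s by (simp add: h_def)
      qed
      show "(\<lambda>y. LINT x:{0<..<s * y}|lborel. h x) \<in> borel_measurable F"
        by (rule borel_measurable_integrable[OF layer_cake(1)[OF s h_meas lim1[OF that]]])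
    qed simp
    also have "\<dots> = (LINT x:{0<..}|lborel. h x * of_real (G (s / x)))"
      by (rule layer_cake(2)[OF s h_meas lim1[OF that]])
    finally show ?thesis .
  qed
  show "integrable F (\<lambda>y. y)"
  proof -
    \<comment> \<open>One fixed admissible scale is enough: \<open>layer_cake\<close> with the
      constant integrand 1 recovers \<open>s * y\<close>. Below 1 the tail is bounded by 1, beyond 1
      by a multiple of \<open>x powr (- \<gamma>2)\<close>.\<close>
    define s where "s = s0 / 2"
    have s: "0 < s" "s < s0" using C2 by (auto simp: s_def)
    have m: "(\<lambda>x. indicator {0<..} x * G (s / x)) \<in> borel_measurable borel" using s by simp
    have 1: "set_integrable lborel {0<..1} (\<lambda>x. G (s / x))"
    proof -
      have eq: "(\<lambda>x. indicat_real {0<..1} x * G (s / x)) = (\<lambda>x. indicator {0<..1} x * (indicator {0<..} x * G (s / x)))"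
        by (auto split: split_indicator)
      show ?thesis
      proof (rule set_integrable_bound)
        show "set_integrable lborel {0<..1} (\<lambda>x::real. 1::real)" by (simp add: set_integrable_def integrable_indicator_iff emeasure_lborel_Ioc)
        show "set_borel_measurable lborel {0<..1} (\<lambda>x. G (s / x))" unfolding set_borel_measurable_def using eq m by simp
        show "AE x in lborel. x \<in> {0<..1} \<longrightarrow> norm (G (s / x)) \<le> norm (1::real)"
          using s G_le_1 G_nonneg by (intro AE_I2) auto
      qed
    qed
    have 2: "set_integrable lborel {1<..} (\<lambda>x. G (s / x))"
    proof -
      have eq: "(\<lambda>x. indicat_real {1<..} x * G (s / x)) = (\<lambda>x. indicator {1<..} x * (indicator {0<..} x * G (s / x)))"
        by (auto split: split_indicator)
      show ?thesis
      proof (rule set_integrable_bound)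
        show "set_integrable lborel {1<..} (\<lambda>x. C2 * x powr (- \<gamma>2) * G s)"
          using set_integrable_powr_1_inf[of "- \<gamma>2"] \<gamma> by simp
        show "set_borel_measurable lborel {1<..} (\<lambda>x. G (s / x))" unfolding set_borel_measurable_def using eq m by simp
        show "AE x in lborel. x \<in> {1<..} \<longrightarrow> norm (G (s / x)) \<le> norm (C2 * x powr - \<gamma>2 * G s)"
        proof (intro AE_I2 impI)
          fix x :: real assume "x \<in> {1<..}"
          then have "0 \<le> G (s / x)" "G (s / x) \<le> C2 * x powr - \<gamma>2 * G s"
            using C2(3)[of s "1 / x"] G_nonneg[of "s / x"] s by (simp_all add: powr_divide powr_minus field_simps)
          then show "norm (G (s / x)) \<le> norm (C2 * x powr - \<gamma>2 * G s)" by simp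
        qed
      qed
    qed
    have "{0<..} = {0<..1} \<union> {1::real<..}" by auto
    then have "set_integrable lborel {0<..} (\<lambda>x. norm (1::complex) * G (s / x))" using set_integrable_Un[OF 1 2] by simp
    then have "integrable F (\<lambda>y. LINT x:{0<..<s * y}|lborel. (1::complex))"
      using s by (intro layer_cake(1)) auto
    then have I: "integrable F (\<lambda>y. Re (LINT x:{0<..<s * y}|lborel. (1::complex)) / s)" by (intro integrable_divide integrable_Re)
    have "AE y in F. Re (LINT x:{0<..<s * y}|lborel. (1::complex)) / s = y"
      using nonneg s by (elim AE_mp, intro AE_I2) (auto simp: set_lebesgue_integral_def scaleR_conv_of_real)
    then show ?thesis by (intro integrable_cong_AE_imp[OF I]) auto
  qed
  have "(LINT x:{0<..}|lborel. h x * of_real (x powr (- \<beta>))) = \<i> * Kint \<beta>"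
    unfolding h_def Kint_def by (subst set_integral_mult_right[symmetric]) (simp only: mult.assoc of_real_1)
  then have lim3: "((\<lambda>s. (LINT x:{0<..}|lborel. h x * of_real (G (s / x))) / of_real (G s)) \<longlongrightarrow> stable_const \<beta>) (at_right 0)"
    using lim2 \<beta> by (simp add: stable_const_def)
  show "((\<lambda>s. (\<integral>y. iexp (s * y) - 1 - \<i> * of_real (s * y) \<partial>F) / of_real (G s)) \<longlongrightarrow> stable_const \<beta>) (at_right 0)"
  proof (rule Lim_transform_eventually[OF lim3])
    show "\<forall>\<^sub>F s in at_right 0. (LINT x:{0<..}|lborel. h x * of_real (G (s / x))) / of_real (G s) = (\<integral>y. iexp (s * y) - 1 - \<i> * of_real (s * y) \<partial>F) / of_real (G s)"
      unfolding eventually_at_right_field using E C2 by (intro exI[of _ s0]) auto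
  qed
qed

text \<open>For \<open>\<beta> < 1\<close> the integral of \<open>iexp x * x powr (-\<beta>)\<close> converges only conditionally, so dominated convergence
  is applied to the law truncated at \<open>A\<close>, at the price of an error \<open>2 * G (s / A)\<close>.\<close>

lemma iexp_limit_lt_1:
  assumes \<beta>: "\<beta> < 1"
  shows "((\<lambda>s. (\<integral>y. iexp (s * y) - 1 \<partial>F) / of_real (G s)) \<longlongrightarrow> stable_const \<beta>) (at_right 0)"
proof -
  let ?I = "\<lambda>s. \<integral>y. iexp (s * y) - 1 \<partial>F"
  define h where "h A x = indicator {..<A} x *\<^sub>R (\<i> * (iexp x - of_real 0))" for A x :: real
  define L where "L A = (LINT x:{0<..}|lborel. h A x * of_real (x powr (- \<beta>)))" for A
  define J where "J A s = (LINT x:{0<..}|lborel. h A x * of_real (G (s / x)))" for A s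
  have h_meas [measurable]: "h A \<in> borel_measurable borel" for A unfolding h_def by measurable
  obtain \<gamma> where \<gamma>: "\<beta> < \<gamma>" "\<gamma> < 1" using \<beta> dense by metis
  obtain C where C: "C > 0" "\<And>s l. 0 < s \<Longrightarrow> 1 \<le> l \<Longrightarrow> G (l * s) \<le> C * l powr \<gamma> * G s"
    using potter_large[OF \<gamma>(1)] by metis
  have bound: "norm (h A x) * G (s / x) \<le> indicator {0<..A} x * (C * x powr (- \<gamma>) + 1) * G s" if "0 < s" "0 < x" for A s x
  proof (cases "x < A")
    case True
    have "G (s / x) \<le> (C * x powr (- \<gamma>) + 1) * G s"
    proof (cases "x \<le> 1")
      case True
      have "G (s / x) \<le> C * x powr (- \<gamma>) * G s" using C(2)[of s "1 / x"] that True
        by (simp add: powr_divide powr_minus field_simps)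
      then show ?thesis using G_pos[OF that(1)] by (simp add: distrib_right)
    next
      case False
      have "G (s / x) \<le> G s" using False that by (intro mono_G) (auto simp: field_simps)
      moreover have "0 \<le> C * x powr (- \<gamma>) * G s" using C G_pos[OF that(1)] by simp
      ultimately show ?thesis by (simp add: distrib_right)
    qed
    then show ?thesis using True that by (simp add: h_def norm_mult)
  qed (use that G_pos[OF that(1)] C in \<open>auto simp: h_def split: split_indicator\<close>)
  have w: "set_integrable lborel {0<..} (\<lambda>x. indicator {0<..A} x * (C * x powr (- \<gamma>) + 1))" if "A > 0" for A
  proof -
    have "set_integrable lborel {0<..A} (\<lambda>x. x powr (- \<gamma>))"
      using integrable_on_powr_from_0'[of "- \<gamma>" A] \<gamma> that
      by (intro set_integrable_nonneg_of_integrable_on) auto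
    moreover have "set_integrable lborel {0<..A} (\<lambda>x. 1::real)"
      using that by (simp add: set_integrable_def integrable_indicator_iff emeasure_lborel_Ioc)
    ultimately have "set_integrable lborel {0<..A} (\<lambda>x. C * x powr (- \<gamma>) + 1)"
      by (intro set_integral_add(1) set_integrable_mult_right impI)
    then show ?thesis unfolding set_integrable_def
      by (rule Bochner_Integration.integrable_cong[THEN iffD1, OF refl, rotated]) (auto split: split_indicator)
  qed
  have int: "set_integrable lborel {0<..} (\<lambda>x. norm (h A x) * G (s / x))" if "A > 0" "0 < s" "s < 1" for s A
    by (rule tail_integral_limit(1)[OF h_meas zero_less_one w[OF that(1)] _ that(2,3)]) (use bound in auto)
  have limJ: "((\<lambda>s. J A s / of_real (G s)) \<longlongrightarrow> L A) (at_right 0)" if "A > 0" for A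
    unfolding J_def L_def by (rule tail_integral_limit(2)[OF h_meas zero_less_one w[OF that]]) (use bound in auto)
  have hint: "(LINT x:{0<..<m}|lborel. h A x) = iexp (min m A) - 1" if "0 \<le> m" "0 < A" for m A
  proof -
    have "(LINT x:{0<..<m}|lborel. h A x) = (LINT x:{0<..<min m A}|lborel. \<i> * (iexp x - of_real 0))"
      unfolding set_lebesgue_integral_def by (intro Bochner_Integration.integral_cong) (auto simp: h_def split: split_indicator)
    also have "\<dots> = iexp (min m A) - 1" using LBINT_iexp_derivative[of "min m A" 0] that by simp
    finally show ?thesis .
  qed
  \<comment> \<open>The integrands agree as long as \<open>s * y\<close> is at most
    \<open>A\<close>; beyond that they differ by two numbers of modulus 1.\<close>
  have diff: "norm (?I s - J A s) \<le> 2 * G (s / A)" if "A > 0" "0 < s" "s < 1" for s A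
  proof -
    have s0: "0 \<le> s" using that by simp
    note lc = layer_cake[OF s0 h_meas int[OF that]]
    have i1: "integrable F (\<lambda>y. iexp (s * y) - 1)" by (intro integrable_const_bound[where B = 2]) (auto intro!: order_trans[OF norm_triangle_ineq4])
    have "?I s - J A s = (\<integral>y. (iexp (s * y) - 1) - (LINT x:{0<..<s * y}|lborel. h A x) \<partial>F)"
      unfolding J_def lc(2)[symmetric] by (rule Bochner_Integration.integral_diff[symmetric, OF i1 lc(1)])
    also have "norm \<dots> \<le> (\<integral>y. norm ((iexp (s * y) - 1) - (LINT x:{0<..<s * y}|lborel. h A x)) \<partial>F)"
      by (rule integral_norm_bound)
    also have "\<dots> \<le> (\<integral>y. 2 * indicator {y. A < s * y} y \<partial>F)"
    proof (rule integral_mono_AE)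
      show "integrable F (\<lambda>y. norm ((iexp (s * y) - 1) - (LINT x:{0<..<s * y}|lborel. h A x)))"
        using i1 lc(1) by auto
      show "AE y in F. norm ((iexp (s * y) - 1) - (LINT x:{0<..<s * y}|lborel. h A x)) \<le> 2 * indicator {y. A < s * y} y"
        using nonneg
      proof (elim AE_mp, intro AE_I2 impI)
        fix y :: real assume "0 \<le> y"
        then have "(LINT x:{0<..<s * y}|lborel. h A x) = iexp (min (s * y) A) - 1" using that by (intro hint) auto
        then show "norm ((iexp (s * y) - 1) - (LINT x:{0<..<s * y}|lborel. h A x)) \<le> 2 * indicator {y. A < s * y} y"
          using norm_triangle_ineq4[of "iexp (s * y)" "iexp A"] by (auto simp: min_def not_le simp del: of_real_mult split: split_indicator)
      qed
    qed (intro integrable_mult_right integrable_real_indicator; simp add: less_top[symmetric])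
    also have "\<dots> = 2 * G (s / A)" using that by (simp add: G_div)
    finally show ?thesis .
  qed
  have L_eq: "L A = (iexp A - 1) * of_real (A powr (- \<beta>)) + of_real \<beta> * (LINT x:{0<..<A}|lborel. (iexp x - 1) * of_real (x powr (- (\<beta> + 1))))" if "A > 0" for A
  proof -
    have "L A = (LINT x:{0<..<A}|lborel. \<i> * iexp x * of_real (x powr (- \<beta>)))"
      unfolding L_def set_lebesgue_integral_def by (intro Bochner_Integration.integral_cong) (auto simp: h_def split: split_indicator)
    then show ?thesis using truncated_stable_integral[OF \<beta>_pos \<beta> that] by simp
  qed
  have K: "(\<lambda>n. LINT x:{0<..<real n}|lborel. (iexp x - 1) * of_real (x powr (- (\<beta> + 1)))) \<longlonglongrightarrow> Kint (\<beta> + 1)"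
    unfolding Kint_def set_lebesgue_integral_def
  proof (rule integral_dominated_convergence)
    show "integrable lborel (\<lambda>x. norm (indicator {0<..} x *\<^sub>R ((iexp x - 1) * of_real (x powr (- (\<beta> + 1))))))"
      using set_integrable_Kint[of "\<beta> + 1"] \<beta> \<beta>_pos by (intro integrable_norm) (auto simp: set_integrable_def)
    show "AE x in lborel. (\<lambda>n. indicator {0<..<real n} x *\<^sub>R ((iexp x - 1) * of_real (x powr (- (\<beta> + 1))))) \<longlonglongrightarrow> indicator {0<..} x *\<^sub>R ((iexp x - 1) * of_real (x powr (- (\<beta> + 1))))"
    proof (intro AE_I2 tendsto_eventually)
      fix x :: real
      show "\<forall>\<^sub>F n in sequentially. indicator {0<..<real n} x *\<^sub>R ((iexp x - 1) * of_real (x powr (- (\<beta> + 1)))) = indicator {0<..} x *\<^sub>R ((iexp x - 1) * complex_of_real (x powr (- (\<beta> + 1))))"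
        using eventually_gt_at_top[of "nat \<lceil>x\<rceil>"] by eventually_elim (auto split: split_indicator; linarith)
    qed
  qed (auto split: split_indicator)
  have pow0: "(\<lambda>n. real n powr (- \<beta>)) \<longlonglongrightarrow> 0"
    using \<beta>_pos by (intro tendsto_neg_powr filterlim_real_sequentially) auto
  have L0: "(\<lambda>n. (iexp (real n) - 1) * of_real (real n powr (- \<beta>))) \<longlonglongrightarrow> 0"
  proof (rule Lim_null_comparison)
    show "\<forall>\<^sub>F n in sequentially. norm ((iexp (real n) - 1) * of_real (real n powr (- \<beta>))) \<le> 2 * real n powr (- \<beta>)"
      using norm_iexp_minus_one[of "real n" for n] by (intro always_eventually allI) (auto simp: norm_mult intro!: mult_right_mono)
    show "(\<lambda>n. 2 * real n powr (- \<beta>)) \<longlonglongrightarrow> 0" using tendsto_mult_right_zero[OF pow0] .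
  qed
  have "(\<lambda>n. (iexp (real n) - 1) * of_real (real n powr (- \<beta>)) + of_real \<beta> * (LINT x:{0<..<real n}|lborel. (iexp x - 1) * of_real (x powr (- (\<beta> + 1))))) \<longlonglongrightarrow> 0 + of_real \<beta> * Kint (\<beta> + 1)"
    by (intro tendsto_add L0 tendsto_mult tendsto_const K)
  then have limL: "(\<lambda>n. L (real n)) \<longlonglongrightarrow> stable_const \<beta>"
  proof (rule Lim_transform_eventually[THEN tendsto_eq_rhs])
    show "\<forall>\<^sub>F n in sequentially. (iexp (real n) - 1) * of_real (real n powr (- \<beta>)) + of_real \<beta> * (LINT x:{0<..<real n}|lborel. (iexp x - 1) * of_real (x powr (- (\<beta> + 1)))) = L (real n)"
      using eventually_gt_at_top[of 0] by eventually_elim (simp only: L_eq of_nat_0_less_iff)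
    show "0 + of_real \<beta> * Kint (\<beta> + 1) = stable_const \<beta>" using \<beta> by (simp add: stable_const_def)
  qed
  show ?thesis
  proof (rule tendstoI)
    fix e :: real assume e: "e > 0"
    \<comment> \<open>The truncation level is fixed before \<open>s\<close> tends to 0. Relative to
      \<open>G s\<close> the truncation error tends to at most
      \<open>2 * A powr (- \<beta>)\<close>, so \<open>e / 8\<close> here becomes
      \<open>e / 4\<close> below.\<close>
    have "\<forall>\<^sub>F n in sequentially. 0 < n \<and> dist (L (real n)) (stable_const \<beta>) < e / 4 \<and> real n powr (- \<beta>) < e / 8"
      using tendstoD[OF limL, of "e / 4"] order_tendstoD(2)[OF pow0, of "e / 8"] e
      by (intro eventually_conj eventually_gt_at_top) auto
    then obtain n :: nat where n: "0 < n" "dist (L (real n)) (stable_const \<beta>) < e / 4" "real n powr (- \<beta>) < e / 8"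
      unfolding eventually_sequentially by blast
    define A where "A = real n"
    have A: "A > 0" using n by (simp add: A_def)
    have "((\<lambda>s. G (1 / A * s) / G s) \<longlongrightarrow> (1 / A) powr \<beta>) (at_right 0)" using A by (intro rv) auto
    moreover have "(1 / A) powr \<beta> < e / 8" using n A by (simp add: A_def powr_divide powr_minus_divide)
    ultimately have "\<forall>\<^sub>F s in at_right 0. G (1 / A * s) / G s < e / 8" by (rule order_tendstoD(2))
    moreover have "\<forall>\<^sub>F s in at_right 0. dist (J A s / of_real (G s)) (L A) < e / 4"
      using e A by (intro tendstoD[OF limJ]) auto
    moreover have "\<forall>\<^sub>F s in at_right 0. 0 < s \<and> s < (1::real)"
      unfolding eventually_at_right_field by (intro exI[of _ 1]) auto
    ultimately show "\<forall>\<^sub>F s in at_right 0. dist (?I s / of_real (G s)) (stable_const \<beta>) < e"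
    proof eventually_elim
      case (elim s)
      have Gs: "G s > 0" using elim by (intro G_pos) auto
      have "norm ((?I s - J A s) / of_real (G s)) \<le> 2 * (G (s / A) / G s)"
        using diff[OF A, of s] elim Gs by (simp add: norm_divide divide_right_mono)
      also have "\<dots> < e / 4" using elim(1) by (simp add: mult.commute)
      finally have 1: "dist (?I s / of_real (G s)) (J A s / of_real (G s)) < e / 4"
        by (simp add: dist_norm diff_divide_distrib)
      show ?case
        using 1 elim(2) n(2) e dist_triangle[of "?I s / of_real (G s)" "stable_const \<beta>" "L A"]
          dist_triangle[of "?I s / of_real (G s)" "L A" "J A s / of_real (G s)"]
        by (simp add: A_def)
    qed
  qed
qed

end

section \<open>Products of centred characteristic functions\<close>

lemma norm_exp_minus_one_minus:
  fixes z :: complex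
  assumes "norm z \<le> 1"
  shows "norm (1 + z - exp z) \<le> 3 * (norm z)\<^sup>2"
proof -
  have "norm (exp z - (\<Sum>i\<le>1. z ^ i / fact i)) \<le> exp \<bar>Re z\<bar> * (norm z) ^ Suc 1 / fact 1"
    by (rule Taylor_exp)
  also have "\<dots> \<le> 3 * (norm z)\<^sup>2"
  proof -
    have "exp \<bar>Re z\<bar> \<le> exp 1" using abs_Re_le_cmod[of z] assms by simp
    also have "\<dots> \<le> (3::real)" using exp_le by simp
    finally show ?thesis by (simp add: power2_eq_square mult_right_mono)
  qed
  finally show ?thesis by (simp add: norm_minus_commute algebra_simps)
qed

context rv_distribution
begin

definition centre :: real where "centre = (if \<beta> < 1 then 0 else \<integral>y. y \<partial>F)"

definition psi :: "real \<Rightarrow> complex" where "psi u = (\<integral>y. iexp (u * (y - centre)) \<partial>F) - 1"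

text \<open>Limits are taken along positive multiples only; negative arguments are covered by
  conjugation, through \<open>psi_uminus\<close>.\<close>

definition stable_exponent :: "real \<Rightarrow> complex" where
  "stable_exponent u = of_real (\<bar>u\<bar> powr \<beta>) * (if u < 0 then cnj (stable_const \<beta>) else stable_const \<beta>)"

lemma integrable_iexp_affine: "integrable F (\<lambda>y. iexp (u * (y - c)))"
  by (intro integrable_const_bound[where B = 1]) auto

lemma psi_0 [simp]: "psi 0 = 0"
  using prob_space by (simp add: psi_def)

text \<open>Makes \<open>exp (psi u)\<close> a number of modulus at most 1, as the factorwise
  comparison of products requires.\<close>

lemma Re_psi: "Re (psi u) \<le> 0"
proof -
  have "Re (\<integral>y. iexp (u * (y - centre)) \<partial>F) \<le> norm (\<integral>y. iexp (u * (y - centre)) \<partial>F)" by (rule complex_Re_le_cmod)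
  also have "\<dots> \<le> (\<integral>y. norm (iexp (u * (y - centre))) \<partial>F)" by (rule integral_norm_bound)
  also have "\<dots> = 1" using prob_space by simp
  finally show ?thesis by (simp add: psi_def)
qed

lemma norm_1_psi: "norm (1 + psi u) \<le> 1"
proof -
  have "norm (\<integral>y. iexp (u * (y - centre)) \<partial>F) \<le> (\<integral>y. norm (iexp (u * (y - centre))) \<partial>F)" by (rule integral_norm_bound)
  also have "\<dots> = 1" using prob_space by simp
  finally show ?thesis by (simp add: psi_def)
qed

lemma psi_uminus: "psi (- u) = cnj (psi u)"
proof -
  have "cnj (\<integral>y. iexp (u * (y - centre)) \<partial>F) = (\<integral>y. cnj (iexp (u * (y - centre))) \<partial>F)"
    by simp
  also have "\<dots> = (\<integral>y. iexp (- u * (y - centre)) \<partial>F)"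
    by (intro Bochner_Integration.integral_cong) (auto simp: exp_cnj)
  finally show ?thesis by (simp add: psi_def)
qed

text \<open>For \<beta> > 1 the exact centring multiplies by \<open>iexp (- (s * m))\<close>,
  whereas \<open>iexp_limit_gt_1\<close> subtracts the linear term. Expanding the product shows that
  the two differ by terms quadratic in \<open>s\<close>, and these are negligible because
  \<open>G s\<close> is at least a multiple of \<open>s powr \<gamma>\<close> with \<gamma> <
  2.\<close>

lemma psi_limit:
  assumes \<beta>2: "\<beta> < 2" "\<beta> \<noteq> 1"
  shows "((\<lambda>s. psi s / of_real (G s)) \<longlongrightarrow> stable_const \<beta>) (at_right 0)"
proof (cases "\<beta> < 1")
  case True
  have "psi s = (\<integral>y. iexp (s * y) - 1 \<partial>F)" for s
    using True integrable_iexp_affine[of s 0] prob_space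
    by (subst Bochner_Integration.integral_diff) (auto simp: psi_def centre_def)
  then show ?thesis using iexp_limit_lt_1[OF True] by simp
next
  let ?R = "\<lambda>s y. iexp (s * y) - 1 - \<i> * of_real (s * y)"
  let ?I = "\<lambda>s. \<integral>y. iexp (s * y) - 1 - \<i> * of_real (s * y) \<partial>F"
  case False
  then have \<beta>: "1 < \<beta>" using \<beta>2 by simp
  note id = integrable_ident[OF \<beta> \<beta>2(1)]
  define m where "m = (\<integral>y. y \<partial>F)"
  have c: "centre = m" using False by (simp add: centre_def m_def)
  have m0: "m \<ge> 0" unfolding m_def using nonneg by (rule integral_nonneg_AE)
  have bound: "norm (psi s - ?I s) \<le> 4 * m\<^sup>2 * s\<^sup>2" if s: "s > 0" for s
  proof -
    have i1: "integrable F (\<lambda>y. iexp (s * y) - 1 - \<i> * of_real (s * y))"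
      using integrable_iexp_affine[of s 0] id by (intro Bochner_Integration.integrable_diff) auto
    have i2: "integrable F (\<lambda>y. iexp (s * (y - m)) - 1 - \<i> * of_real (s * (y - m)))"
      using id by (intro Bochner_Integration.integrable_diff integrable_iexp_affine) auto
    have "(\<integral>y. iexp (s * (y - m)) - 1 - \<i> * of_real (s * (y - m)) \<partial>F) =
        (\<integral>y. iexp (s * (y - m)) \<partial>F) - 1 - \<i> * of_real (\<integral>y. s * (y - m) \<partial>F)"
      using integrable_iexp_affine[of s m] id prob_space
      by (subst Bochner_Integration.integral_diff, simp, simp)
         (subst Bochner_Integration.integral_diff, auto simp del: of_real_mult of_real_diff)
    also have "(\<integral>y. s * (y - m) \<partial>F) = 0" using id prob_space by (simp add: m_def)
    finally have psi_eq: "psi s = (\<integral>y. iexp (s * (y - m)) - 1 - \<i> * of_real (s * (y - m)) \<partial>F)"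
      by (simp add: psi_def c)
    have "norm (psi s - ?I s) =
      norm (\<integral>y. (iexp (s * (y - m)) - 1 - \<i> * of_real (s * (y - m))) - ?R s y \<partial>F)"
      unfolding psi_eq by (rule arg_cong[where f = norm, OF Bochner_Integration.integral_diff[symmetric, OF i2 i1]])
    also have "\<dots> \<le> (\<integral>y. norm ((iexp (s * (y - m)) - 1 - \<i> * of_real (s * (y - m))) - ?R s y) \<partial>F)"
      by (rule integral_norm_bound)
    also have "\<dots> \<le> (\<integral>y. s\<^sup>2 * m\<^sup>2 + s\<^sup>2 * m * y \<partial>F)"
    proof (rule integral_mono_AE)
      show "integrable F (\<lambda>y. norm ((iexp (s * (y - m)) - 1 - \<i> * of_real (s * (y - m))) - ?R s y))"
        by (rule integrable_norm[OF Bochner_Integration.integrable_diff[OF i2 i1]])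
      show "AE y in F. norm ((iexp (s * (y - m)) - 1 - \<i> * of_real (s * (y - m))) - ?R s y) \<le> s\<^sup>2 * m\<^sup>2 + s\<^sup>2 * m * y"
        using nonneg
      proof (elim AE_mp, intro AE_I2 impI)
        fix y :: real assume y: "0 \<le> y"
        have e: "iexp (s * (y - m)) = iexp (s * y) * iexp (- (s * m))"
          by (simp add: exp_add[symmetric] algebra_simps)
        have "(iexp (s * (y - m)) - 1 - \<i> * of_real (s * (y - m))) - ?R s y =
          iexp (s * y) * (iexp (- (s * m)) - 1 - \<i> * of_real (- (s * m))) + \<i> * of_real (- (s * m)) * (iexp (s * y) - 1)"
          unfolding e by (simp add: algebra_simps)
        also have "norm \<dots> \<le> norm (iexp (- (s * m)) - 1 - \<i> * of_real (- (s * m))) + s * m * norm (iexp (s * y) - 1)"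
          using s m0 by (intro order_trans[OF norm_triangle_ineq]) (simp add: norm_mult)
        also have "\<dots> \<le> (s * m)\<^sup>2 + s * m * (s * y)"
        proof (intro add_mono mult_left_mono)
          have "norm (iexp (- (s * m)) - 1 - \<i> * of_real (- (s * m))) \<le> (s * m)\<^sup>2 / 2"
            using iexp_approx1[of "- (s * m)" 1] by (simp add: algebra_simps power2_eq_square)
          then show "norm (iexp (- (s * m)) - 1 - \<i> * of_real (- (s * m))) \<le> (s * m)\<^sup>2" by (rule order_trans) simp
          show "norm (iexp (s * y) - 1) \<le> s * y" using norm_iexp_minus_one[of "s * y"] s y by simp
        qed (use s m0 in auto)
        finally show "norm ((iexp (s * (y - m)) - 1 - \<i> * of_real (s * (y - m))) - ?R s y) \<le> s\<^sup>2 * m\<^sup>2 + s\<^sup>2 * m * y"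
          by (simp add: power2_eq_square mult_ac)
      qed
    qed (use id in auto)
    also have "\<dots> = s\<^sup>2 * m\<^sup>2 + s\<^sup>2 * m * m" using id prob_space by (simp add: m_def)
    also have "\<dots> = 2 * (m\<^sup>2 * s\<^sup>2)" by (simp add: power2_eq_square)
    also have "\<dots> \<le> 4 * (m\<^sup>2 * s\<^sup>2)" by (intro mult_right_mono) auto
    also have "\<dots> = 4 * m\<^sup>2 * s\<^sup>2" by simp
    finally show ?thesis .
  qed
  obtain \<gamma> where \<gamma>: "\<beta> < \<gamma>" "\<gamma> < 2" using \<beta>2 dense by metis
  obtain c where c0: "c > 0" "\<And>s. 0 < s \<Longrightarrow> s \<le> 1 \<Longrightarrow> c * s powr \<gamma> \<le> G s" using G_lower[OF \<gamma>(1)] by metis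
  have "((\<lambda>s. (psi s - ?I s) / of_real (G s)) \<longlongrightarrow> 0) (at_right 0)"
  proof (rule Lim_null_comparison)
    show "\<forall>\<^sub>F s in at_right 0. norm ((psi s - ?I s) / of_real (G s)) \<le> 4 * m\<^sup>2 / c * s powr (2 - \<gamma>)"
      unfolding eventually_at_right_field
    proof (intro exI[of _ 1] conjI allI impI)
      fix s :: real assume s: "0 < s" "s < 1"
      have "norm ((psi s - ?I s) / of_real (G s)) \<le> 4 * m\<^sup>2 * s\<^sup>2 / G s"
        using bound[OF s(1)] G_pos[OF s(1)] by (simp add: norm_divide divide_right_mono)
      also have "\<dots> \<le> 4 * m\<^sup>2 * s\<^sup>2 / (c * s powr \<gamma>)"
        using c0(2)[of s] c0(1) s G_pos[OF s(1)] by (intro divide_left_mono) auto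
      also have "\<dots> = 4 * m\<^sup>2 / c * s powr (2 - \<gamma>)" using s by (simp add: powr_diff)
      finally show "norm ((psi s - ?I s) / of_real (G s)) \<le> 4 * m\<^sup>2 / c * s powr (2 - \<gamma>)" .
    qed simp
    have "((\<lambda>s::real. s powr (2 - \<gamma>)) \<longlongrightarrow> 0) (at_right 0)"
      using \<gamma> by (auto intro!: tendsto_eq_intros simp: eventually_at_right_field intro!: exI[of _ 1])
    then show "((\<lambda>s. 4 * m\<^sup>2 / c * s powr (2 - \<gamma>)) \<longlongrightarrow> 0) (at_right 0)" by (rule tendsto_mult_right_zero)
  qed
  from tendsto_add[OF this iexp_limit_gt_1(2)[OF \<beta> \<beta>2(1)]] show ?thesis by (simp add: diff_divide_distrib)
qed

text \<open>The normalisation stays \<open>G s\<close> while the argument is scaled: regular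
  variation exchanges \<open>G (v * s)\<close> for \<open>G s\<close> and leaves the factor
  \<open>v powr \<beta>\<close>.\<close>

lemma psi_limit_scaled:
  assumes \<beta>2: "\<beta> < 2" "\<beta> \<noteq> 1"
  shows "((\<lambda>s. psi (u * s) / of_real (G s)) \<longlongrightarrow> stable_exponent u) (at_right 0)"
proof -
  have pos: "((\<lambda>s. psi (v * s) / of_real (G s)) \<longlongrightarrow> of_real (v powr \<beta>) * stable_const \<beta>) (at_right 0)" if v: "v > 0" for v
  proof -
    have f: "filterlim (\<lambda>s. v * s) (at_right 0) (at_right 0)"
      using v by (auto simp: filterlim_at eventually_at_right_field intro!: tendsto_eq_intros exI[of _ 1])
    have "((\<lambda>s. psi (v * s) / of_real (G (v * s)) * of_real (G (v * s) / G s)) \<longlongrightarrow> stable_const \<beta> * of_real (v powr \<beta>)) (at_right 0)"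
      using v by (intro tendsto_mult filterlim_compose[OF psi_limit[OF \<beta>2] f] tendsto_of_real rv)
    moreover have "\<forall>\<^sub>F s in at_right 0. psi (v * s) / of_real (G (v * s)) * of_real (G (v * s) / G s) = psi (v * s) / of_real (G s)"
      unfolding eventually_at_right_field using G_pos[of "v * s" for s] v
      by (intro exI[of _ 1]) (auto simp: less_imp_neq[symmetric])
    ultimately show ?thesis by (auto intro: Lim_transform_eventually simp: mult.commute)
  qed
  consider "u > 0" | "u = 0" | "u < 0" by linarith
  then show ?thesis
  proof cases
    case 3
    have "((\<lambda>s. cnj (psi (- u * s) / of_real (G s))) \<longlongrightarrow> cnj (of_real ((- u) powr \<beta>) * stable_const \<beta>)) (at_right 0)"
      using 3 by (intro tendsto_cnj pos) auto
    then show ?thesis using 3 psi_uminus[of "u * s" for s] by (simp add: stable_exponent_def)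
  qed (use pos in \<open>auto simp: stable_exponent_def\<close>)
qed

text \<open>The deterministic core, a limit theorem for null arrays of weights. The sum of the
  \<open>psi\<close> values follows \<open>stable_exponent u\<close> times the sum of the tails,
  hence converges; product and exponential of the sum differ by at most a constant times the sum of
  squares of \<open>psi\<close>, which is the largest value times a bounded sum.\<close>

lemma prod_psi_limit:
  assumes \<beta>2: "\<beta> < 2" "\<beta> \<noteq> 1"
    and c0: "\<And>n t. t \<in> T n \<Longrightarrow> 0 \<le> c n t"
    and sum: "(\<lambda>n. \<Sum>t\<in>T n. G (c n t)) \<longlonglongrightarrow> 1"
    and small: "\<And>e. 0 < e \<Longrightarrow> \<forall>\<^sub>F n in sequentially. \<forall>t\<in>T n. c n t < e"
  shows "(\<lambda>n. \<Prod>t\<in>T n. 1 + psi (u * c n t)) \<longlonglongrightarrow> exp (stable_exponent u)"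
proof -
  define K where "K = stable_exponent u"
  have near: "\<forall>\<^sub>F n in sequentially. \<forall>t\<in>T n. norm (psi (u * c n t) - K * of_real (G (c n t))) \<le> e * G (c n t)" if e: "e > 0" for e
  proof -
    have "\<forall>\<^sub>F s in at_right 0. dist (psi (u * s) / of_real (G s)) K < e"
      using tendstoD[OF psi_limit_scaled[OF \<beta>2] e] by (simp add: K_def)
    then obtain s0 where s0: "s0 > 0" "\<And>s. 0 < s \<Longrightarrow> s < s0 \<Longrightarrow> dist (psi (u * s) / of_real (G s)) K < e"
      unfolding eventually_at_right_field by auto
    have s: "norm (psi (u * s) - K * of_real (G s)) \<le> e * G s" if "0 \<le> s" "s < s0" for s
    proof (cases "s = 0")
      case False
      have g: "G s > 0" using that False by (intro G_pos) auto
      have "norm (psi (u * s) - K * of_real (G s)) = norm (psi (u * s) / of_real (G s) - K) * G s"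
      proof -
        have "psi (u * s) - K * of_real (G s) = (psi (u * s) / of_real (G s) - K) * of_real (G s)"
          using g by (simp add: left_diff_distrib)
        then show ?thesis using g by (simp only: norm_mult norm_of_real abs_of_pos)
      qed
      also have "\<dots> \<le> e * G s" using s0(2)[of s] that False g by (intro mult_right_mono) (auto simp: dist_norm)
      finally show ?thesis .
    qed (simp add: G_0)
    show ?thesis using small[OF s0(1)] by eventually_elim (auto intro!: s c0)
  qed
  have sumG: "(\<Sum>t\<in>T n. G (c n t)) \<ge> 0" for n by (intro sum_nonneg G_nonneg c0)
  have S: "(\<lambda>n. (\<Sum>t\<in>T n. psi (u * c n t)) - K * of_real (\<Sum>t\<in>T n. G (c n t))) \<longlonglongrightarrow> 0"
  proof (rule tendstoI)
    fix e :: real assume e: "e > 0"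
    have "\<forall>\<^sub>F n in sequentially. (\<Sum>t\<in>T n. G (c n t)) < 2" using order_tendstoD(2)[OF sum, of 2] by simp
    moreover have "\<forall>\<^sub>F n in sequentially. \<forall>t\<in>T n. norm (psi (u * c n t) - K * of_real (G (c n t))) \<le> e / 2 * G (c n t)"
      using e by (intro near) auto
    ultimately show "\<forall>\<^sub>F n in sequentially. dist ((\<Sum>t\<in>T n. psi (u * c n t)) - K * of_real (\<Sum>t\<in>T n. G (c n t))) 0 < e"
    proof eventually_elim
      case (elim n)
      have "norm ((\<Sum>t\<in>T n. psi (u * c n t)) - K * of_real (\<Sum>t\<in>T n. G (c n t))) = norm (\<Sum>t\<in>T n. psi (u * c n t) - K * of_real (G (c n t)))"
        by (simp add: sum_subtractf sum_distrib_left)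
      also have "\<dots> \<le> (\<Sum>t\<in>T n. e / 2 * G (c n t))" using elim by (intro sum_norm_le) auto
      also have "\<dots> = e / 2 * (\<Sum>t\<in>T n. G (c n t))" by (simp add: sum_distrib_left)
      also have "\<dots> < e / 2 * 2" using elim e by (intro mult_strict_left_mono) auto
      finally show ?case by simp
    qed
  qed
  have "(\<lambda>n. ((\<Sum>t\<in>T n. psi (u * c n t)) - K * of_real (\<Sum>t\<in>T n. G (c n t))) + K * of_real (\<Sum>t\<in>T n. G (c n t))) \<longlonglongrightarrow> 0 + K * of_real 1"
    by (intro tendsto_add S tendsto_mult tendsto_const tendsto_of_real sum)
  then have "(\<lambda>n. \<Sum>t\<in>T n. psi (u * c n t)) \<longlonglongrightarrow> K" by simp
  then have E: "(\<lambda>n. exp (\<Sum>t\<in>T n. psi (u * c n t))) \<longlonglongrightarrow> exp K" by (rule tendsto_exp)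
  have "(\<lambda>n. (\<Prod>t\<in>T n. 1 + psi (u * c n t)) - exp (\<Sum>t\<in>T n. psi (u * c n t))) \<longlonglongrightarrow> 0"
  proof (rule tendstoI)
    fix e :: real assume e: "e > 0"
    \<comment> \<open>\<open>B\<close> is the constant in the bound of \<open>psi\<close> by
      \<open>G\<close> that \<open>near\<close> gives with tolerance 1. The 6 in \<open>d\<close> is
      the 3 of \<open>norm_exp_minus_one_minus\<close> times the bound 2 on the sum of
      tails.\<close>
    define B where "B = norm K + 1"
    have B: "B > 0" by (simp add: B_def add_nonneg_pos)
    define d where "d = min 1 (e / (6 * B))"
    have d: "d > 0" "d \<le> 1" "d * (6 * B) \<le> e" using e B by (auto simp: d_def min_def field_simps)
    \<comment> \<open>\<open>G\<close> vanishes at \<open>0+\<close>: \<open>potter_small\<close>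
      with the positive exponent \<open>\<beta> / 2\<close>, anchored at the fixed point
      \<open>r / 2\<close>.\<close>
    have Gs: "\<exists>r>0. \<forall>s. 0 \<le> s \<longrightarrow> s < r \<longrightarrow> B * G s \<le> d"
    proof -
      obtain C r where C: "C > 0" "r > 0" "\<And>s l. 0 < s \<Longrightarrow> s < r \<Longrightarrow> 0 < l \<Longrightarrow> l \<le> 1 \<Longrightarrow> G (l * s) \<le> C * l powr (\<beta> / 2) * G s"
        using potter_small[of "\<beta> / 2"] \<beta>_pos by auto
      have "((\<lambda>s::real. B * (C * s powr (\<beta> / 2))) \<longlongrightarrow> 0) (at_right 0)"
        using \<beta>_pos by (auto intro!: tendsto_eq_intros simp: eventually_at_right_field intro!: exI[of _ 1])
      then have "\<forall>\<^sub>F s::real in at_right 0. B * (C * s powr (\<beta> / 2)) < d" using d by (intro order_tendstoD(2))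
      then obtain q where q: "q > 0" "\<And>s. 0 < s \<Longrightarrow> s < q \<Longrightarrow> B * (C * s powr (\<beta> / 2)) < d"
        unfolding eventually_at_right_field by auto
      show ?thesis
      proof (intro exI[of _ "min 1 q * (r / 2)"] conjI allI impI)
        fix s assume s: "0 \<le> s" "s < min 1 q * (r / 2)"
        show "B * G s \<le> d"
        proof (cases "s = 0")
          case False
          define l where "l = s / (r / 2)"
          have "l < min 1 q" using s C(2) by (simp only: l_def pos_divide_less_eq half_gt_zero)
          then have l: "0 < l" "l < 1" "l < q" using s False C(2) by (auto simp: l_def)
          have "G s = G (l * (r / 2))" using C(2) by (simp add: l_def)
          also have "\<dots> \<le> C * l powr (\<beta> / 2) * G (r / 2)" using l C(2) by (intro C(3)) auto
          also have "\<dots> \<le> C * l powr (\<beta> / 2) * 1" using C(1) by (intro mult_left_mono G_le_1) auto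
          finally have "B * G s \<le> B * (C * l powr (\<beta> / 2))" using B by (intro mult_left_mono) auto
          then show ?thesis using q(2)[of l] l by simp
        qed (use d in \<open>simp add: G_0\<close>)
      qed (use q C in auto)
    qed
    then obtain r where r: "r > 0" "\<And>s. 0 \<le> s \<Longrightarrow> s < r \<Longrightarrow> B * G s \<le> d" by blast
    have "\<forall>\<^sub>F n in sequentially. (\<Sum>t\<in>T n. G (c n t)) < 2" using order_tendstoD(2)[OF sum, of 2] by simp
    moreover note small[OF r(1)] near[OF zero_less_one]
    ultimately show "\<forall>\<^sub>F n in sequentially. dist ((\<Prod>t\<in>T n. 1 + psi (u * c n t)) - exp (\<Sum>t\<in>T n. psi (u * c n t))) 0 < e"
    proof eventually_elim
      case (elim n)
      have p: "norm (psi (u * c n t)) \<le> B * G (c n t)" if "t \<in> T n" for t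
      proof -
        have "norm (psi (u * c n t)) \<le> norm (K * of_real (G (c n t))) + norm (psi (u * c n t) - K * of_real (G (c n t)))"
          by (metis norm_triangle_sub)
        also have "norm (K * of_real (G (c n t))) = norm K * G (c n t)" using G_nonneg[OF c0[OF that]] by (simp add: norm_mult)
        finally show ?thesis using elim(3) that by (auto simp: B_def distrib_right)
      qed
      have p2: "norm (1 + psi (u * c n t) - exp (psi (u * c n t))) \<le> 3 * d * B * G (c n t)" if t: "t \<in> T n" for t
      proof -
        have "norm (psi (u * c n t)) \<le> d" using p[OF t] r(2)[OF c0[OF t]] elim(2) t by fastforce
        then have "norm (1 + psi (u * c n t) - exp (psi (u * c n t))) \<le> 3 * (norm (psi (u * c n t)))\<^sup>2"
          using d by (intro norm_exp_minus_one_minus) auto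
        also have "\<dots> \<le> 3 * (d * (B * G (c n t)))" unfolding power2_eq_square
          using p[OF t] \<open>norm (psi (u * c n t)) \<le> d\<close> d by (intro mult_left_mono mult_mono) auto
        finally show ?thesis by (simp add: mult.assoc)
      qed
      show ?case
      \<comment> \<open>Over an infinite index set the product is 1 and the sum 0 by convention, so
        the difference is 0.\<close>
      proof (cases "finite (T n)")
        case True
        have "norm ((\<Prod>t\<in>T n. 1 + psi (u * c n t)) - exp (\<Sum>t\<in>T n. psi (u * c n t))) =
           norm ((\<Prod>t\<in>T n. 1 + psi (u * c n t)) - (\<Prod>t\<in>T n. exp (psi (u * c n t))))" using True by (simp add: exp_sum)
        also have "\<dots> \<le> (\<Sum>t\<in>T n. norm (1 + psi (u * c n t) - exp (psi (u * c n t))))"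
          using Re_psi by (intro norm_prod_diff norm_1_psi) (auto simp: norm_exp_eq_Re)
        also have "\<dots> \<le> (\<Sum>t\<in>T n. 3 * d * B * G (c n t))" by (intro sum_mono p2)
        also have "\<dots> = 3 * d * B * (\<Sum>t\<in>T n. G (c n t))" by (simp add: sum_distrib_left)
        also have "\<dots> < 3 * d * B * 2" using elim d B by (intro mult_strict_left_mono) auto
        also have "\<dots> \<le> e" using d by (simp add: mult_ac)
        finally show ?thesis by simp
      qed (use e in simp)
    qed
  qed
  from tendsto_add[OF this E] show ?thesis by (simp add: K_def)
qed

end

section \<open>Covariance inequalities under mixing\<close>

text \<open>\<open>min (U \<omega>) K\<close> is the integral over \<open>x\<close> from 0 to
  \<open>K\<close> of the indicator of \<open>x < U \<omega>\<close>, so a bound that holds for all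
  these indicators integrates to \<open>K\<close> times itself. Two applications pass from events to
  bounded variables.\<close>

lemma (in prob_space) expectation_min_bound:
  fixes U W :: "'a \<Rightarrow> real"
  assumes [measurable]: "U \<in> borel_measurable M" "W \<in> borel_measurable M"
    and U0: "\<And>\<omega>. \<omega> \<in> space M \<Longrightarrow> 0 \<le> U \<omega>" and W: "\<And>\<omega>. \<bar>W \<omega>\<bar> \<le> B" and K: "0 \<le> K"
    and s: "\<And>x. 0 \<le> x \<Longrightarrow> \<bar>expectation (\<lambda>\<omega>. indicator {\<omega>. x < U \<omega>} \<omega> * W \<omega>)\<bar> \<le> s"
  shows "\<bar>expectation (\<lambda>\<omega>. min (U \<omega>) K * W \<omega>)\<bar> \<le> K * s"
proof -
  interpret P: pair_sigma_finite lborel M ..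
  have B: "B \<ge> 0" using W[of undefined] by linarith
  define f where "f x \<omega> = indicator {0..<K} x * (indicator {p. fst p < U (snd p)} (x, \<omega>) * W \<omega>)" for x \<omega>
  have [measurable]: "(\<lambda>(x, \<omega>). f x \<omega>) \<in> borel_measurable (lborel \<Otimes>\<^sub>M M)"
    unfolding f_def by measurable
  have I: "integrable (lborel \<Otimes>\<^sub>M M) (\<lambda>(x, \<omega>). f x \<omega>)"
  proof (rule Bochner_Integration.integrable_bound)
    show "integrable (lborel \<Otimes>\<^sub>M M) (\<lambda>p. B * indicator ({0..<K} \<times> space M) p)"
      using K by (intro integrable_mult_right) (auto simp: integrable_indicator_iff emeasure_pair_measure_Times emeasure_space_1 lborel.emeasure_pair_measure_Times)
    show "AE p in lborel \<Otimes>\<^sub>M M. norm (case p of (x, \<omega>) \<Rightarrow> f x \<omega>) \<le> norm (B * indicator ({0..<K} \<times> space M) p)"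
      using W B by (intro AE_I2) (auto simp: f_def space_pair_measure indicator_def)
  qed simp
  have inner: "(\<integral>x. f x \<omega> \<partial>lborel) = min (U \<omega>) K * W \<omega>" if "\<omega> \<in> space M" for \<omega>
  proof -
    have "(\<integral>x. f x \<omega> \<partial>lborel) = (\<integral>x. indicator {0..<min (U \<omega>) K} x * W \<omega> \<partial>lborel)"
      by (intro Bochner_Integration.integral_cong) (auto simp: f_def split: split_indicator)
    also have "\<dots> = min (U \<omega>) K * W \<omega>" using U0[OF that] K by simp
    finally show ?thesis .
  qed
  have "expectation (\<lambda>\<omega>. min (U \<omega>) K * W \<omega>) = (\<integral>\<omega>. (\<integral>x. f x \<omega> \<partial>lborel) \<partial>M)"
    by (intro Bochner_Integration.integral_cong) (auto simp: inner)
  also have "\<dots> = (\<integral>x. (\<integral>\<omega>. f x \<omega> \<partial>M) \<partial>lborel)" by (rule P.Fubini_integral[OF I])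
  also have "\<bar>\<dots>\<bar> \<le> (\<integral>x. indicator {0..<K} x * s \<partial>lborel)"
    unfolding real_norm_def[symmetric]
  proof (rule order_trans[OF integral_norm_bound], rule integral_mono)
    show "integrable lborel (\<lambda>x. norm (\<integral>\<omega>. f x \<omega> \<partial>M))" using P.integrable_fst[OF I] by simp
    show "integrable lborel (\<lambda>x. indicator {0..<K} x * s)"
      using K by (intro integrable_mult_left) (auto simp: integrable_indicator_iff)
    show "norm (\<integral>\<omega>. f x \<omega> \<partial>M) \<le> indicator {0..<K} x * s" for x
    proof (cases "x \<in> {0..<K}")
      case True
      have "(\<integral>\<omega>. f x \<omega> \<partial>M) = expectation (\<lambda>\<omega>. indicator {\<omega>. x < U \<omega>} \<omega> * W \<omega>)"
        using True by (intro Bochner_Integration.integral_cong) (auto simp: f_def split: split_indicator)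
      then show ?thesis using s[of x] True by simp
    qed (simp add: f_def)
  qed
  also have "\<dots> = K * s" using K by simp
  finally show ?thesis .
qed

text \<open>\<open>expectation_min_bound\<close> applied to \<open>U\<close> against the centred
  truncation of \<open>V\<close>; its hypothesis on indicators of \<open>U\<close> is a second
  application, to \<open>V\<close> against a centred indicator, and there only events
  remain.\<close>

lemma (in prob_space) covariance_min_bound:
  fixes U V :: "'a \<Rightarrow> real"
  assumes [measurable]: "U \<in> borel_measurable M" "V \<in> borel_measurable M"
    and U0: "\<And>\<omega>. \<omega> \<in> space M \<Longrightarrow> 0 \<le> U \<omega>" and V0: "\<And>\<omega>. \<omega> \<in> space M \<Longrightarrow> 0 \<le> V \<omega>" and K: "0 \<le> K"
    and r: "\<And>x y. \<bar>prob ({\<omega> \<in> space M. x < U \<omega>} \<inter> {\<omega> \<in> space M. y < V \<omega>}) - prob {\<omega> \<in> space M. x < U \<omega>} * prob {\<omega> \<in> space M. y < V \<omega>}\<bar> \<le> r"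
  shows "\<bar>expectation (\<lambda>\<omega>. min (U \<omega>) K * min (V \<omega>) K) - expectation (\<lambda>\<omega>. min (U \<omega>) K) * expectation (\<lambda>\<omega>. min (V \<omega>) K)\<bar> \<le> K\<^sup>2 * r"
proof -
  let ?A = "\<lambda>x. {\<omega> \<in> space M. x < U \<omega>}"
  let ?B = "\<lambda>y. {\<omega> \<in> space M. y < V \<omega>}"
  \<comment> \<open>Clipped from below as well, because the weight in
    \<open>expectation_min_bound\<close> has to be bounded at every point, including those outside
    the space.\<close>
  define V' where "V' \<omega> = max 0 (min (V \<omega>) K)" for \<omega>
  have [measurable]: "V' \<in> borel_measurable M" unfolding V'_def by measurable
  have V': "0 \<le> V' \<omega>" "V' \<omega> \<le> K" for \<omega> using K by (auto simp: V'_def)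
  have V'eq: "\<omega> \<in> space M \<Longrightarrow> V' \<omega> = min (V \<omega>) K" for \<omega> using V0[of \<omega>] K by (auto simp: V'_def)
  have iV': "integrable M V'" using V' by (intro integrable_const_bound[where B = K]) auto
  have EV': "0 \<le> expectation V'" "expectation V' \<le> K"
    using V' iV' by (auto intro!: integral_nonneg_AE integral_le_const)
  have iU: "integrable M (\<lambda>\<omega>. min (U \<omega>) K)" using U0 K by (intro integrable_const_bound[where B = K]) auto
  have iUV: "integrable M (\<lambda>\<omega>. min (U \<omega>) K * V' \<omega>)"
    using U0 V' K by (intro integrable_const_bound[where B = "K * K"]) (auto simp: abs_mult intro!: AE_I2 mult_mono)
  have step1: "\<bar>expectation (\<lambda>\<omega>. min (U \<omega>) K * (V' \<omega> - expectation V'))\<bar> \<le> K * (K * r)"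
  proof (rule expectation_min_bound[where B = K])
    show "\<bar>V' \<omega> - expectation V'\<bar> \<le> K" for \<omega> using V'[of \<omega>] EV' by linarith
    fix x :: real assume "0 \<le> x"
    define p where "p = prob (?A x)"
    define A where "A \<omega> = (indicator {\<omega>. x < U \<omega>} \<omega> :: real)" for \<omega>
    have [measurable]: "A \<in> borel_measurable M" unfolding A_def by measurable
    have iA: "integrable M A" unfolding A_def by (intro integrable_const_bound[where B = 1]) auto
    have EA: "expectation A = p"
    proof -
      have "expectation A = expectation (indicator (?A x))"
        by (intro Bochner_Integration.integral_cong) (auto simp: A_def split: split_indicator)
      then show ?thesis by (simp add: p_def)
    qed
    have p: "0 \<le> p" "p \<le> 1" by (auto simp: p_def)
    have iAV: "integrable M (\<lambda>\<omega>. A \<omega> * V' \<omega>)"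
      using V' K by (intro integrable_const_bound[where B = K]) (auto simp: A_def split: split_indicator)
    have "\<bar>expectation (\<lambda>\<omega>. min (V \<omega>) K * (A \<omega> - p))\<bar> \<le> K * r"
    proof (rule expectation_min_bound[where B = 1])
      show "\<bar>A \<omega> - p\<bar> \<le> 1" for \<omega> using p by (auto simp: A_def split: split_indicator)
      fix y :: real
      have i2: "integrable M (\<lambda>\<omega>. indicator (?B y) \<omega> * p)"
        by (intro integrable_mult_left) (simp add: integrable_indicator_iff emeasure_eq_measure)
      have i1: "integrable M (indicator ((?A x) \<inter> (?B y)) :: _ \<Rightarrow> real)"
        by (simp add: integrable_indicator_iff emeasure_eq_measure)
      have "expectation (\<lambda>\<omega>. indicator {\<omega>. y < V \<omega>} \<omega> * (A \<omega> - p)) =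
        expectation (\<lambda>\<omega>. indicator ((?A x) \<inter> (?B y)) \<omega> - indicator (?B y) \<omega> * p)"
        by (intro Bochner_Integration.integral_cong) (auto simp: A_def split: split_indicator)
      also have "\<dots> = prob ((?A x) \<inter> (?B y)) - prob (?B y) * p"
        using i1 i2 by simp
      finally show "\<bar>expectation (\<lambda>\<omega>. indicator {\<omega>. y < V \<omega>} \<omega> * (A \<omega> - p))\<bar> \<le> r"
        using r[of x y] by (simp add: p_def mult.commute)
    qed (use V0 K in auto)
    \<comment> \<open>A covariance may be centred in either factor: the centring moves from the
      indicator to \<open>V'\<close>.\<close>
    also have "expectation (\<lambda>\<omega>. min (V \<omega>) K * (A \<omega> - p)) = expectation (\<lambda>\<omega>. A \<omega> * V' \<omega> - p * V' \<omega>)"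
      by (intro Bochner_Integration.integral_cong) (auto simp: V'eq algebra_simps)
    also have "\<dots> = expectation (\<lambda>\<omega>. A \<omega> * V' \<omega>) - p * expectation V'" using iAV iV' by simp
    also have "\<dots> = expectation (\<lambda>\<omega>. A \<omega> * V' \<omega> - A \<omega> * expectation V')" using iAV iA by (simp add: EA)
    finally show "\<bar>expectation (\<lambda>\<omega>. indicator {\<omega>. x < U \<omega>} \<omega> * (V' \<omega> - expectation V'))\<bar> \<le> K * r"
      by (simp add: A_def right_diff_distrib)
  qed (use U0 K in auto)
  have EV'_eq: "expectation V' = expectation (\<lambda>\<omega>. min (V \<omega>) K)"
    by (intro Bochner_Integration.integral_cong) (auto simp: V'eq)
  have "expectation (\<lambda>\<omega>. min (U \<omega>) K * (V' \<omega> - expectation V')) = expectation (\<lambda>\<omega>. min (U \<omega>) K * V' \<omega> - min (U \<omega>) K * expectation V')"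
    by (simp add: right_diff_distrib)
  also have "\<dots> = expectation (\<lambda>\<omega>. min (U \<omega>) K * V' \<omega>) - expectation (\<lambda>\<omega>. min (U \<omega>) K) * expectation V'"
    using iUV iU by simp
  also have "expectation (\<lambda>\<omega>. min (U \<omega>) K * V' \<omega>) = expectation (\<lambda>\<omega>. min (U \<omega>) K * min (V \<omega>) K)"
    by (intro Bochner_Integration.integral_cong) (auto simp: V'eq)
  finally show ?thesis using step1 by (simp add: EV'_eq power2_eq_square mult.assoc)
qed

text \<open>Above \<open>K\<close> the factor \<open>u powr (2 - q)\<close> is at most
  \<open>K powr (2 - q)\<close>, since the exponent is not positive. Markov's inequality for the
  part cut off by truncation.\<close>

lemma powr_excess_bound:
  fixes u K q :: real
  assumes "0 \<le> u" "1 \<le> K" "2 \<le> q" "K < u"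
  shows "u\<^sup>2 \<le> K powr (2 - q) * u powr q" "u \<le> K powr (2 - q) * u powr q"
proof -
  have "u powr (2 - q) \<le> K powr (2 - q)" using assms by (intro powr_mono2') auto
  then have "u powr (2 - q) * u powr q \<le> K powr (2 - q) * u powr q" by (intro mult_right_mono) auto
  moreover have "u powr (2 - q) * u powr q = u\<^sup>2" using assms by (simp add: powr_add[symmetric])
  ultimately show 1: "u\<^sup>2 \<le> K powr (2 - q) * u powr q" by simp
  have "u \<le> u\<^sup>2" using assms by (simp add: power2_eq_square)
  then show "u \<le> K powr (2 - q) * u powr q" using 1 by simp
qed

text \<open>Truncation at \<open>K\<close> leaves a bounded covariance plus excesses of order
  \<open>K powr (2 - q)\<close>. In the constant, \<open>2 * C\<close> comes from the mean of the
  product and \<open>2 * C * (1 + C)\<close> from the product of the means, each mean being at most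
  \<open>1 + C\<close>.\<close>

lemma (in prob_space) covariance_truncation_bound:
  fixes U V :: "'a \<Rightarrow> real"
  assumes [measurable]: "U \<in> borel_measurable M" "V \<in> borel_measurable M"
    and U0: "\<And>\<omega>. \<omega> \<in> space M \<Longrightarrow> 0 \<le> U \<omega>" and V0: "\<And>\<omega>. \<omega> \<in> space M \<Longrightarrow> 0 \<le> V \<omega>" and K: "1 \<le> K" and q: "2 \<le> q"
    and r: "\<And>x y. \<bar>prob ({\<omega> \<in> space M. x < U \<omega>} \<inter> {\<omega> \<in> space M. y < V \<omega>}) - prob {\<omega> \<in> space M. x < U \<omega>} * prob {\<omega> \<in> space M. y < V \<omega>}\<bar> \<le> r"
    and iU: "integrable M (\<lambda>\<omega>. U \<omega> powr q)" and iV: "integrable M (\<lambda>\<omega>. V \<omega> powr q)"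
    and C: "expectation (\<lambda>\<omega>. U \<omega> powr q) \<le> C" "expectation (\<lambda>\<omega>. V \<omega> powr q) \<le> C"
  shows "\<bar>expectation (\<lambda>\<omega>. U \<omega> * V \<omega>) - expectation U * expectation V\<bar> \<le> K\<^sup>2 * r + (2 * C + 2 * C * (1 + C)) * K powr (2 - q)"
    and "integrable M U" "integrable M (\<lambda>\<omega>. U \<omega> * V \<omega>)"
proof -
  let ?m = "\<lambda>\<omega>. min (U \<omega>) K * min (V \<omega>) K"
  let ?p = "\<lambda>\<omega>. U \<omega> * V \<omega>"
  let ?k = "\<lambda>X \<omega>. min (X \<omega>) K"
  have C0: "0 \<le> C" using C(1) by (rule order_trans[OF integral_nonneg_AE, rotated]) auto
  have le1: "u \<le> 1 + u powr q" if "0 \<le> u" for u :: real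
    using powr_excess_bound(2)[of u 1 q] that q by (cases "1 < u") (auto intro: order_trans[of _ 1])
  have sq1: "u\<^sup>2 \<le> 1 + u powr q" if "0 \<le> u" for u :: real
    using powr_excess_bound(1)[of u 1 q] that q by (cases "1 < u") (auto intro: order_trans[of _ 1] simp: power_le_one)
  have int1: "integrable M X" if [measurable]: "X \<in> borel_measurable M" and "\<And>\<omega>. \<omega> \<in> space M \<Longrightarrow> 0 \<le> X \<omega>" "integrable M (\<lambda>\<omega>. X \<omega> powr q)" for X
    using that by (intro Bochner_Integration.integrable_bound[of M "\<lambda>\<omega>. 1 + X \<omega> powr q" X]) (auto intro!: le1)
  show iU1: "integrable M U" by (rule int1) (use U0 iU in auto)
  have iV1: "integrable M V" by (rule int1) (use V0 iV in auto)
  show iUV1: "integrable M ?p"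
  proof (rule Bochner_Integration.integrable_bound[of M "\<lambda>\<omega>. (1 + U \<omega> powr q) + (1 + V \<omega> powr q)"])
    show "AE \<omega> in M. norm (U \<omega> * V \<omega>) \<le> norm ((1 + U \<omega> powr q) + (1 + V \<omega> powr q))"
    proof (intro AE_I2)
      fix \<omega> assume w: "\<omega> \<in> space M"
      have "2 * (U \<omega> * V \<omega>) \<le> (U \<omega>)\<^sup>2 + (V \<omega>)\<^sup>2" using sum_squares_bound[of "U \<omega>" "V \<omega>"] by simp
      moreover have "0 \<le> U \<omega> * V \<omega>" using U0[OF w] V0[OF w] by simp
      ultimately show "norm (U \<omega> * V \<omega>) \<le> norm ((1 + U \<omega> powr q) + (1 + V \<omega> powr q))"
        using sq1[OF U0[OF w]] sq1[OF V0[OF w]] by simp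
    qed
  qed (use iU iV in auto)
  have K0: "0 \<le> K" using K by simp
  have i1: "integrable M (?k U)" using U0 K by (intro integrable_const_bound[where B = K]) auto
  have i1V: "integrable M (?k V)" using V0 K by (intro integrable_const_bound[where B = K]) auto
  have i2: "integrable M ?m"
    using U0 V0 K by (intro integrable_const_bound[where B = "K * K"]) (auto simp: abs_mult intro!: AE_I2 mult_mono)
  define k where "k = K powr (2 - q)"
  have k0: "0 \<le> k" by (simp add: k_def)
  have d2: "0 \<le> expectation ?p - expectation ?m"
    "expectation ?p - expectation ?m \<le> k * (2 * C)"
  proof -
    have pw: "U \<omega> * V \<omega> - min (U \<omega>) K * min (V \<omega>) K \<le> k * (U \<omega> powr q + V \<omega> powr q)" if w: "\<omega> \<in> space M" for \<omega>
    proof -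
      have u: "0 \<le> U \<omega>" "0 \<le> V \<omega>" using U0 V0 w by auto
      have m: "0 \<le> min (U \<omega>) K * min (V \<omega>) K" using u K by simp
      \<comment> \<open>If truncation has any effect, the larger factor exceeds \<open>K\<close> and
        the product is at most its square.\<close>
      consider "U \<omega> \<le> K" "V \<omega> \<le> K" | "K < U \<omega>" "V \<omega> \<le> U \<omega>" | "K < V \<omega>" "U \<omega> \<le> V \<omega>" by linarith
      then show ?thesis
      proof cases
        case 1
        then show ?thesis using k0 by (simp add: min_def)
      next
        case 2
        have "U \<omega> * V \<omega> \<le> (U \<omega>)\<^sup>2" using 2 u by (simp add: power2_eq_square mult_left_mono)
        also have "\<dots> \<le> k * U \<omega> powr q" unfolding k_def using 2 u K q by (intro powr_excess_bound(1)) auto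
        also have "\<dots> \<le> k * (U \<omega> powr q + V \<omega> powr q)" using k0 by (intro mult_left_mono) auto
        finally show ?thesis using m by linarith
      next
        case 3
        have "U \<omega> * V \<omega> \<le> (V \<omega>)\<^sup>2" using 3 u by (simp add: power2_eq_square mult_right_mono)
        also have "\<dots> \<le> k * V \<omega> powr q" unfolding k_def using 3 u K q by (intro powr_excess_bound(1)) auto
        also have "\<dots> \<le> k * (U \<omega> powr q + V \<omega> powr q)" using k0 by (intro mult_left_mono) auto
        finally show ?thesis using m by linarith
      qed
    qed
    have "expectation (\<lambda>\<omega>. U \<omega> * V \<omega> - min (U \<omega>) K * min (V \<omega>) K) \<le> expectation (\<lambda>\<omega>. k * (U \<omega> powr q + V \<omega> powr q))"
      using pw iUV1 i2 iU iV by (intro integral_mono) auto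
    also have "\<dots> = k * (expectation (\<lambda>\<omega>. U \<omega> powr q) + expectation (\<lambda>\<omega>. V \<omega> powr q))" using iU iV by simp
    also have "\<dots> \<le> k * (2 * C)" using k0 C by (intro mult_left_mono) auto
    finally show "expectation ?p - expectation ?m \<le> k * (2 * C)"
      using iUV1 i2 by simp
    have "0 \<le> expectation (\<lambda>\<omega>. U \<omega> * V \<omega> - min (U \<omega>) K * min (V \<omega>) K)"
      using U0 V0 K by (intro integral_nonneg_AE AE_I2) (auto intro!: mult_mono)
    then show "0 \<le> expectation ?p - expectation ?m"
      using iUV1 i2 by simp
  qed
  have d1: "0 \<le> expectation X - expectation (?k X) \<and> expectation X - expectation (?k X) \<le> k * C
      \<and> 0 \<le> expectation (?k X) \<and> expectation X \<le> 1 + C"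
    if iX: "integrable M X" and X0: "\<And>\<omega>. \<omega> \<in> space M \<Longrightarrow> 0 \<le> X \<omega>" and iX': "integrable M (\<lambda>\<omega>. X \<omega> powr q)" and CX: "expectation (\<lambda>\<omega>. X \<omega> powr q) \<le> C" for X
  proof -
    note [measurable] = borel_measurable_integrable[OF iX]
    have im: "integrable M (?k X)" using X0 K by (intro integrable_const_bound[where B = K]) auto
    have "expectation (\<lambda>\<omega>. X \<omega> - min (X \<omega>) K) \<le> expectation (\<lambda>\<omega>. k * X \<omega> powr q)"
    proof (rule integral_mono)
      fix \<omega> assume w: "\<omega> \<in> space M"
      show "X \<omega> - min (X \<omega>) K \<le> k * X \<omega> powr q"
        using powr_excess_bound(2)[of "X \<omega>" K q] X0[OF w] K q k0 by (cases "K < X \<omega>") (auto simp: k_def)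
    qed (use iX im iX' in auto)
    also have "\<dots> \<le> k * C" using k0 CX by (simp add: mult_left_mono)
    finally have 1: "expectation X - expectation (?k X) \<le> k * C" using iX im by simp
    have "0 \<le> expectation (\<lambda>\<omega>. X \<omega> - min (X \<omega>) K)" by (intro integral_nonneg_AE AE_I2) auto
    then have 2: "0 \<le> expectation X - expectation (?k X)" using iX im by simp
    have 3: "0 \<le> expectation (?k X)" using X0 K by (intro integral_nonneg_AE AE_I2) auto
    have "expectation X \<le> expectation (\<lambda>\<omega>. 1 + X \<omega> powr q)" using iX iX' X0 by (intro integral_mono) (auto intro: le1)
    also have "\<dots> \<le> 1 + C" using iX' CX prob_space by simp
    finally show ?thesis using 1 2 3 by simp
  qed
  note dU = d1[OF iU1 U0 iU C(1)] and dV = d1[OF iV1 V0 iV C(2)]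
  define eu ev eu' ev' where "eu = expectation U" "ev = expectation V" "eu' = expectation (?k U)" "ev' = expectation (?k V)"
  note e = this
  have p: "0 \<le> eu * ev - eu' * ev'" "eu * ev - eu' * ev' \<le> k * (2 * C * (1 + C))"
  proof -
    have split: "eu * ev - eu' * ev' = (eu - eu') * ev + eu' * (ev - ev')" by (simp add: algebra_simps)
    have n: "0 \<le> eu - eu'" "eu - eu' \<le> k * C" "0 \<le> eu'" "eu \<le> 1 + C" "0 \<le> ev - ev'" "ev - ev' \<le> k * C" "0 \<le> ev'" "ev \<le> 1 + C"
      using dU dV by (auto simp: e)
    then have n2: "0 \<le> ev" "eu' \<le> 1 + C" by auto
    show "0 \<le> eu * ev - eu' * ev'" unfolding split using n n2 by simp
    have "(eu - eu') * ev \<le> (k * C) * (1 + C)" using n n2 C0 k0 by (intro mult_mono) auto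
    moreover have "eu' * (ev - ev') \<le> (1 + C) * (k * C)" using n n2 C0 k0 by (intro mult_mono) auto
    ultimately show "eu * ev - eu' * ev' \<le> k * (2 * C * (1 + C))" unfolding split by (simp add: algebra_simps)
  qed
  have m: "\<bar>expectation ?m - eu' * ev'\<bar> \<le> K\<^sup>2 * r"
    unfolding e using covariance_min_bound[OF assms(1,2) U0 V0 K0 r] by simp
  have "\<bar>expectation ?p - eu * ev\<bar> \<le> K\<^sup>2 * r + (k * (2 * C) + k * (2 * C * (1 + C)))"
    using m d2 p by linarith
  then show "\<bar>expectation ?p - expectation U * expectation V\<bar> \<le> K\<^sup>2 * r + (2 * C + 2 * C * (1 + C)) * K powr (2 - q)"
    by (simp add: e k_def algebra_simps)
qed

text \<open>The trivial rate 1. It bounds the set whose supremum is the mixing coefficient, and it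
  serves where only integrability is wanted.\<close>

lemma (in prob_space) abs_prob_diff_prod_le_1: "\<bar>prob A - prob B * prob C\<bar> \<le> 1"
  using prob_le_1[of A] prob_le_1[of B] prob_le_1[of C] measure_nonneg[of M A] mult_le_one[of "prob B" "prob C"]
  by (smt (verit) measure_nonneg mult_nonneg_nonneg)


text \<open>A form of Davydov's inequality, by choosing the truncation level in
  \<open>covariance_truncation_bound\<close>. The extreme values of \<open>r\<close> are treated
  apart: for \<open>r = 0\<close> the level tends to infinity, for \<open>r > 1\<close> the trivial
  rate 1 is used.\<close>

lemma (in prob_space) covariance_mixing_bound:
  fixes U V :: "'a \<Rightarrow> real"
  assumes [measurable]: "U \<in> borel_measurable M" "V \<in> borel_measurable M"
    and U0: "\<And>\<omega>. \<omega> \<in> space M \<Longrightarrow> 0 \<le> U \<omega>" and V0: "\<And>\<omega>. \<omega> \<in> space M \<Longrightarrow> 0 \<le> V \<omega>" and q: "2 < q"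
    and r: "\<And>x y. \<bar>prob ({\<omega> \<in> space M. x < U \<omega>} \<inter> {\<omega> \<in> space M. y < V \<omega>}) - prob {\<omega> \<in> space M. x < U \<omega>} * prob {\<omega> \<in> space M. y < V \<omega>}\<bar> \<le> r"
    and iU: "integrable M (\<lambda>\<omega>. U \<omega> powr q)" and iV: "integrable M (\<lambda>\<omega>. V \<omega> powr q)"
    and C: "expectation (\<lambda>\<omega>. U \<omega> powr q) \<le> C" "expectation (\<lambda>\<omega>. V \<omega> powr q) \<le> C"
  shows "\<bar>expectation (\<lambda>\<omega>. U \<omega> * V \<omega>) - expectation U * expectation V\<bar> \<le> (1 + (2 * C + 2 * C * (1 + C))) * r powr ((q - 2) / q)"
proof -
  let ?A = "\<lambda>x. {\<omega> \<in> space M. x < U \<omega>}"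
  let ?B = "\<lambda>y. {\<omega> \<in> space M. y < V \<omega>}"
  define D where "D = 2 * C + 2 * C * (1 + C)"
  have q2: "2 \<le> q" using q by simp
  have C0: "0 \<le> C" using C(1) by (rule order_trans[OF integral_nonneg_AE, rotated]) auto
  then have D0: "0 \<le> D" by (simp add: D_def)
  define c where "c = \<bar>expectation (\<lambda>\<omega>. U \<omega> * V \<omega>) - expectation U * expectation V\<bar>"
  have b: "c \<le> K\<^sup>2 * s + D * K powr (2 - q)" if "1 \<le> K" "r \<le> s \<or> 1 \<le> s" for K s
  proof -
    have "\<bar>prob ((?A x) \<inter> (?B y)) - prob (?A x) * prob (?B y)\<bar> \<le> s" for x y
      using r[of x y] that(2) abs_prob_diff_prod_le_1 by (meson order_trans)
    from covariance_truncation_bound(1)[OF assms(1,2) U0 V0 that(1) q2 this iU iV C] show ?thesis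
      by (simp add: c_def D_def)
  qed
  have r0: "0 \<le> r" using r[of 0 0] by linarith
  have "c \<le> (1 + D) * r powr ((q - 2) / q)"
  proof -
    consider "r = 0" | "0 < r" "r \<le> 1" | "1 < r" using r0 by linarith
    then show ?thesis
    proof cases
      case 1
      have "((\<lambda>K. D * K powr (2 - q)) \<longlongrightarrow> D * 0) at_top"
        using q by (intro tendsto_intros tendsto_neg_powr filterlim_ident) auto
      moreover have "\<forall>\<^sub>F K in at_top. c \<le> D * K powr (2 - q)"
        using eventually_ge_at_top[of 1] by eventually_elim (use b[of _ 0] 1 in auto)
      ultimately have "c \<le> D * 0" by (intro tendsto_lowerbound) auto
      then show ?thesis using 1 by simp
    next
      case 2
      \<comment> \<open>The balancing level: both \<open>K\<^sup>2 * r\<close> and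
        \<open>K powr (2 - q)\<close> become \<open>r powr ((q - 2) / q)\<close>.\<close>
      define K where "K = r powr (- 1 / q)"
      have "1 \<le> r powr (- 1 / q)" using 2 q powr_le1[of "1 / q" r] by (simp add: powr_minus_divide)
      then have K: "1 \<le> K" by (simp add: K_def)
      have "K\<^sup>2 = K powr 2" using K by simp
      then have "K\<^sup>2 * r = r powr (- 2 / q) * r powr 1" using 2 by (simp add: K_def powr_powr)
      also have "\<dots> = r powr (- 2 / q + 1)" by (rule powr_add[symmetric])
      also have "- 2 / q + 1 = (q - 2) / q" using q by (simp add: field_simps)
      finally have 1: "K\<^sup>2 * r = r powr ((q - 2) / q)" .
      have 2: "K powr (2 - q) = r powr ((q - 2) / q)"
      proof -
        have "- 1 / q * (2 - q) = (q - 2) / q" using q by (simp add: field_simps)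
        then show ?thesis unfolding K_def powr_powr by simp
      qed
      show ?thesis using b[OF K, of r] by (simp add: 1 2 distrib_right)
    next
      case 3
      have "c \<le> 1 + D" using b[of 1 1] by simp
      also have "\<dots> \<le> (1 + D) * r powr ((q - 2) / q)"
        using 3 q D0 by (simp add: ge_one_powr_ge_zero mult_ge1_I)
      finally show ?thesis .
    qed
  qed
  then show ?thesis by (simp add: c_def D_def)
qed

text \<open>Each distance from \<open>s\<close> is attained at most once on either side.\<close>

lemma sum_dist_le:
  fixes c :: "nat \<Rightarrow> real"
  assumes c: "\<And>h. 0 \<le> c h" and s: "s \<in> {1..n}"
  shows "(\<Sum>t=1..n. c (nat \<bar>int s - int t\<bar>)) \<le> 2 * (\<Sum>h<n. c h)"
proof -
  have D: "{1..n} = {1..s} \<union> {s<..n}" using s by auto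
  have "(\<Sum>t=1..n. c (nat \<bar>int s - int t\<bar>)) = (\<Sum>t\<in>{1..s}. c (nat \<bar>int s - int t\<bar>)) + (\<Sum>t\<in>{s<..n}. c (nat \<bar>int s - int t\<bar>))"
    unfolding D by (subst sum.union_disjoint) auto
  also have "(\<Sum>t\<in>{1..s}. c (nat \<bar>int s - int t\<bar>)) = (\<Sum>h\<in>(\<lambda>t. s - t) ` {1..s}. c h)"
    by (subst sum.reindex) (auto simp: inj_on_def nat_diff_distrib' intro!: sum.cong arg_cong[of _ _ c])
  also have "\<dots> \<le> (\<Sum>h<n. c h)" using s by (intro sum_mono2 c) auto
  also have "(\<Sum>t\<in>{s<..n}. c (nat \<bar>int s - int t\<bar>)) = (\<Sum>h\<in>(\<lambda>t. t - s) ` {s<..n}. c h)"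
    by (subst sum.reindex) (auto simp: inj_on_def intro!: sum.cong arg_cong[of _ _ c])
  also have "\<dots> \<le> (\<Sum>h<n. c h)" using s by (intro sum_mono2 c) auto
  finally show ?thesis by simp
qed

text \<open>Covariances are asked for in time order only, as a mixing condition separates past from
  future; commutativity gives the other half of the double sum.\<close>

lemma (in prob_space) variance_sum_bound:
  fixes U :: "nat \<Rightarrow> 'a \<Rightarrow> real" and c :: "nat \<Rightarrow> real"
  assumes i1: "\<And>t. integrable M (U t)" and i2: "\<And>s t. integrable M (\<lambda>\<omega>. U s \<omega> * U t \<omega>)"
    and c: "\<And>h. 0 \<le> c h"
    and cov: "\<And>s t. s \<in> {1..n} \<Longrightarrow> t \<in> {1..n} \<Longrightarrow> s \<le> t \<Longrightarrow>
      \<bar>expectation (\<lambda>\<omega>. U s \<omega> * U t \<omega>) - expectation (U s) * expectation (U t)\<bar> \<le> c (t - s)"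
  shows "integrable M (\<lambda>\<omega>. ((\<Sum>t=1..n. U t \<omega>) - (\<Sum>t=1..n. expectation (U t)))\<^sup>2)"
    and "expectation (\<lambda>\<omega>. ((\<Sum>t=1..n. U t \<omega>) - (\<Sum>t=1..n. expectation (U t)))\<^sup>2) \<le> 2 * real n * (\<Sum>h<n. c h)"
proof -
  let ?c = "\<lambda>s t. expectation (\<lambda>\<omega>. U s \<omega> * U t \<omega>) - expectation (U s) * expectation (U t)"
  let ?S = "\<lambda>\<omega>. ((\<Sum>t=1..n. U t \<omega>) - (\<Sum>t=1..n. expectation (U t)))\<^sup>2"
  let ?v = "\<lambda>s t \<omega>. (U s \<omega> - expectation (U s)) * (U t \<omega> - expectation (U t))"
  have cov': "\<bar>?c s t\<bar> \<le> c (nat \<bar>int s - int t\<bar>)"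
    if "s \<in> {1..n}" "t \<in> {1..n}" for s t
  proof (cases "s \<le> t")
    case True
    then show ?thesis using cov[OF that True] by (simp add: nat_diff_distrib')
  next
    case False
    then have "t \<le> s" by simp
    from cov[OF that(2,1) this] show ?thesis using False by (simp add: mult.commute nat_diff_distrib')
  qed
  have eq: "((\<Sum>t=1..n. U t \<omega>) - (\<Sum>t=1..n. expectation (U t)))\<^sup>2 =
     (\<Sum>s=1..n. \<Sum>t=1..n. (U s \<omega> - expectation (U s)) * (U t \<omega> - expectation (U t)))" for \<omega>
    by (simp add: power2_eq_square sum_product sum_subtractf[symmetric])
  have ic: "integrable M (?v s t)" for s t
    using i1 i2 by (simp add: algebra_simps)
  show "integrable M ?S"
    unfolding eq by (intro Bochner_Integration.integrable_sum ic)
  have ec: "expectation (?v s t) = ?c s t" for s t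
    using i1 i2 prob_space by (simp add: algebra_simps)
  have "expectation ?S =
     (\<Sum>s=1..n. \<Sum>t=1..n. ?c s t)"
    unfolding eq using ic by (simp add: ec)
  also have "\<dots> \<le> (\<Sum>s=1..n. \<Sum>t=1..n. c (nat \<bar>int s - int t\<bar>))"
    using cov' by (intro sum_mono) (auto intro: order_trans[OF abs_ge_self])
  also have "\<dots> \<le> (\<Sum>s=1..n. 2 * (\<Sum>h<n. c h))" by (intro sum_mono sum_dist_le c)
  also have "\<dots> = 2 * real n * (\<Sum>h<n. c h)" by simp
  finally show "expectation ?S \<le> 2 * real n * (\<Sum>h<n. c h)" .
qed

section \<open>A continuity theorem and weak convergence of product laws\<close>

text \<open>Averaging characteristic functions over a Gaussian argument gives tightness.\<close>

lemma (in real_distribution) char_gaussian_average: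
  "(\<integral>t. char M (u * t) \<partial>std_normal_distribution) = of_real (\<integral>x. exp (- (u * x)\<^sup>2 / 2) \<partial>M)"
proof -
  interpret N: real_distribution std_normal_distribution by (rule real_dist_normal_dist)
  interpret P: pair_prob_space M std_normal_distribution ..
  have "(\<integral>t. char M (u * t) \<partial>std_normal_distribution) = (\<integral>t. (\<integral>x. iexp (u * t * x) \<partial>M) \<partial>std_normal_distribution)"
    by (simp add: char_def)
  also have "\<dots> = (\<integral>x. (\<integral>t. iexp (u * t * x) \<partial>std_normal_distribution) \<partial>M)"
    by (intro P.Fubini_integral P.integrable_const_bound[where B = 1]) (auto simp: split_beta')
  also have "\<dots> = (\<integral>x. char std_normal_distribution (u * x) \<partial>M)"
    by (simp add: char_def mult_ac)
  also have "\<dots> = (\<integral>x. of_real (exp (- (u * x)\<^sup>2 / 2)) \<partial>M)" by (simp add: char_std_normal_distribution)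
  also have "\<dots> = of_real (\<integral>x. exp (- (u * x)\<^sup>2 / 2) \<partial>M)" by (rule integral_complex_of_real)
  finally show ?thesis .
qed

text \<open>Where \<open>\<bar>x\<bar>\<close> is at least \<open>1 / u\<close> the Gaussian factor
  is at most \<open>exp (- 1 / 2)\<close>; elsewhere it is at most 1.\<close>

lemma (in real_distribution) tail_le_char_gaussian_average:
  assumes "u > 0"
  shows "(1 - exp (- 1 / 2)) * prob {x. 1 / u \<le> \<bar>x\<bar>} \<le> 1 - Re (\<integral>t. char M (u * t) \<partial>std_normal_distribution)"
proof -
  have "(\<integral>x. exp (- (u * x)\<^sup>2 / 2) \<partial>M) \<le> (\<integral>x. 1 - (1 - exp (- 1 / 2)) * indicator {x. 1 / u \<le> \<bar>x\<bar>} x \<partial>M)"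
  proof (rule integral_mono)
    show "integrable M (\<lambda>x. exp (- (u * x)\<^sup>2 / 2))" by (intro integrable_const_bound[where B = 1]) auto
    show "integrable M (\<lambda>x. 1 - (1 - exp (- 1 / 2)) * indicator {x. 1 / u \<le> \<bar>x\<bar>} x :: real)"
      by (intro Bochner_Integration.integrable_diff integrable_mult_right) (auto simp: integrable_indicator_iff emeasure_eq_measure)
    show "exp (- (u * x)\<^sup>2 / 2) \<le> 1 - (1 - exp (- 1 / 2)) * indicator {x. 1 / u \<le> \<bar>x\<bar>} x" for x
    proof (cases "1 / u \<le> \<bar>x\<bar>")
      case True
      then have "1 \<le> \<bar>u * x\<bar>" using assms by (simp add: abs_mult field_simps)
      then have "1 \<le> (u * x)\<^sup>2" by (metis abs_le_square_iff abs_1 one_power2)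
      then show ?thesis using True by simp
    qed simp
  qed
  also have "\<dots> = 1 - (1 - exp (- 1 / 2)) * prob {x. 1 / u \<le> \<bar>x\<bar>}"
    using prob_space by (subst Bochner_Integration.integral_diff) (auto simp: integrable_indicator_iff emeasure_eq_measure intro!: integrable_mult_right)
  finally show ?thesis by (simp add: char_gaussian_average)
qed

text \<open>Continuity of \<open>f\<close> at 0 makes its Gaussian averages over small scales close
  to 1, which by \<open>tail_le_char_gaussian_average\<close> gives tightness. A weak limit along a
  subsequence then has characteristic function \<open>f\<close>. This is the source of the stable
  law below.\<close>

lemma levy_continuity_existence:
  fixes \<mu> :: "nat \<Rightarrow> real measure" and f :: "real \<Rightarrow> complex"
  assumes \<mu>: "\<And>n. real_distribution (\<mu> n)" and lim: "\<And>t. (\<lambda>n. char (\<mu> n) t) \<longlonglongrightarrow> f t" and cont: "isCont f 0"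
  obtains \<nu> where "real_distribution \<nu>" "char \<nu> = f"
proof -
  let ?c = "\<lambda>n u. \<integral>t. char (\<mu> n) (u * t) \<partial>std_normal_distribution"
  let ?f = "\<lambda>u. \<integral>t. f (u * t) \<partial>std_normal_distribution"
  interpret \<mu>: real_distribution "\<mu> n" for n by (rule \<mu>)
  interpret N: real_distribution std_normal_distribution by (rule real_dist_normal_dist)
  have f0: "f 0 = 1" using LIMSEQ_unique[OF lim[of 0]] by (simp add: \<mu>.char_zero)
  have fmeas [measurable]: "f \<in> borel_measurable borel"
    by (rule borel_measurable_LIMSEQ_metric[OF \<mu>.char_measurable]) (use lim in auto)
  have f1: "norm (f t) \<le> 1" for t
    by (rule tendsto_upperbound[OF tendsto_norm[OF lim]]) (auto simp: \<mu>.cmod_char_le_1)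
  have avg: "(\<lambda>n. \<integral>t. char (\<mu> n) (u * t) \<partial>std_normal_distribution) \<longlonglongrightarrow> (\<integral>t. f (u * t) \<partial>std_normal_distribution)" for u
    by (rule integral_dominated_convergence[where w = "\<lambda>_. 1"]) (auto simp: lim \<mu>.cmod_char_le_1)
  \<comment> \<open>As the scale \<open>1 / Suc k\<close> shrinks the average tends to
    \<open>f 0 = 1\<close>; this is the only place where continuity at 0 enters.\<close>
  have "(\<lambda>k. \<integral>t. f (1 / Suc k * t) \<partial>std_normal_distribution) \<longlonglongrightarrow> (\<integral>t. 1 \<partial>std_normal_distribution)"
  proof (rule integral_dominated_convergence[where w = "\<lambda>_. 1"])
    show "AE t in std_normal_distribution. (\<lambda>k. f (1 / Suc k * t)) \<longlonglongrightarrow> 1"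
    proof (intro AE_I2)
      fix t :: real
      have "(\<lambda>k. 1 / Suc k * t) \<longlonglongrightarrow> 0" using LIMSEQ_inverse_real_of_nat by (intro tendsto_mult_left_zero) (simp add: inverse_eq_divide)
      from isCont_tendsto_compose[OF cont this] show "(\<lambda>k. f (1 / Suc k * t)) \<longlonglongrightarrow> 1" by (simp add: f0)
    qed
  qed (auto simp: f1)
  then have avg1: "(\<lambda>k. Re (?f (1 / Suc k))) \<longlonglongrightarrow> 1"
    using N.prob_space tendsto_Re by fastforce
  have "tight \<mu>"
    unfolding tight_def
  proof (intro conjI allI impI)
    fix e :: real assume e: "e > 0"
    define c where "c = 1 - exp (- 1 / 2 :: real)"
    have c: "c > 0" by (simp add: c_def)
    have "\<forall>\<^sub>F k in sequentially. 1 - c * e < Re (?f (1 / Suc k))"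
      using c e by (intro order_tendstoD(1)[OF avg1]) auto
    then obtain k where k: "1 - c * e < Re (?f (1 / Suc k))"
      by (auto simp: eventually_sequentially)
    define u where "u = 1 / real (Suc k)"
    have u: "u > 0" by (simp add: u_def)
    have "\<forall>\<^sub>F n in sequentially. 1 - c * e < Re (?c n u)"
      using k by (intro order_tendstoD(1)[OF tendsto_Re[OF avg]]) (auto simp: u_def)
    then obtain n0 where n0: "\<And>n. n \<ge> n0 \<Longrightarrow> 1 - c * e < Re (?c n u)"
      by (auto simp: eventually_sequentially)
    have big: "1 - e < measure (\<mu> n) {- R<..R}" if "n \<ge> n0" "R \<ge> 1 / u" for n R
    proof -
      have "c * measure (\<mu> n) {x. 1 / u \<le> \<bar>x\<bar>} < c * e"
        using n0[OF that(1)] \<mu>.tail_le_char_gaussian_average[OF u, of n] unfolding c_def[symmetric] by linarith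
      then have "measure (\<mu> n) {x. 1 / u \<le> \<bar>x\<bar>} < e" using c by simp
      then have "1 - e < measure (\<mu> n) (space (\<mu> n) - {x. 1 / u \<le> \<bar>x\<bar>})"
        by (subst \<mu>.prob_compl) auto
      also have "\<dots> \<le> measure (\<mu> n) {- R<..R}" using that(2) by (intro \<mu>.finite_measure_mono) auto
      finally show ?thesis .
    qed
    have "\<forall>\<^sub>F k in sequentially. 1 - e < measure (\<mu> n) {- real k<..real k}" for n
    proof -
      have "(\<lambda>k. measure (\<mu> n) {- real k<..real k}) \<longlonglongrightarrow> measure (\<mu> n) (\<Union>k. {- real k<..real k})"
        by (rule \<mu>.finite_Lim_measure_incseq) (auto simp: incseq_def)
      also have "(\<Union>k. {- real k<..real k}) = UNIV"
      proof (intro UNIV_eq_I[symmetric])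
        fix x :: real
        obtain k where "\<bar>x\<bar> < real k" using reals_Archimedean2 by blast
        then show "x \<in> (\<Union>k. {- real k<..real k})" by (intro UN_I[of k]) auto
      qed
      also have "measure (\<mu> n) UNIV = 1" using \<mu>.prob_space[of n] by simp
      finally show ?thesis using e by (intro order_tendstoD(1)) auto
    qed
    \<comment> \<open>The finitely many laws before \<open>n0\<close> are tight one by one; the
      remaining ones share the bound \<open>big\<close>.\<close>
    then have "\<forall>\<^sub>F k in sequentially. \<forall>n\<in>{..<n0}. 1 - e < measure (\<mu> n) {- real k<..real k}"
      by (intro eventually_ball_finite) auto
    moreover have "\<forall>\<^sub>F k in sequentially. 1 / u \<le> real k"
      using eventually_ge_at_top[of "nat \<lceil>1 / u\<rceil>"] by eventually_elim linarith
    moreover have "\<forall>\<^sub>F k in sequentially. 0 < (k::nat)" by (rule eventually_gt_at_top)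
    ultimately have "\<forall>\<^sub>F k in sequentially. 0 < k \<and> (\<forall>n. 1 - e < measure (\<mu> n) {- real k<..real k})"
    proof eventually_elim
      case (elim k)
      have "1 - e < measure (\<mu> n) {- real k<..real k}" for n
        using elim big[of n "real k"] by (cases "n < n0") auto
      then show ?case using elim by simp
    qed
    then obtain k :: nat where k: "0 < k" "\<And>n. 1 - e < measure (\<mu> n) {- real k<..real k}"
      by (auto simp: eventually_sequentially)
    then show "\<exists>a b. a < b \<and> (\<forall>n. 1 - e < measure (\<mu> n) {a<..b})" by (intro exI[of _ "- real k"] exI[of _ "real k"]) auto
  qed (rule \<mu>)
  then obtain r \<nu> where r: "strict_mono r" and \<nu>: "real_distribution \<nu>" and w: "weak_conv_m (\<mu> \<circ> id \<circ> r) \<nu>"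
    using tight_imp_convergent_subsubsequence[of \<mu> id] by (auto simp: strict_mono_def)
  have "char \<nu> t = f t" for t
  proof (rule LIMSEQ_unique)
    show "(\<lambda>n. char ((\<mu> \<circ> id \<circ> r) n) t) \<longlonglongrightarrow> char \<nu> t" by (rule levy_continuity1[OF _ \<nu> w]) (simp add: \<mu>)
    show "(\<lambda>n. char ((\<mu> \<circ> id \<circ> r) n) t) \<longlonglongrightarrow> f t" using LIMSEQ_subseq_LIMSEQ[OF lim r] by (simp add: o_def)
  qed
  then show ?thesis using that[OF \<nu>] by blast
qed

text \<open>Skorohod representations of the coordinates, placed side by side on the product of their
  spaces, have the required product laws and converge pointwise, so bounded convergence applies.
  They are chosen for all indices at once, hence hypotheses at every \<open>i\<close> and not only
  in \<open>I\<close>.\<close>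

lemma weak_conv_PiM:
  fixes \<mu> :: "nat \<Rightarrow> 'i \<Rightarrow> real measure" and g :: "('i \<Rightarrow> real) \<Rightarrow> real"
  assumes I: "finite I" and \<mu>: "\<And>n i. real_distribution (\<mu> n i)" and \<nu>: "\<And>i. real_distribution (\<nu> i)"
    and w: "\<And>i. weak_conv_m (\<lambda>n. \<mu> n i) (\<nu> i)"
    and g: "g \<in> borel_measurable (PiM I (\<lambda>_. borel))" and B: "\<And>x. \<bar>g x\<bar> \<le> B"
    and cont: "\<And>X x. (\<And>i. i \<in> I \<Longrightarrow> (\<lambda>n. X n i) \<longlonglongrightarrow> x i) \<Longrightarrow> (\<lambda>n. g (\<lambda>i\<in>I. X n i)) \<longlonglongrightarrow> g (\<lambda>i\<in>I. x i)"
  shows "(\<lambda>n. \<integral>x. g x \<partial>PiM I (\<mu> n)) \<longlonglongrightarrow> (\<integral>x. g x \<partial>PiM I \<nu>)"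
proof -
  have "\<forall>i. \<exists>(\<Omega> :: real measure) Y Y'. prob_space \<Omega> \<and> (\<forall>n. Y n \<in> borel_measurable \<Omega>) \<and> (\<forall>n. distr \<Omega> borel (Y n) = \<mu> n i) \<and>
     Y' \<in> borel_measurable \<Omega> \<and> distr \<Omega> borel Y' = \<nu> i \<and> (\<forall>x\<in>space \<Omega>. (\<lambda>n. Y n x) \<longlonglongrightarrow> (Y' x :: real))"
  proof
    fix i
    obtain \<Omega> :: "real measure" and Y Y' where a: "prob_space \<Omega>" "\<forall>n. Y n \<in> borel_measurable \<Omega>" "\<forall>n. distr \<Omega> borel (Y n) = \<mu> n i"
      "Y' \<in> measurable \<Omega> lborel" "distr \<Omega> borel Y' = \<nu> i" "\<forall>x\<in>space \<Omega>. (\<lambda>n. Y n x) \<longlonglongrightarrow> (Y' x :: real)"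
      using Skorohod[OF \<mu> \<nu> w, of i] by blast
    have "Y' \<in> borel_measurable \<Omega>" using a(4) by simp
    with a show "\<exists>(\<Omega> :: real measure) Y Y'. prob_space \<Omega> \<and> (\<forall>n. Y n \<in> borel_measurable \<Omega>) \<and> (\<forall>n. distr \<Omega> borel (Y n) = \<mu> n i) \<and>
     Y' \<in> borel_measurable \<Omega> \<and> distr \<Omega> borel Y' = \<nu> i \<and> (\<forall>x\<in>space \<Omega>. (\<lambda>n. Y n x) \<longlonglongrightarrow> (Y' x :: real))"
      by blast
  qed
  then obtain \<Omega> :: "'i \<Rightarrow> real measure" and Y Y' where \<Omega>: "\<And>i. prob_space (\<Omega> i)" and Y: "\<And>n i. Y i n \<in> borel_measurable (\<Omega> i)"
    and dY: "\<And>n i. distr (\<Omega> i) borel (Y i n) = \<mu> n i" and Y': "\<And>i. Y' i \<in> borel_measurable (\<Omega> i)"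
    and dY': "\<And>i. distr (\<Omega> i) borel (Y' i) = \<nu> i" and lim: "\<And>i x. x \<in> space (\<Omega> i) \<Longrightarrow> (\<lambda>n. Y i n x) \<longlonglongrightarrow> Y' i x"
    by metis
  interpret P: product_prob_space \<Omega> I
    unfolding product_prob_space_def product_prob_space_axioms_def product_sigma_finite_def using \<Omega> prob_space_imp_sigma_finite by blast
  have meas: "(\<lambda>x. \<lambda>i\<in>I. Z i (x i)) \<in> measurable (PiM I \<Omega>) (PiM I (\<lambda>_. borel))"
    if Z: "\<And>i. Z i \<in> borel_measurable (\<Omega> i)" for Z :: "'i \<Rightarrow> real \<Rightarrow> real"
    using Z by (intro measurable_restrict) (auto intro: measurable_compose[OF measurable_component_singleton])
  have dist: "PiM I (\<lambda>i. distr (\<Omega> i) borel (Z i)) = distr (PiM I \<Omega>) (PiM I (\<lambda>_. borel)) (\<lambda>x. \<lambda>i\<in>I. Z i (x i))"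
    if Z: "\<And>i. Z i \<in> borel_measurable (\<Omega> i)" for Z :: "'i \<Rightarrow> real \<Rightarrow> real"
  proof -
    interpret Q: product_sigma_finite "\<lambda>i. distr (\<Omega> i) borel (Z i)"
      unfolding product_sigma_finite_def using \<Omega> Z by (auto intro!: prob_space_imp_sigma_finite prob_space.prob_space_distr)
    have "distr (PiM I \<Omega>) (PiM I (\<lambda>_. borel)) (\<lambda>x. \<lambda>i\<in>I. Z i (x i)) = PiM I (\<lambda>i. distr (\<Omega> i) borel (Z i))"
    proof (rule Q.PiM_eqI[OF I])
      show "sets (distr (PiM I \<Omega>) (PiM I (\<lambda>_. borel)) (\<lambda>x. \<lambda>i\<in>I. Z i (x i))) = sets (PiM I (\<lambda>i. distr (\<Omega> i) borel (Z i)))"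
        by (simp cong: sets_PiM_cong)
      fix A :: "'i \<Rightarrow> real set" assume A: "\<And>i. i \<in> I \<Longrightarrow> A i \<in> sets (distr (\<Omega> i) borel (Z i))"
      have "emeasure (distr (PiM I \<Omega>) (PiM I (\<lambda>_. borel)) (\<lambda>x. \<lambda>i\<in>I. Z i (x i))) (Pi\<^sub>E I A) =
         emeasure (PiM I \<Omega>) ((\<lambda>x. \<lambda>i\<in>I. Z i (x i)) -` Pi\<^sub>E I A \<inter> space (PiM I \<Omega>))"
        using A I by (intro emeasure_distr meas Z sets_PiM_I_finite) auto
      also have "(\<lambda>x. \<lambda>i\<in>I. Z i (x i)) -` Pi\<^sub>E I A \<inter> space (PiM I \<Omega>) = Pi\<^sub>E I (\<lambda>i. Z i -` A i \<inter> space (\<Omega> i))"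
        by (auto simp: space_PiM PiE_iff Pi_iff)
      also have "emeasure (PiM I \<Omega>) \<dots> = (\<Prod>i\<in>I. emeasure (\<Omega> i) (Z i -` A i \<inter> space (\<Omega> i)))"
        using A Z I by (intro P.emeasure_PiM) (auto intro: measurable_sets)
      also have "\<dots> = (\<Prod>i\<in>I. emeasure (distr (\<Omega> i) borel (Z i)) (A i))"
        using A Z by (intro prod.cong) (auto simp: emeasure_distr)
      finally show "emeasure (distr (PiM I \<Omega>) (PiM I (\<lambda>_. borel)) (\<lambda>x. \<lambda>i\<in>I. Z i (x i))) (Pi\<^sub>E I A) = (\<Prod>i\<in>I. emeasure (distr (\<Omega> i) borel (Z i)) (A i))" .
    qed
    then show ?thesis ..
  qed
  have 1: "(\<integral>x. g x \<partial>PiM I (\<mu> n)) = (\<integral>x. g (\<lambda>i\<in>I. Y i n (x i)) \<partial>PiM I \<Omega>)" for n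
    unfolding dY[symmetric] by (subst dist[OF Y]) (rule integral_distr[OF meas[OF Y] g])
  have 2: "(\<integral>x. g x \<partial>PiM I \<nu>) = (\<integral>x. g (\<lambda>i\<in>I. Y' i (x i)) \<partial>PiM I \<Omega>)"
    using integral_distr[OF meas[OF Y'] g] dist[OF Y'] by (simp add: dY')
  show ?thesis unfolding 1 2
  proof (rule integral_dominated_convergence[where w = "\<lambda>_. B"])
    show "AE x in PiM I \<Omega>. (\<lambda>n. g (\<lambda>i\<in>I. Y i n (x i))) \<longlonglongrightarrow> g (\<lambda>i\<in>I. Y' i (x i))"
      by (intro AE_I2 cont lim) (auto simp: space_PiM PiE_def Pi_def)
  qed (use B measurable_compose[OF meas[OF Y] g] measurable_compose[OF meas[OF Y'] g] in auto)
qed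

section \<open>The stochastic volatility model\<close>

text \<open>The law sits on the nonnegative half-line, so \<open>G\<close> vanishes at negative
  arguments and is monotone on the whole line.\<close>

lemma (in rv_distribution) borel_measurable_G [measurable]: "G \<in> borel_measurable borel"
proof (rule borel_measurable_mono, rule monoI)
  fix x y :: real assume xy: "x \<le> y"
  show "G x \<le> G y"
  proof (cases "0 \<le> x")
    case False
    have "AE z in F. \<not> 1 < x * z"
      using nonneg
    proof (elim AE_mp, intro AE_I2 impI)
      fix z :: real assume "0 \<le> z"
      then have "x * z \<le> 0" using False by (intro mult_nonpos_nonneg) auto
      then show "\<not> 1 < x * z" by simp
    qed
    then have "G x = measure F {}" unfolding G_def by (intro finite_measure_eq_AE) auto
    then show ?thesis by (simp add: G_def)
  qed (use xy mono_G in auto)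
qed

lemma cesaro_mean_null:
  fixes c :: "nat \<Rightarrow> real"
  assumes "c \<longlonglongrightarrow> 0" and c0: "\<And>h. 0 \<le> c h"
  shows "(\<lambda>n. (\<Sum>h<n. c h) / real n) \<longlonglongrightarrow> 0"
proof (rule tendstoI)
  fix e :: real assume e: "e > 0"
  obtain N where N: "\<And>h. h \<ge> N \<Longrightarrow> c h < e / 2"
    using order_tendstoD(2)[OF assms(1), of "e / 2"] e by (auto simp: eventually_sequentially)
  define S where "S = (\<Sum>h<N. c h)"
  have "(\<lambda>n. S / real n) \<longlonglongrightarrow> 0" by (rule lim_const_over_n)
  then have "\<forall>\<^sub>F n in sequentially. S / real n < e / 2" using e by (intro order_tendstoD(2)) auto
  moreover have "\<forall>\<^sub>F n in sequentially. max 1 N \<le> n" by (rule eventually_ge_at_top)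
  ultimately show "\<forall>\<^sub>F n in sequentially. dist ((\<Sum>h<n. c h) / real n) 0 < e"
  proof eventually_elim
    case (elim n)
    have "{..<n} = {..<N} \<union> {N..<n}" using elim by auto
    then have "(\<Sum>h<n. c h) = S + (\<Sum>h=N..<n. c h)" unfolding S_def by (simp add: sum.union_disjoint ivl_disj_int)
    also have "(\<Sum>h=N..<n. c h) \<le> (\<Sum>h=N..<n. e / 2)" using N by (intro sum_mono) (auto intro: less_imp_le)
    also have "\<dots> \<le> e / 2 * real n" using e by (simp add: mult.commute)
    finally have "(\<Sum>h<n. c h) / real n \<le> (S + e / 2 * real n) / real n" using elim by (intro divide_right_mono) auto
    also have "\<dots> = S / real n + e / 2" using elim by (simp add: add_divide_distrib)
    also have "\<dots> < e" using elim(1) by linarith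
    finally show ?case using sum_nonneg[of "{..<n}" c] c0 by (simp add: dist_real_def)
  qed
qed

text \<open>The one-sided tails add up to the tail of the absolute value, where
  \<open>pp + pm = 1\<close> removes the weights even if one of them is 0. The level of the absolute
  value is \<open>1 / sqrt s\<close>, which halves the index.\<close>

lemma (in prob_space) regularly_varying_rv_square:
  assumes Z [measurable]: "Z \<in> borel_measurable M" and \<alpha>: "0 < \<alpha>" and rv: "regularly_varying_rv M Z \<alpha>"
  shows "rv_distribution (distr M borel (\<lambda>\<omega>. (Z \<omega>)\<^sup>2)) (\<alpha> / 2)"
proof -
  let ?D = "distr M borel (\<lambda>\<omega>. (Z \<omega>)\<^sup>2)"
  let ?p = "\<lambda>x. prob {\<omega> \<in> space M. Z \<omega> > x}"
  let ?q = "\<lambda>x. prob {\<omega> \<in> space M. Z \<omega> < - x}"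
  define H where "H x = prob {\<omega> \<in> space M. x < \<bar>Z \<omega>\<bar>}" for x
  obtain pp pm L where p: "pp + pm = 1" and L: "slowly_varying L"
    and Lp: "((\<lambda>x. (?p x) / (L x * x powr (-\<alpha>))) \<longlongrightarrow> pp) at_top"
    and Lm: "((\<lambda>x. (?q x) / (L x * x powr (-\<alpha>))) \<longlongrightarrow> pm) at_top"
    using rv unfolding regularly_varying_rv_def by blast
  have H: "((\<lambda>x. H x / (L x * x powr (-\<alpha>))) \<longlongrightarrow> 1) at_top"
  proof (rule Lim_transform_eventually)
    show "((\<lambda>x. (?p x) / (L x * x powr (-\<alpha>)) + (?q x) / (L x * x powr (-\<alpha>))) \<longlongrightarrow> 1) at_top"
      using tendsto_add[OF Lp Lm] p by simp
    show "\<forall>\<^sub>F x in at_top. (?p x) / (L x * x powr (-\<alpha>)) + (?q x) / (L x * x powr (-\<alpha>)) = H x / (L x * x powr (-\<alpha>))"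
      using eventually_gt_at_top[of 0]
    proof eventually_elim
      case (elim x)
      have "H x = prob ({\<omega> \<in> space M. Z \<omega> > x} \<union> {\<omega> \<in> space M. Z \<omega> < - x})"
        unfolding H_def using elim by (intro arg_cong[where f = prob]) auto
      also have "\<dots> = (?p x) + (?q x)"
        using elim by (intro finite_measure_Union) auto
      finally show ?case by (simp add: add_divide_distrib)
    qed
  qed
  have anti: "H y \<le> H x" if "x \<le> y" for x y
    unfolding H_def using that by (intro finite_measure_mono) auto
  \<comment> \<open>The tail is asymptotic to the regularly varying function, so it is nonzero at
    arbitrarily high levels; being decreasing, it is positive everywhere.\<close>
  have H0: "0 < H x" for x
  proof -
    have "\<forall>\<^sub>F y in at_top. 0 < H y / (L y * y powr (-\<alpha>))" by (rule order_tendstoD(1)[OF H]) simp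
    then have "\<forall>\<^sub>F y in at_top. x \<le> y \<and> 0 < H y / (L y * y powr (-\<alpha>))" by (intro eventually_conj eventually_ge_at_top)
    then obtain y where y: "x \<le> y" "0 < H y / (L y * y powr (-\<alpha>))" by (auto simp: eventually_at_top_linorder)
    then have "H y \<noteq> 0" by auto
    moreover have "0 \<le> H y" by (simp add: H_def)
    ultimately show ?thesis using anti[OF y(1)] by linarith
  qed
  have Lpos: "\<forall>\<^sub>F x in at_top. 0 < L x" and Lc: "\<And>c. 0 < c \<Longrightarrow> ((\<lambda>x. L (c * x) / L x) \<longlongrightarrow> 1) at_top"
    using L by (auto simp: slowly_varying_def)
  \<comment> \<open>Dividing both tails by their asymptotic equivalents leaves factors tending to 1,
    the slowly varying ratio, and \<open>c powr (-\<alpha>)\<close>.\<close>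
  have Hc: "((\<lambda>x. H (c * x) / H x) \<longlongrightarrow> c powr (-\<alpha>)) at_top" if c: "0 < c" for c
  proof (rule Lim_transform_eventually)
    have f: "filterlim (\<lambda>x. c * x) at_top at_top" using c by (intro filterlim_tendsto_pos_mult_at_top[OF tendsto_const] filterlim_ident)
    show "((\<lambda>x. H (c * x) / (L (c * x) * (c * x) powr (-\<alpha>)) / (H x / (L x * x powr (-\<alpha>))) * (L (c * x) / L x) * c powr (-\<alpha>)) \<longlongrightarrow> c powr (-\<alpha>)) at_top"
      using tendsto_mult[OF tendsto_mult[OF tendsto_divide[OF filterlim_compose[OF H f] H] Lc[OF c]] tendsto_const[of "c powr (-\<alpha>)"]] by simp
    show "\<forall>\<^sub>F x in at_top. H (c * x) / (L (c * x) * (c * x) powr (-\<alpha>)) / (H x / (L x * x powr (-\<alpha>))) * (L (c * x) / L x) * c powr (-\<alpha>) = H (c * x) / H x"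
      using Lpos eventually_compose_filterlim[OF Lpos f] eventually_gt_at_top[of 0]
    proof eventually_elim
      case (elim x)
      have "(c * x) powr (-\<alpha>) = c powr (-\<alpha>) * x powr (-\<alpha>)" using c elim by (simp add: powr_mult)
      moreover have "c powr (-\<alpha>) > 0" "x powr (-\<alpha>) > 0" using c elim by auto
      ultimately show ?case using elim H0[of x] by (simp add: field_simps)
    qed
  qed
  have G: "measure ?D {y. 1 < s * y} = H (1 / sqrt s)" if s: "s > 0" for s
  proof -
    have "1 < s * z\<^sup>2 \<longleftrightarrow> 1 / sqrt s < \<bar>z\<bar>" for z :: real
    proof -
      have "1 / sqrt s < \<bar>z\<bar> \<longleftrightarrow> (1 / sqrt s)\<^sup>2 < \<bar>z\<bar>\<^sup>2"
        using s power_mono_iff[of "\<bar>z\<bar>" "1 / sqrt s" 2] by (auto simp: not_le[symmetric] simp del: power2_abs)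
      also have "\<dots> \<longleftrightarrow> 1 < s * z\<^sup>2" using s by (simp add: power_divide field_simps)
      finally show ?thesis ..
    qed
    then show ?thesis unfolding H_def
      by (subst measure_distr) (auto simp: vimage_def Int_def intro!: arg_cong[where f = prob])
  qed
  interpret D: prob_space "distr M borel (\<lambda>\<omega>. (Z \<omega>)\<^sup>2)" by (rule prob_space_distr) simp
  show ?thesis
  proof
    show "AE y in distr M borel (\<lambda>\<omega>. (Z \<omega>)\<^sup>2). 0 \<le> y" by (subst AE_distr_iff) auto
    show "0 < \<alpha> / 2" using \<alpha> by simp
    show "0 < measure ?D {y. 1 < s * y}" if "0 < s" for s
      using G[OF that] H0 by simp
    show "((\<lambda>s. measure ?D {y. 1 < (c * s) * y} / measure ?D {y. 1 < s * y}) \<longlongrightarrow> c powr (\<alpha> / 2)) (at_right 0)"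
      if c: "0 < c" for c
    proof (rule Lim_transform_eventually)
      have "filterlim (\<lambda>s::real. sqrt s) (at_right 0) (at_right 0)"
        by (auto simp: filterlim_at eventually_at_right_field intro!: tendsto_eq_intros exI[of _ 1])
      then have f: "filterlim (\<lambda>s::real. 1 / sqrt s) at_top (at_right 0)"
        using filterlim_compose[OF filterlim_inverse_at_top_right] by (simp add: inverse_eq_divide)
      have "(1 / sqrt c) powr (-\<alpha>) = c powr (\<alpha> / 2)"
        using c by (simp add: powr_half_sqrt[symmetric] powr_divide powr_powr powr_minus)
      then show "((\<lambda>s. H (1 / sqrt c * (1 / sqrt s)) / H (1 / sqrt s)) \<longlongrightarrow> c powr (\<alpha> / 2)) (at_right 0)"
        using filterlim_compose[OF Hc[of "1 / sqrt c"] f] c by simp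
      show "\<forall>\<^sub>F s in at_right 0. H (1 / sqrt c * (1 / sqrt s)) / H (1 / sqrt s) = measure ?D {y. 1 < (c * s) * y} / measure ?D {y. 1 < s * y}"
        unfolding eventually_at_right_field using c by (intro exI[of _ 1]) (auto simp: G real_sqrt_mult)
    qed
  qed simp_all
qed

text \<open>Takes the place of conditioning on \<open>Y\<close>: the joint law is a product, so
  Fubini lets a second sample point \<open>\<omega>'\<close> drive \<open>X\<close> while
  \<open>Y\<close> is frozen at \<open>\<omega>\<close>.\<close>

lemma (in prob_space) indep_var_expectation_iterated:
  fixes h :: "'b \<times> 'b \<Rightarrow> real"
  assumes ind: "indep_var S X T Y" and h [measurable]: "h \<in> borel_measurable (S \<Otimes>\<^sub>M T)" and B: "\<And>x. \<bar>h x\<bar> \<le> B"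
  shows "expectation (\<lambda>\<omega>. h (X \<omega>, Y \<omega>)) = expectation (\<lambda>\<omega>. expectation (\<lambda>\<omega>'. h (X \<omega>', Y \<omega>)))"
    and "(\<lambda>\<omega>. expectation (\<lambda>\<omega>'. h (X \<omega>', Y \<omega>))) \<in> borel_measurable M"
proof -
  have rv [measurable]: "random_variable S X" "random_variable T Y"
    and eq: "distr M S X \<Otimes>\<^sub>M distr M T Y = distr M (S \<Otimes>\<^sub>M T) (\<lambda>x. (X x, Y x))"
    using ind by (auto simp: indep_var_distribution_eq)
  interpret X: prob_space "distr M S X" by (rule prob_space_distr) simp
  interpret Y: prob_space "distr M T Y" by (rule prob_space_distr) simp
  interpret P: pair_prob_space "distr M S X" "distr M T Y" ..
  have I: "integrable (distr M S X \<Otimes>\<^sub>M distr M T Y) (\<lambda>(x, y). h (x, y))"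
    using B by (intro P.integrable_const_bound[where B = B]) auto
  have inner: "(\<integral>x. h (x, y) \<partial>distr M S X) = expectation (\<lambda>\<omega>'. h (X \<omega>', y))" if "y \<in> space T" for y
    using that by (intro integral_distr) auto
  have Yin: "\<omega> \<in> space M \<Longrightarrow> Y \<omega> \<in> space T" for \<omega> using rv(2) by (rule measurable_space)
  have m: "(\<lambda>y. \<integral>x. h (x, y) \<partial>distr M S X) \<in> borel_measurable (distr M T Y)"
    using borel_measurable_integrable[OF P.integrable_snd[OF I]] .
  have "expectation (\<lambda>\<omega>. h (X \<omega>, Y \<omega>)) = (\<integral>p. h p \<partial>distr M (S \<Otimes>\<^sub>M T) (\<lambda>x. (X x, Y x)))"
    by (subst integral_distr) auto
  also have "\<dots> = (\<integral>p. (\<lambda>(x, y). h (x, y)) p \<partial>(distr M S X \<Otimes>\<^sub>M distr M T Y))"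
    by (simp add: eq)
  also have "\<dots> = (\<integral>y. (\<integral>x. h (x, y) \<partial>distr M S X) \<partial>distr M T Y)"
    by (rule P.integral_snd[OF I, symmetric])
  also have "\<dots> = expectation (\<lambda>\<omega>. \<integral>x. h (x, Y \<omega>) \<partial>distr M S X)"
    using m by (intro integral_distr) auto
  also have "\<dots> = expectation (\<lambda>\<omega>. expectation (\<lambda>\<omega>'. h (X \<omega>', Y \<omega>)))"
    by (intro Bochner_Integration.integral_cong) (auto simp: inner Yin)
  finally show "expectation (\<lambda>\<omega>. h (X \<omega>, Y \<omega>)) = expectation (\<lambda>\<omega>. expectation (\<lambda>\<omega>'. h (X \<omega>', Y \<omega>)))" .
  have "(\<lambda>\<omega>. \<integral>x. h (x, Y \<omega>) \<partial>distr M S X) \<in> borel_measurable M"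
    using measurable_compose[OF rv(2), of "\<lambda>y. \<integral>x. h (x, y) \<partial>distr M S X" borel] m by simp
  then show "(\<lambda>\<omega>. expectation (\<lambda>\<omega>'. h (X \<omega>', Y \<omega>))) \<in> borel_measurable M"
    by (rule measurable_cong[THEN iffD1, rotated]) (simp add: inner Yin)
qed

lemma less_square_iff: "0 \<le> c \<Longrightarrow> c\<^sup>2 < x\<^sup>2 \<longleftrightarrow> c < \<bar>x\<bar>" for c x :: real
  by (metis abs_le_square_iff abs_of_nonneg not_le)

section \<open>Volatility weights and the normalising sequence\<close>

locale sv_model = prob_space M for M :: "'a measure" +
  fixes Z \<sigma> :: "int \<Rightarrow> int \<Rightarrow> 'a \<Rightarrow> real" and p :: nat and \<alpha> \<delta> \<epsilon> :: real and a r :: "nat \<Rightarrow> real"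
  assumes Z_meas [measurable]: "\<And>i t. Z i t \<in> borel_measurable M"
    and \<sigma>_meas [measurable]: "\<And>i t. \<sigma> i t \<in> borel_measurable M"
    and Z_indep: "indep_vars (\<lambda>_. borel) (\<lambda>(i,t). Z i t) UNIV"
    and Z_ident: "\<And>i t. distr M borel (Z i t) = distr M borel (Z 0 0)"
    and \<sigma>_nonneg: "\<And>i t \<omega>. \<omega> \<in> space M \<Longrightarrow> \<sigma> i t \<omega> \<ge> 0"
    and \<sigma>_stat: "strictly_stationary_field M \<sigma>"
    and Z_\<sigma>_indep: "indep_var
          (PiM UNIV (\<lambda>_. borel)) (\<lambda>\<omega>. \<lambda>(i,t). Z i t \<omega>)
          (PiM UNIV (\<lambda>_. borel)) (\<lambda>\<omega>. \<lambda>(i,t). \<sigma> i t \<omega>)"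
    and p_ge: "p \<ge> 1"
    and \<alpha>_range: "0 < \<alpha>" "\<alpha> < 4" "\<alpha> \<noteq> 2"
    and Z_rv: "regularly_varying_rv M (Z 0 0) \<alpha>"
    and \<delta>_pos: "\<delta> > 0"
    and mixing: "strongly_mixing_with_rate M \<sigma> p r"
    and r_summable: "summable (\<lambda>h. r h powr (\<delta> / (2 + \<delta>)))"
    and \<epsilon>_pos: "\<epsilon> > 0"
    and moment: "integrable M (\<lambda>\<omega>. \<sigma> 0 0 \<omega> powr (2 * max (2 + \<delta>) (\<alpha> + \<epsilon>)))"
    and a_n: "(\<lambda>n. real n * prob {\<omega> \<in> space M. \<bar>sv_X \<sigma> Z 0 0 \<omega>\<bar> > a n}) \<longlonglongrightarrow> 1"
begin

definition \<beta> where "\<beta> = \<alpha> / 2"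
text \<open>The moment order available for the squared volatility. The bound
  \<open>2 + \<delta>\<close> serves the covariances of the weights themselves;
  \<open>\<alpha> + \<epsilon>\<close>, being above \<open>2 * \<beta>\<close>, serves those of
  their exceedance probabilities.\<close>

definition \<kappa> where "\<kappa> = max (2 + \<delta>) (\<alpha> + \<epsilon>)"
definition w where "w i t \<omega> = (\<sigma> i t \<omega>)\<^sup>2"
definition b where "b n = (a n)\<^sup>2"
definition Y_law where "Y_law = distr M borel (\<lambda>\<omega>. (Z 0 0 \<omega>)\<^sup>2)"

lemma \<beta>: "0 < \<beta>" "\<beta> < 2" "\<beta> \<noteq> 1" using \<alpha>_range by (auto simp: \<beta>_def)
lemma \<kappa>: "2 + \<delta> \<le> \<kappa>" "2 < \<kappa>" "\<beta> < \<kappa> / 2" using \<delta>_pos \<epsilon>_pos by (auto simp: \<kappa>_def \<beta>_def)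

sublocale Y: rv_distribution Y_law \<beta>
  unfolding Y_law_def \<beta>_def by (rule regularly_varying_rv_square) (use \<alpha>_range Z_rv in auto)

lemma w_meas [measurable]: "w i t \<in> borel_measurable M" unfolding w_def by measurable
lemma w_nonneg [simp]: "0 \<le> w i t \<omega>" by (simp add: w_def)
lemma b_nonneg [simp]: "0 \<le> b n" by (simp add: b_def)

lemma field_meas: "(\<And>i t. f i t \<in> borel_measurable M) \<Longrightarrow> (\<lambda>\<omega>. \<lambda>(i, t). f i t \<omega> :: real) \<in> measurable M (PiM (UNIV :: (int \<times> int) set) (\<lambda>_. borel))"
  by (rule measurable_PiM_single') auto

lemma \<sigma>_law: "distr M borel (\<sigma> i t) = distr M borel (\<sigma> 0 0)"
proof -
  have c: "(\<lambda>x :: int \<times> int \<Rightarrow> real. x (0, 0)) \<in> measurable (PiM UNIV (\<lambda>_. borel)) borel" by simp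
  have "distr (distr M (PiM UNIV (\<lambda>_. borel)) (\<lambda>\<omega>. \<lambda>(j,s). \<sigma> (j + i) (s + t) \<omega>)) borel (\<lambda>x. x (0, 0)) =
    distr (distr M (PiM UNIV (\<lambda>_. borel)) (\<lambda>\<omega>. \<lambda>(j,s). \<sigma> j s \<omega>)) borel (\<lambda>x. x (0, 0))"
    using \<sigma>_stat by (simp add: strictly_stationary_field_def field_law_def)
  then show ?thesis by (simp add: distr_distr[OF c field_meas] o_def)
qed

lemma w_law: "distr M borel (w i t) = distr M borel (w 0 0)"
proof -
  have "distr M borel (w i t) = distr (distr M borel (\<sigma> i t)) borel (\<lambda>x. x\<^sup>2)" for i t
    by (subst distr_distr) (auto simp: o_def w_def[abs_def])
  then show ?thesis using \<sigma>_law by metis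
qed

lemma
  fixes f :: "real \<Rightarrow> real"
  assumes [measurable]: "f \<in> borel_measurable borel"
  shows expectation_w: "expectation (\<lambda>\<omega>. f (w i t \<omega>)) = expectation (\<lambda>\<omega>. f (w 0 0 \<omega>))"
    and integrable_w: "integrable M (\<lambda>\<omega>. f (w i t \<omega>)) \<longleftrightarrow> integrable M (\<lambda>\<omega>. f (w 0 0 \<omega>))"
  using integral_distr[of "w i t" M borel f] integral_distr[of "w 0 0" M borel f]
    integrable_distr_eq[of "w i t" M borel f] integrable_distr_eq[of "w 0 0" M borel f] w_law[of i t]
  by simp_all

lemma moment_w: "integrable M (\<lambda>\<omega>. w i t \<omega> powr \<kappa>)"
proof -
  have "w 0 0 \<omega> powr \<kappa> = \<sigma> 0 0 \<omega> powr (2 * \<kappa>)" if "\<omega> \<in> space M" for \<omega>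
  proof -
    have "\<sigma> 0 0 \<omega> powr (2 * \<kappa>) = (\<sigma> 0 0 \<omega> powr 2) powr \<kappa>" by (simp add: powr_powr)
    also have "\<sigma> 0 0 \<omega> powr 2 = w 0 0 \<omega>" using \<sigma>_nonneg[OF that, of 0 0] by (simp add: w_def)
    finally show ?thesis ..
  qed
  then have "integrable M (\<lambda>\<omega>. w 0 0 \<omega> powr \<kappa>)"
    using moment by (subst Bochner_Integration.integrable_cong[OF refl]) (auto simp: \<kappa>_def)
  then show ?thesis by (subst integrable_w[where f = "\<lambda>x. x powr \<kappa>"]) auto
qed

lemma moment_w_le:
  assumes "0 < q" "q \<le> \<kappa>"
  shows "integrable M (\<lambda>\<omega>. w i t \<omega> powr q)"
proof (rule Bochner_Integration.integrable_bound)
  show "integrable M (\<lambda>\<omega>. 1 + w i t \<omega> powr \<kappa>)" using moment_w by simp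
  show "AE \<omega> in M. norm (w i t \<omega> powr q) \<le> norm (1 + w i t \<omega> powr \<kappa>)"
  proof (intro AE_I2)
    fix \<omega>
    show "norm (w i t \<omega> powr q) \<le> norm (1 + w i t \<omega> powr \<kappa>)"
    proof (cases "w i t \<omega> \<le> 1")
      case True
      then have "w i t \<omega> powr q \<le> 1" using assms by (intro powr_le1) auto
      then show ?thesis by (auto intro: order_trans[of _ 1])
    next
      case False
      then have "w i t \<omega> powr q \<le> w i t \<omega> powr \<kappa>" using assms by (intro powr_mono) auto
      then show ?thesis by simp
    qed
  qed
qed simp

lemma integrable_w1: "integrable M (w i t)"
  using moment_w_le[of 1 i t] \<kappa> by simp

lemma sv_X_sq: "(sv_X \<sigma> Z i t \<omega>)\<^sup>2 = w i t \<omega> * (Z i t \<omega>)\<^sup>2"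
  by (simp add: sv_X_def w_def power_mult_distrib)

lemma indep_component: "indep_var borel (\<lambda>\<omega>. (Z i t \<omega>)\<^sup>2) borel (w j s)"
  using indep_var_compose[OF Z_\<sigma>_indep, of "\<lambda>x. (x (i, t))\<^sup>2" borel "\<lambda>x. (x (j, s))\<^sup>2" borel]
  by (simp add: o_def w_def[abs_def])

text \<open>Freezing the volatility turns the tail of the product into an average of
  \<open>G\<close>; in this form the condition on \<open>a\<close> is used.\<close>

lemma tail_sq: 
  assumes "0 < B"
  shows "prob {\<omega> \<in> space M. B < (sv_X \<sigma> Z 0 0 \<omega>)\<^sup>2} = expectation (\<lambda>\<omega>. Y.G (w 0 0 \<omega> / B))"
proof -
  define h where "h = (\<lambda>(y, s). indicator {(y, s). B < s * y} (y, s) :: real)"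
  have h [measurable]: "h \<in> borel_measurable (borel \<Otimes>\<^sub>M borel)" unfolding h_def by measurable
  have "prob {\<omega> \<in> space M. B < (sv_X \<sigma> Z 0 0 \<omega>)\<^sup>2} = expectation (indicator {\<omega> \<in> space M. B < w 0 0 \<omega> * (Z 0 0 \<omega>)\<^sup>2})"
    by (simp add: sv_X_sq)
  also have "\<dots> = expectation (\<lambda>\<omega>. h ((Z 0 0 \<omega>)\<^sup>2, w 0 0 \<omega>))"
    by (intro Bochner_Integration.integral_cong) (auto simp: h_def split: split_indicator)
  also have "\<dots> = expectation (\<lambda>\<omega>. expectation (\<lambda>\<omega>'. h ((Z 0 0 \<omega>')\<^sup>2, w 0 0 \<omega>)))"
    by (rule indep_var_expectation_iterated(1)[OF indep_component h, of 1]) (auto simp: h_def split: split_indicator)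
  also have "\<dots> = expectation (\<lambda>\<omega>. Y.G (w 0 0 \<omega> / B))"
  proof (intro Bochner_Integration.integral_cong refl)
    fix \<omega>
    have "expectation (\<lambda>\<omega>'. h ((Z 0 0 \<omega>')\<^sup>2, w 0 0 \<omega>)) = expectation (indicator {\<omega>' \<in> space M. 1 < w 0 0 \<omega> / B * (Z 0 0 \<omega>')\<^sup>2})"
      using assms by (intro Bochner_Integration.integral_cong) (auto simp: h_def field_simps split: split_indicator)
    also have "\<dots> = Y.G (w 0 0 \<omega> / B)"
    proof -
      have "Y.G (w 0 0 \<omega> / B) = measure Y_law {y. 1 < w 0 0 \<omega> / B * y}" by (simp only: Y.G_def)
      also have "\<dots> = prob ((\<lambda>\<omega>. (Z 0 0 \<omega>)\<^sup>2) -` {y. 1 < w 0 0 \<omega> / B * y} \<inter> space M)"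
        unfolding Y_law_def by (rule measure_distr) auto
      also have "(\<lambda>\<omega>. (Z 0 0 \<omega>)\<^sup>2) -` {y. 1 < w 0 0 \<omega> / B * y} \<inter> space M = {\<omega>' \<in> space M. 1 < w 0 0 \<omega> / B * (Z 0 0 \<omega>')\<^sup>2}"
        by auto
      finally show ?thesis by simp
    qed
    finally show "expectation (\<lambda>\<omega>'. h ((Z 0 0 \<omega>')\<^sup>2, w 0 0 \<omega>)) = Y.G (w 0 0 \<omega> / B)" .
  qed
  finally show ?thesis .
qed

lemma integrable_G_w: "integrable M (\<lambda>\<omega>. Y.G (w i t \<omega> / B))"
proof (cases "0 \<le> B")
  case True
  then show ?thesis by (intro integrable_const_bound[where B = 1]) (auto simp: Y.G_nonneg Y.G_le_1)
next
  case False
  then show ?thesis by (intro integrable_const_bound[where B = 1]) (auto simp: Y.G_def)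
qed

text \<open>A volatility vanishing almost surely would contradict the condition on \<open>a\<close>:
  then \<open>sv_X\<close> would be 0 almost surely and its tail probability either 0 or 1.\<close>

lemma w_positive:
  obtains \<eta> where "0 < \<eta>" "\<eta> \<le> 1" "0 < prob {\<omega> \<in> space M. \<eta> \<le> w 0 0 \<omega>}"
proof -
  have "\<exists>k. prob {\<omega> \<in> space M. 1 / real (Suc k) \<le> w 0 0 \<omega>} \<noteq> 0"
  proof (rule ccontr)
    assume "\<not> ?thesis"
    then have "AE \<omega> in M. \<forall>k. \<not> 1 / real (Suc k) \<le> w 0 0 \<omega>"
      unfolding AE_all_countable by (intro allI AE_I[where N = "{\<omega> \<in> space M. 1 / real (Suc k) \<le> w 0 0 \<omega>}" for k]) (auto simp: emeasure_eq_measure)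
    then have z: "AE \<omega> in M. sv_X \<sigma> Z 0 0 \<omega> = 0"
    proof (elim AE_mp, intro AE_I2 impI)
      fix \<omega> assume *: "\<forall>k. \<not> 1 / real (Suc k) \<le> w 0 0 \<omega>"
      have "w 0 0 \<omega> = 0"
      proof (rule ccontr)
        assume "w 0 0 \<omega> \<noteq> 0"
        then have "0 < w 0 0 \<omega>" using w_nonneg[of 0 0 \<omega>] by linarith
        then obtain k where "1 / real (Suc k) < w 0 0 \<omega>" using nat_approx_posE by blast
        then show False using * by (meson less_imp_le)
      qed
      then show "sv_X \<sigma> Z 0 0 \<omega> = 0" by (simp add: w_def sv_X_def)
    qed
    have pr: "prob {\<omega> \<in> space M. \<bar>sv_X \<sigma> Z 0 0 \<omega>\<bar> > a n} = (if a n < 0 then 1 else 0)" for n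
    proof -
      have [measurable]: "sv_X \<sigma> Z 0 0 \<in> borel_measurable M" unfolding sv_X_def by measurable
      have "prob {\<omega> \<in> space M. \<bar>sv_X \<sigma> Z 0 0 \<omega>\<bar> > a n} = prob (if a n < 0 then space M else {})"
        using z by (intro finite_measure_eq_AE) auto
      then show ?thesis by (simp add: prob_space)
    qed
    \<comment> \<open>Only the values 0 and \<open>n\<close> occur, both at distance at least 1 from
      1 once \<open>n\<close> is at least 2.\<close>
    have "\<forall>\<^sub>F n in sequentially. dist (real n * (if a n < 0 then 1 else 0)) 1 < 1"
      using tendstoD[OF a_n, of 1] by (simp add: pr)
    moreover have "\<forall>\<^sub>F n in sequentially. 2 \<le> n" by (rule eventually_ge_at_top)
    ultimately have "\<forall>\<^sub>F n :: nat in sequentially. False"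
      by eventually_elim (auto simp: dist_real_def split: if_splits)
    then show False by simp
  qed
  then obtain k where "prob {\<omega> \<in> space M. 1 / real (Suc k) \<le> w 0 0 \<omega>} \<noteq> 0" by blast
  then show ?thesis by (intro that[of "1 / real (Suc k)"]) (auto simp: zero_less_measure_iff)
qed

text \<open>With positive probability the weight is at least \<open>\<eta>\<close>; there the tail
  is at least that of \<open>\<eta>\<close> times the squared noise, and a Potter bound removes the
  factor \<open>\<eta>\<close>.\<close>

lemma tail_lower:
  obtains c where "c > 0" "\<And>B. 0 < B \<Longrightarrow> c * Y.G (1 / B) \<le> prob {\<omega> \<in> space M. B < (sv_X \<sigma> Z 0 0 \<omega>)\<^sup>2}"
proof -
  obtain \<eta> where \<eta>: "0 < \<eta>" "\<eta> \<le> 1" "0 < prob {\<omega> \<in> space M. \<eta> \<le> w 0 0 \<omega>}" using w_positive .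
  obtain C where C: "C > 0" "\<And>s l. 0 < s \<Longrightarrow> 1 \<le> l \<Longrightarrow> Y.G (l * s) \<le> C * l powr (\<beta> + 1) * Y.G s"
    using Y.potter_large[of "\<beta> + 1"] by auto
  define P where "P = prob {\<omega> \<in> space M. \<eta> \<le> w 0 0 \<omega>}"
  define D where "D = C * (1 / \<eta>) powr (\<beta> + 1)"
  have D: "D > 0" using C \<eta> by (simp add: D_def)
  show ?thesis
  proof (rule that[of "P / D"])
    show "P / D > 0" using \<eta> D by (simp add: P_def)
    fix B :: real assume B: "0 < B"
    have "Y.G (1 / \<eta> * (\<eta> / B)) \<le> D * Y.G (\<eta> / B)" unfolding D_def using \<eta> B by (intro C(2)) auto
    then have "Y.G (1 / B) \<le> D * Y.G (\<eta> / B)" using \<eta> by simp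
    then have "P / D * Y.G (1 / B) \<le> P / D * (D * Y.G (\<eta> / B))"
      using D by (intro mult_left_mono) (auto simp: P_def)
    also have "\<dots> = P * Y.G (\<eta> / B)" using D by simp
    also have "\<dots> = expectation (\<lambda>\<omega>. indicator {\<omega> \<in> space M. \<eta> \<le> w 0 0 \<omega>} \<omega> * Y.G (\<eta> / B))"
      by (simp add: P_def)
    also have "\<dots> \<le> expectation (\<lambda>\<omega>. Y.G (w 0 0 \<omega> / B))"
    proof (rule integral_mono)
      show "indicator {\<omega> \<in> space M. \<eta> \<le> w 0 0 \<omega>} \<omega> * Y.G (\<eta> / B) \<le> Y.G (w 0 0 \<omega> / B)" for \<omega>
        using \<eta> B by (auto split: split_indicator intro!: Y.mono_G Y.G_nonneg divide_right_mono)
    qed (auto intro!: integrable_G_w integrable_mult_left simp: integrable_indicator_iff emeasure_eq_measure)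
    finally show "P / D * Y.G (1 / B) \<le> prob {\<omega> \<in> space M. B < (sv_X \<sigma> Z 0 0 \<omega>)\<^sup>2}"
      using tail_sq[OF B] by simp
  qed
qed

text \<open>Whenever \<open>a n\<close> is at most \<open>R'\<close>, the tail probability is at
  least the fixed positive number \<open>q\<close>. As \<open>n\<close> times it is eventually below
  2, this cannot happen once \<open>n\<close> is at least \<open>2 / q\<close>.\<close>

lemma a_at_top: "filterlim a at_top sequentially"
  unfolding filterlim_at_top
proof
  fix R :: real
  define R' where "R' = max R 1"
  obtain c where c: "c > 0" "\<And>B. 0 < B \<Longrightarrow> c * Y.G (1 / B) \<le> prob {\<omega> \<in> space M. B < (sv_X \<sigma> Z 0 0 \<omega>)\<^sup>2}"
    using tail_lower by metis
  define q where "q = c * Y.G (1 / R'\<^sup>2)"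
  have R': "R' > 0" by (simp add: R'_def)
  have q: "q > 0" using c R' by (simp add: q_def Y.G_pos)
  have [measurable]: "sv_X \<sigma> Z 0 0 \<in> borel_measurable M" unfolding sv_X_def by measurable
  have "\<forall>\<^sub>F n in sequentially. real n * prob {\<omega> \<in> space M. \<bar>sv_X \<sigma> Z 0 0 \<omega>\<bar> > a n} < 2"
    using order_tendstoD(2)[OF a_n, of 2] by simp
  moreover have "\<forall>\<^sub>F n in sequentially. nat \<lceil>2 / q\<rceil> \<le> n" by (rule eventually_ge_at_top)
  ultimately show "\<forall>\<^sub>F n in sequentially. R \<le> a n"
  proof eventually_elim
    case (elim n)
    show "R \<le> a n"
    proof (rule ccontr)
      assume "\<not> R \<le> a n"
      then have an: "a n \<le> R'" by (simp add: R'_def)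
      have "q \<le> prob {\<omega> \<in> space M. R'\<^sup>2 < (sv_X \<sigma> Z 0 0 \<omega>)\<^sup>2}" unfolding q_def using R' by (intro c(2)) auto
      also have "\<dots> \<le> prob {\<omega> \<in> space M. \<bar>sv_X \<sigma> Z 0 0 \<omega>\<bar> > a n}"
      proof (rule finite_measure_mono)
        show "{\<omega> \<in> space M. R'\<^sup>2 < (sv_X \<sigma> Z 0 0 \<omega>)\<^sup>2} \<subseteq> {\<omega> \<in> space M. \<bar>sv_X \<sigma> Z 0 0 \<omega>\<bar> > a n}"
          using an R' by (auto simp: less_square_iff)
      qed simp
      finally have "real n * q \<le> real n * prob {\<omega> \<in> space M. \<bar>sv_X \<sigma> Z 0 0 \<omega>\<bar> > a n}" by (intro mult_left_mono) auto
      moreover have "2 / q \<le> real n" using elim(2) by linarith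
      then have "2 \<le> real n * q" using q by (simp add: field_simps)
      ultimately show False using elim(1) by linarith
    qed
  qed
qed

lemma b_at_top: "filterlim b at_top sequentially"
  unfolding b_def using a_at_top by (intro filterlim_pow_at_top) auto

lemma b_pos: "\<forall>\<^sub>F n in sequentially. 0 < b n"
  using b_at_top by (simp add: filterlim_at_top_dense)

lemma expected_exceedances: "(\<lambda>n. real n * expectation (\<lambda>\<omega>. Y.G (w 0 0 \<omega> / b n))) \<longlonglongrightarrow> 1"
proof (rule Lim_transform_eventually[OF a_n])
  have "\<forall>\<^sub>F n in sequentially. 0 < a n" using a_at_top by (simp add: filterlim_at_top_dense)
  then show "\<forall>\<^sub>F n in sequentially. real n * prob {\<omega> \<in> space M. \<bar>sv_X \<sigma> Z 0 0 \<omega>\<bar> > a n} = real n * expectation (\<lambda>\<omega>. Y.G (w 0 0 \<omega> / b n))"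
    using b_pos
  proof eventually_elim
    case (elim n)
    have "{\<omega> \<in> space M. \<bar>sv_X \<sigma> Z 0 0 \<omega>\<bar> > a n} = {\<omega> \<in> space M. b n < (sv_X \<sigma> Z 0 0 \<omega>)\<^sup>2}"
      using elim by (auto simp: b_def less_square_iff)
    then show ?case using tail_sq[OF elim(2)] by simp
  qed
qed

section \<open>Mixing, variances and the growth of the normalisation\<close>

lemma mixing_events:
  fixes f :: "real \<Rightarrow> real"
  assumes [measurable]: "f \<in> borel_measurable borel" and i: "i \<in> {1..p}" and st: "1 \<le> s" "s \<le> (t::nat)"
  shows "\<bar>prob ({\<omega> \<in> space M. x < f (w (int i) (int s) \<omega>)} \<inter> {\<omega> \<in> space M. y < f (w (int i) (int t) \<omega>)})
    - prob {\<omega> \<in> space M. x < f (w (int i) (int s) \<omega>)} * prob {\<omega> \<in> space M. y < f (w (int i) (int t) \<omega>)}\<bar> \<le> r (t - s)"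
proof -
  let ?A = "\<lambda>x s. {\<omega> \<in> space M. x < f (w (int i) (int s) \<omega>)}"
  have gen: "{\<omega> \<in> space M. x < f (w (int i) u \<omega>)} \<in> sigma_gen M \<sigma> p T" if "u \<in> T" for x u T
  proof -
    have "{\<omega> \<in> space M. x < f (w (int i) u \<omega>)} = \<sigma> (int i) u -` {v. x < f (v\<^sup>2)} \<inter> space M"
      by (auto simp: w_def)
    moreover have "{v :: real. x < f (v\<^sup>2)} \<in> sets borel" by measurable
    ultimately have "{\<omega> \<in> space M. x < f (w (int i) u \<omega>)} \<in> {\<sigma> (int i) u -` B \<inter> space M | B. B \<in> sets borel}" by blast
    then show ?thesis
      unfolding sigma_gen_def using i that by (intro sigma_sets.Basic UN_I[of "int i"] UN_I[of u]) auto
  qed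
  define S where "S = {\<bar>prob (A \<inter> B) - prob A * prob B\<bar> | A B k.
     (k::int) \<ge> 1 \<and> A \<in> sigma_gen M \<sigma> p {1..k} \<and> B \<in> sigma_gen M \<sigma> p {k + int (t - s)..}}"
  \<comment> \<open>A supremum of reals bounds its members only if the set is bounded above.\<close>
  have bdd: "bdd_above S" unfolding S_def using abs_prob_diff_prod_le_1 by (intro bdd_aboveI[of _ 1]) auto
  have "\<bar>prob ((?A x s) \<inter> (?A y t))
    - prob (?A x s) * prob (?A y t)\<bar> \<in> S"
    unfolding S_def using st by (intro CollectI exI[of _ "int s"] exI conjI refl) (auto intro!: gen)
  then have "\<bar>prob ((?A x s) \<inter> (?A y t))
    - prob (?A x s) * prob (?A y t)\<bar> \<le> Sup S"
    by (rule cSup_upper[OF _ bdd])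
  also have "Sup S = mixing_coef M \<sigma> p (t - s)" by (simp add: S_def mixing_coef_def)
  also have "\<dots> \<le> r (t - s)" using mixing by (simp add: strongly_mixing_with_rate_def)
  finally show ?thesis .
qed

text \<open>\<open>r h\<close> dominates an absolute value at lag \<open>h\<close>, here for the
  times 1 and \<open>Suc h\<close>.\<close>

lemma r_nonneg: "0 \<le> r h"
  using order_trans[OF abs_ge_zero mixing_events[of "\<lambda>x. x" 1 1 "Suc h" 0 0]] p_ge by simp

lemma r_tendsto: "r \<longlonglongrightarrow> 0"
  using mixing by (simp add: strongly_mixing_with_rate_def)

text \<open>Stated for a function of the weights because it is applied twice: to the identity, and
  to rescaled tails that depend on \<open>n\<close>, for which \<open>C\<close> has to be
  uniform.\<close>

lemma variance_w:
  fixes f :: "real \<Rightarrow> real"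
  assumes f [measurable]: "f \<in> borel_measurable borel" and f0: "\<And>x. 0 \<le> x \<Longrightarrow> 0 \<le> f x" and i: "i \<in> {1..p}"
    and q: "2 < q" and int: "integrable M (\<lambda>\<omega>. f (w 0 0 \<omega>) powr q)" and C: "expectation (\<lambda>\<omega>. f (w 0 0 \<omega>) powr q) \<le> C"
  shows "integrable M (\<lambda>\<omega>. ((\<Sum>t=1..n. f (w (int i) (int t) \<omega>)) - real n * expectation (\<lambda>\<omega>. f (w 0 0 \<omega>)))\<^sup>2)"
    and "expectation (\<lambda>\<omega>. ((\<Sum>t=1..n. f (w (int i) (int t) \<omega>)) - real n * expectation (\<lambda>\<omega>. f (w 0 0 \<omega>)))\<^sup>2)
      \<le> 2 * real n * (\<Sum>h<n. (1 + (2 * C + 2 * C * (1 + C))) * r h powr ((q - 2) / q))"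
proof -
  define U where "U t \<omega> = f (w (int i) (int t) \<omega>)" for t :: nat and \<omega>
  define c where "c h = (1 + (2 * C + 2 * C * (1 + C))) * r h powr ((q - 2) / q)" for h
  have C0: "0 \<le> C" using C by (rule order_trans[OF integral_nonneg_AE, rotated]) auto
  have [measurable]: "U t \<in> borel_measurable M" for t unfolding U_def by measurable
  have U0: "0 \<le> U t \<omega>" for t \<omega> by (simp add: U_def f0)
  have iq: "integrable M (\<lambda>\<omega>. U t \<omega> powr q)" for t
    unfolding U_def using integrable_w[of "\<lambda>x. f x powr q" "int i" "int t"] int by simp
  have Cq: "expectation (\<lambda>\<omega>. U t \<omega> powr q) \<le> C" for t
    unfolding U_def using expectation_w[of "\<lambda>x. f x powr q" "int i" "int t"] C by simp
  \<comment> \<open>Only the integrability conclusions are wanted, so level 1 and the trivial rate 1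
    suffice.\<close>
  have i1: "integrable M (U t)" for t
    by (rule covariance_truncation_bound(2)[of "U t" "U t" 1 q 1 C]) (use U0 q iq Cq abs_prob_diff_prod_le_1 in auto)
  have i2: "integrable M (\<lambda>\<omega>. U s \<omega> * U t \<omega>)" for s t
    by (rule covariance_truncation_bound(3)[of "U s" "U t" 1 q 1 C]) (use U0 q iq Cq abs_prob_diff_prod_le_1 in auto)
  have cov: "\<bar>expectation (\<lambda>\<omega>. U s \<omega> * U t \<omega>) - expectation (U s) * expectation (U t)\<bar> \<le> c (t - s)"
    if "s \<in> {1..n}" "t \<in> {1..n}" "s \<le> t" for s t
    unfolding c_def
  proof (rule covariance_mixing_bound[OF _ _ _ _ q])
    show "\<bar>prob ({\<omega> \<in> space M. x < U s \<omega>} \<inter> {\<omega> \<in> space M. y < U t \<omega>}) - prob {\<omega> \<in> space M. x < U s \<omega>} * prob {\<omega> \<in> space M. y < U t \<omega>}\<bar> \<le> r (t - s)" for x y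
      unfolding U_def using that i by (intro mixing_events) auto
  qed (use U0 iq Cq in auto)
  have c0: "0 \<le> c h" for h using C0 by (simp add: c_def)
  have e: "(\<Sum>t=1..n. expectation (U t)) = real n * expectation (\<lambda>\<omega>. f (w 0 0 \<omega>))"
    unfolding U_def by (simp add: expectation_w[OF f, of "int i"])
  show "integrable M (\<lambda>\<omega>. ((\<Sum>t=1..n. f (w (int i) (int t) \<omega>)) - real n * expectation (\<lambda>\<omega>. f (w 0 0 \<omega>)))\<^sup>2)"
    using variance_sum_bound(1)[of U c n, OF i1 i2 c0 cov] unfolding e by (simp add: U_def)
  show "expectation (\<lambda>\<omega>. ((\<Sum>t=1..n. f (w (int i) (int t) \<omega>)) - real n * expectation (\<lambda>\<omega>. f (w 0 0 \<omega>)))\<^sup>2)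
      \<le> 2 * real n * (\<Sum>h<n. (1 + (2 * C + 2 * C * (1 + C))) * r h powr ((q - 2) / q))"
    using variance_sum_bound(2)[of U c n, OF i1 i2 c0 cov] unfolding e by (simp add: U_def c_def)
qed

text \<open>Above \<beta> for the Potter bound, and below \<open>\<kappa> / 2\<close> so that
  \<open>w powr \<gamma>\<close> has a moment of order \<open>\<kappa> / \<gamma>\<close> above
  2.\<close>

lemma exponent_choice:
  obtains \<gamma> where "\<beta> < \<gamma>" "\<gamma> < 2" "2 * \<gamma> < \<kappa>" "0 < \<gamma>"
proof -
  have "\<beta> < min 2 (\<kappa> / 2)" using \<beta> \<kappa> by simp
  then obtain \<gamma> where "\<beta> < \<gamma>" "\<gamma> < min 2 (\<kappa> / 2)" using dense by blast
  then show ?thesis using that[of \<gamma>] \<beta> by simp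
qed

text \<open>By \<open>tail_lower\<close> the quantity is at most a constant times the expected
  number of exceedances, which tends to 1.\<close>

lemma n_G_bounded:
  obtains C where "C > 0" "\<forall>\<^sub>F n in sequentially. real n * Y.G (1 / b n) \<le> C"
proof -
  obtain c where c: "c > 0" "\<And>B. 0 < B \<Longrightarrow> c * Y.G (1 / B) \<le> prob {\<omega> \<in> space M. B < (sv_X \<sigma> Z 0 0 \<omega>)\<^sup>2}"
    using tail_lower by metis
  show ?thesis
  proof (rule that[of "2 / c"])
    have "\<forall>\<^sub>F n in sequentially. real n * expectation (\<lambda>\<omega>. Y.G (w 0 0 \<omega> / b n)) < 2"
      using order_tendstoD(2)[OF expected_exceedances, of 2] by simp
    then show "\<forall>\<^sub>F n in sequentially. real n * Y.G (1 / b n) \<le> 2 / c"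
      using b_pos
    proof eventually_elim
      case (elim n)
      have "c * Y.G (1 / b n) \<le> expectation (\<lambda>\<omega>. Y.G (w 0 0 \<omega> / b n))" using c(2)[OF elim(2)] tail_sq[OF elim(2)] by simp
      then have "real n * (c * Y.G (1 / b n)) \<le> real n * expectation (\<lambda>\<omega>. Y.G (w 0 0 \<omega> / b n))" by (rule mult_left_mono) simp
      then have "c * (real n * Y.G (1 / b n)) \<le> 2" using elim(1) by (simp add: mult.left_commute)
      then show ?case using c(1) by (simp add: field_simps)
    qed
  qed (use c in simp)
qed

text \<open>\<open>G_lower\<close> and \<open>n_G_bounded\<close> together bound \<open>n\<close> by
  a multiple of \<open>b n powr \<gamma>\<close> for each \<gamma> above \<beta>; a \<gamma> below
  \<open>\<theta>\<close> leaves a negative power of \<open>b n\<close>. Used with exponents 2 and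
  \<kappa>.\<close>

lemma n_div_b_powr:
  assumes "\<beta> < \<theta>"
  shows "(\<lambda>n. real n * b n powr (- \<theta>)) \<longlonglongrightarrow> 0"
proof -
  obtain \<gamma> where \<gamma>: "\<beta> < \<gamma>" "\<gamma> < \<theta>" using assms dense by blast
  obtain c where c: "c > 0" "\<And>s. 0 < s \<Longrightarrow> s \<le> 1 \<Longrightarrow> c * s powr \<gamma> \<le> Y.G s" using Y.G_lower[OF \<gamma>(1)] by metis
  obtain C where C: "C > 0" "\<forall>\<^sub>F n in sequentially. real n * Y.G (1 / b n) \<le> C" using n_G_bounded .
  have b1: "\<forall>\<^sub>F n in sequentially. 1 \<le> b n" using b_at_top by (simp add: filterlim_at_top)
  show ?thesis
  proof (rule tendsto_sandwich[OF always_eventually _ tendsto_const])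
    show "\<forall>\<^sub>F n in sequentially. real n * b n powr (- \<theta>) \<le> C / c * b n powr (\<gamma> - \<theta>)"
      using C(2) b1
    proof eventually_elim
      case (elim n)
      have "real n * (c * (1 / b n) powr \<gamma>) \<le> real n * Y.G (1 / b n)" using elim by (intro mult_left_mono c(2)) auto
      also have "\<dots> \<le> C" by (rule elim)
      finally have "real n * (1 / b n) powr \<gamma> \<le> C / c" using c(1) by (simp add: field_simps)
      then have "real n * b n powr (- \<gamma>) \<le> C / c" using elim by (simp add: powr_divide powr_minus_divide)
      then have "real n * b n powr (- \<gamma>) * b n powr (\<gamma> - \<theta>) \<le> C / c * b n powr (\<gamma> - \<theta>)" by (rule mult_right_mono) simp
      then show ?case by (simp add: mult.assoc powr_add[symmetric])
    qed
    have "(\<lambda>n. b n powr (\<gamma> - \<theta>)) \<longlonglongrightarrow> 0" using \<gamma> by (intro tendsto_neg_powr b_at_top) auto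
    then show "(\<lambda>n. C / c * b n powr (\<gamma> - \<theta>)) \<longlonglongrightarrow> 0" by (rule tendsto_mult_right_zero)
  qed auto
qed

text \<open>\<open>large\<close> bounds the \<open>\<kappa>\<close>-th power of the maximal normalised weight.\<close>

definition exceed where "exceed n i \<omega> = (\<Sum>t=1..n. Y.G (w (int i) (int t) \<omega> / b n))"
definition large where "large n i \<omega> = (\<Sum>t=1..n. (w (int i) (int t) \<omega> / b n) powr \<kappa>)"
definition drift where "drift n i \<omega> = Y.centre * ((\<Sum>t=1..n. w (int i) (int t) \<omega>) - real n * expectation (w 0 0)) / b n"

lemma exceed_meas [measurable]: "exceed n i \<in> borel_measurable M"
  unfolding exceed_def[abs_def] by measurable
lemma large_meas [measurable]: "large n i \<in> borel_measurable M"
  unfolding large_def[abs_def] by measurable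
lemma drift_meas [measurable]: "drift n i \<in> borel_measurable M"
  unfolding drift_def[abs_def] by measurable

lemma exceed_integrable: "integrable M (\<lambda>\<omega>. (exceed n i \<omega> - 1)\<^sup>2)"
proof (rule integrable_const_bound[where B = "(real n + 1)\<^sup>2"])
  have "\<bar>exceed n i \<omega> - 1\<bar> \<le> real n + 1" for \<omega>
  proof -
    have "exceed n i \<omega> \<le> (\<Sum>t=1..n. 1)" unfolding exceed_def by (intro sum_mono Y.G_le_1)
    moreover have "0 \<le> exceed n i \<omega>" unfolding exceed_def by (intro sum_nonneg Y.G_nonneg) auto
    ultimately show ?thesis by simp
  qed
  then have "(exceed n i \<omega> - 1)\<^sup>2 \<le> (real n + 1)\<^sup>2" for \<omega> using abs_le_square_iff[of "exceed n i \<omega> - 1" "real n + 1"] by simp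
  then show "AE \<omega> in M. norm ((exceed n i \<omega> - 1)\<^sup>2) \<le> (real n + 1)\<^sup>2" by simp
qed simp

text \<open>Variance and squared bias. By Potter and \<open>n_G_bounded\<close>, \<open>n\<close>
  times each exceedance probability has moments of order \<open>\<kappa> / \<gamma>\<close> bounded
  in \<open>n\<close>; the covariance inequality then bounds the variance by a Cesaro mean of powers
  of \<open>r\<close>. The bias vanishes by \<open>expected_exceedances\<close>.\<close>

lemma exceed_L2:
  assumes i: "i \<in> {1..p}"
  shows "(\<lambda>n. expectation (\<lambda>\<omega>. (exceed n i \<omega> - 1)\<^sup>2)) \<longlonglongrightarrow> 0"
proof -
  let ?V = "\<lambda>f n \<omega>. ((\<Sum>t=1..n. f (w (int i) (int t) \<omega>)) - real n * expectation (\<lambda>\<omega>. f (w 0 0 \<omega>)))\<^sup>2"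
  let ?e = "\<lambda>n. expectation (\<lambda>\<omega>. (exceed n i \<omega> - 1)\<^sup>2)"
  obtain \<gamma> where \<gamma>: "\<beta> < \<gamma>" "\<gamma> < 2" "2 * \<gamma> < \<kappa>" "0 < \<gamma>" using exponent_choice .
  define q where "q = \<kappa> / \<gamma>"
  have q: "2 < q" "\<gamma> * q = \<kappa>" using \<gamma> by (auto simp: q_def field_simps)
  obtain C1 where C1: "C1 > 0" "\<And>s l. 0 < s \<Longrightarrow> 1 \<le> l \<Longrightarrow> Y.G (l * s) \<le> C1 * l powr \<gamma> * Y.G s"
    using Y.potter_large[OF \<gamma>(1)] by metis
  obtain C2 where C2: "C2 > 0" "\<forall>\<^sub>F n in sequentially. real n * Y.G (1 / b n) \<le> C2" using n_G_bounded .
  \<comment> \<open>\<open>1 + C1\<close> instead of \<open>C1\<close> lets one constant serve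
    arguments above 1 and those below, where monotonicity replaces the Potter bound.\<close>
  define D where "D = ((1 + C1) * C2) powr q"
  define E where "E = D * (1 + expectation (\<lambda>\<omega>. w 0 0 \<omega> powr \<kappa>))"
  define c where "c h = (1 + (2 * E + 2 * E * (1 + E))) * r h powr ((q - 2) / q)" for h
  have D0: "0 \<le> D" by (simp add: D_def)
  have E0: "0 \<le> E" unfolding E_def using D0 by (intro mult_nonneg_nonneg add_nonneg_nonneg integral_nonneg_AE) auto
  have c0: "0 \<le> c h" for h using E0 by (simp add: c_def)
  define e where "e n = real n * expectation (\<lambda>\<omega>. Y.G (w 0 0 \<omega> / b n))" for n
  have var: "\<forall>\<^sub>F n in sequentially. ?e n \<le> 4 * ((\<Sum>h<n. c h) / real n) + 2 * (e n - 1)\<^sup>2"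
    using C2(2) b_pos eventually_gt_at_top[of 0]
  proof eventually_elim
    case (elim n)
    \<comment> \<open>The single terms are of order \<open>1 / n\<close>; the factor
      \<open>n\<close> keeps their moments bounded, and the later division by
      \<open>(real n)\<^sup>2\<close> leaves the Cesaro mean.\<close>
    define f where "f x = real n * Y.G (x / b n)" for x
    have [measurable]: "f \<in> borel_measurable borel" unfolding f_def by measurable
    have f0: "0 \<le> x \<Longrightarrow> 0 \<le> f x" for x using elim by (simp add: f_def Y.G_nonneg)
    have fq: "f x powr q \<le> D * (1 + x powr \<kappa>)" if x: "0 \<le> x" for x
    proof (cases "1 \<le> x")
      case True
      have "Y.G (x * (1 / b n)) \<le> C1 * x powr \<gamma> * Y.G (1 / b n)" using True elim by (intro C1(2)) auto
      then have "real n * Y.G (x / b n) \<le> real n * (C1 * x powr \<gamma> * Y.G (1 / b n))" by (intro mult_left_mono) auto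
      also have "\<dots> = C1 * (real n * Y.G (1 / b n)) * x powr \<gamma>" by simp
      also have "\<dots> \<le> (1 + C1) * C2 * x powr \<gamma>"
        using C1(1) elim by (intro mult_right_mono mult_mono) (auto intro!: mult_nonneg_nonneg Y.G_nonneg)
      finally have "f x powr q \<le> ((1 + C1) * C2 * x powr \<gamma>) powr q"
        unfolding f_def using q elim x by (intro powr_mono2) (auto intro!: mult_nonneg_nonneg Y.G_nonneg)
      also have "\<dots> = D * x powr \<kappa>" using C1(1) C2(1) q by (simp add: powr_mult powr_powr D_def)
      also have "\<dots> \<le> D * (1 + x powr \<kappa>)" using D0 by (intro mult_left_mono) auto
      finally show ?thesis .
    next
      case False
      have "f x \<le> real n * Y.G (1 / b n)"
        unfolding f_def using False elim x by (intro mult_left_mono Y.mono_G divide_right_mono) auto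
      also have "\<dots> \<le> 1 * C2" using elim by simp
      also have "\<dots> \<le> (1 + C1) * C2" using C1(1) C2(1) by (intro mult_right_mono) auto
      finally have "f x powr q \<le> D" unfolding D_def using q f0[OF x] by (intro powr_mono2) auto
      also have "\<dots> \<le> D * (1 + x powr \<kappa>)" using D0 by (simp add: distrib_left)
      finally show ?thesis .
    qed
    have iD: "integrable M (\<lambda>\<omega>. D * (1 + w 0 0 \<omega> powr \<kappa>))" using moment_w by simp
    have int: "integrable M (\<lambda>\<omega>. f (w 0 0 \<omega>) powr q)"
      by (rule Bochner_Integration.integrable_bound[OF iD]) (use fq D0 in \<open>auto intro: order_trans\<close>)
    have "expectation (\<lambda>\<omega>. f (w 0 0 \<omega>) powr q) \<le> expectation (\<lambda>\<omega>. D * (1 + w 0 0 \<omega> powr \<kappa>))"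
      by (intro integral_mono int iD fq) auto
    also have "\<dots> = E" using moment_w prob_space by (simp add: E_def)
    finally have Eb: "expectation (\<lambda>\<omega>. f (w 0 0 \<omega>) powr q) \<le> E" .
    note v = variance_w[of f i q E n, OF _ f0 i q(1) int Eb]
    have ex: "(exceed n i \<omega> - e n)\<^sup>2 = ?V f n \<omega> / (real n)\<^sup>2" for \<omega>
    proof -
      have "(\<Sum>t=1..n. f (w (int i) (int t) \<omega>)) - real n * expectation (\<lambda>\<omega>. f (w 0 0 \<omega>)) = real n * (exceed n i \<omega> - e n)"
        by (simp add: f_def exceed_def e_def sum_distrib_left right_diff_distrib)
      then show ?thesis using elim by (simp add: power_mult_distrib)
    qed
    have iv: "integrable M (\<lambda>\<omega>. (exceed n i \<omega> - e n)\<^sup>2)" unfolding ex using v(1) by simp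
    have "?e n \<le> expectation (\<lambda>\<omega>. 2 * (exceed n i \<omega> - e n)\<^sup>2 + 2 * (e n - 1)\<^sup>2)"
    proof (rule integral_mono)
      fix \<omega>
      have "0 \<le> ((exceed n i \<omega> - e n) - (e n - 1))\<^sup>2" by simp
      then show "(exceed n i \<omega> - 1)\<^sup>2 \<le> 2 * (exceed n i \<omega> - e n)\<^sup>2 + 2 * (e n - 1)\<^sup>2"
        by (simp add: power2_eq_square algebra_simps)
    qed (use exceed_integrable iv in auto)
    also have "\<dots> = 2 * expectation (\<lambda>\<omega>. (exceed n i \<omega> - e n)\<^sup>2) + 2 * (e n - 1)\<^sup>2" using iv prob_space by simp
    also have "\<dots> = 2 * (expectation (\<lambda>\<omega>. ?V f n \<omega>) / (real n)\<^sup>2) + 2 * (e n - 1)\<^sup>2"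
      by (simp add: ex)
    also have "\<dots> \<le> 2 * ((2 * real n * (\<Sum>h<n. c h)) / (real n)\<^sup>2) + 2 * (e n - 1)\<^sup>2"
      unfolding c_def using v(2) by (intro add_right_mono mult_left_mono divide_right_mono) auto
    also have "\<dots> = 4 * ((\<Sum>h<n. c h) / real n) + 2 * (e n - 1)\<^sup>2" using elim by (simp add: power2_eq_square)
    finally show ?case .
  qed
  have "(\<lambda>h. c h) \<longlonglongrightarrow> (1 + (2 * E + 2 * E * (1 + E))) * 0"
  proof -
    have "(\<lambda>h. r h powr ((q - 2) / q)) \<longlonglongrightarrow> 0 powr ((q - 2) / q)"
      by (rule tendsto_powr2[OF r_tendsto tendsto_const]) (use q r_nonneg in auto)
    then show ?thesis unfolding c_def by (intro tendsto_mult tendsto_const) simp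
  qed
  then have "(\<lambda>n. (\<Sum>h<n. c h) / real n) \<longlonglongrightarrow> 0" by (intro cesaro_mean_null c0) simp
  moreover have "e \<longlonglongrightarrow> 1" unfolding e_def by (rule expected_exceedances)
  ultimately have "(\<lambda>n. 4 * ((\<Sum>h<n. c h) / real n) + 2 * (e n - 1)\<^sup>2) \<longlonglongrightarrow> 4 * 0 + 2 * (1 - 1)\<^sup>2" by (intro tendsto_intros)
  then show ?thesis
    by (intro tendsto_sandwich[OF _ var tendsto_const]) (auto intro!: always_eventually integral_nonneg_AE)
qed

lemma large_integrable: "integrable M (large n i)"
  and large_L1: "(\<lambda>n. expectation (large n i)) \<longlonglongrightarrow> 0"
proof -
  have eq: "large n i \<omega> = (\<Sum>t=1..n. w (int i) (int t) \<omega> powr \<kappa> * b n powr (- \<kappa>))" for n \<omega>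
    by (simp add: large_def powr_divide powr_minus_divide)
  show "integrable M (large n i)" unfolding eq[abs_def] by (intro Bochner_Integration.integrable_sum integrable_mult_left moment_w)
  have "expectation (large n i) = expectation (\<lambda>\<omega>. w 0 0 \<omega> powr \<kappa>) * (real n * b n powr (- \<kappa>))" for n
  proof -
    have e: "expectation (\<lambda>\<omega>. w (int i) (int t) \<omega> powr \<kappa>) = expectation (\<lambda>\<omega>. w 0 0 \<omega> powr \<kappa>)" for t
      using expectation_w[of "\<lambda>x. x powr \<kappa>" "int i" "int t"] by simp
    show ?thesis unfolding eq[abs_def] using moment_w
      by (subst Bochner_Integration.integral_sum) (auto simp: e)
  qed
  moreover have "(\<lambda>n. real n * b n powr (- \<kappa>)) \<longlonglongrightarrow> 0" using \<kappa> \<beta> by (intro n_div_b_powr) auto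
  ultimately show "(\<lambda>n. expectation (large n i)) \<longlonglongrightarrow> 0" by (simp add: tendsto_mult_right_zero)
qed

lemma drift_L2:
  assumes i: "i \<in> {1..p}"
  shows "integrable M (\<lambda>\<omega>. (drift n i \<omega>)\<^sup>2)" and "(\<lambda>n. expectation (\<lambda>\<omega>. (drift n i \<omega>)\<^sup>2)) \<longlonglongrightarrow> 0"
proof -
  \<comment> \<open>Makes the covariance exponent \<open>(q - 2) / q\<close> the one of the
    summability hypothesis, so that the partial sums of \<open>c\<close> stay bounded.\<close>
  define q where "q = 2 + \<delta>"
  have q: "2 < q" "0 < q" "q \<le> \<kappa>" using \<delta>_pos \<kappa> by (auto simp: q_def)
  define C where "C = expectation (\<lambda>\<omega>. w 0 0 \<omega> powr q)"
  define c where "c h = (1 + (2 * C + 2 * C * (1 + C))) * r h powr ((q - 2) / q)" for h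
  have C0: "0 \<le> C" unfolding C_def by (intro integral_nonneg_AE) auto
  have c0: "0 \<le> c h" for h using C0 by (simp add: c_def)
  note v = variance_w[of "\<lambda>x. x" i q C, OF _ _ i q(1) moment_w_le[OF q(2,3)]]
  define V where "V n \<omega> = ((\<Sum>t=1..n. w (int i) (int t) \<omega>) - real n * expectation (w 0 0))\<^sup>2" for n \<omega>
  have iV: "integrable M (V n)" and eV: "expectation (V n) \<le> 2 * real n * (\<Sum>h<n. c h)" for n
    using v[of n] unfolding V_def[abs_def] c_def by (auto simp: C_def)
  have eq: "(drift n i \<omega>)\<^sup>2 = Y.centre\<^sup>2 * (V n \<omega> / (b n)\<^sup>2)" for n \<omega>
    by (simp add: drift_def V_def power_mult_distrib power_divide)
  show "integrable M (\<lambda>\<omega>. (drift n i \<omega>)\<^sup>2)" unfolding eq using iV by simp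
  show "(\<lambda>n. expectation (\<lambda>\<omega>. (drift n i \<omega>)\<^sup>2)) \<longlonglongrightarrow> 0"
  proof (cases "\<beta> < 1")
    case True
    then show ?thesis by (simp add: drift_def Y.centre_def)
  next
    case False
    have "(q - 2) / q = \<delta> / (2 + \<delta>)" by (simp add: q_def)
    then have sc: "summable c" unfolding c_def using r_summable by (intro summable_mult) simp
    define S where "S = suminf c"
    have cS: "(\<Sum>h<n. c h) \<le> S" for n unfolding S_def by (intro sum_le_suminf sc c0) auto
    show ?thesis
    proof (rule tendsto_sandwich[OF always_eventually _ tendsto_const])
      show "\<forall>\<^sub>F n in sequentially. expectation (\<lambda>\<omega>. (drift n i \<omega>)\<^sup>2) \<le> Y.centre\<^sup>2 * (2 * S) * (real n * b n powr (- 2))"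
        using b_pos
      proof eventually_elim
        case (elim n)
        have "expectation (\<lambda>\<omega>. (drift n i \<omega>)\<^sup>2) = Y.centre\<^sup>2 * (expectation (V n) / (b n)\<^sup>2)" unfolding eq by simp
        also have "\<dots> \<le> Y.centre\<^sup>2 * ((2 * real n * S) / (b n)\<^sup>2)"
          using eV[of n] cS[of n] by (intro mult_left_mono divide_right_mono order_trans[OF eV]) auto
        also have "\<dots> = Y.centre\<^sup>2 * (2 * S) * (real n * b n powr (- 2))"
          using elim by (simp add: powr_minus_divide powr_numeral)
        finally show ?case .
      qed
      have "(\<lambda>n. real n * b n powr (- 2)) \<longlonglongrightarrow> 0" using \<beta> by (intro n_div_b_powr) auto
      then show "(\<lambda>n. Y.centre\<^sup>2 * (2 * S) * (real n * b n powr (- 2))) \<longlonglongrightarrow> 0" by (rule tendsto_mult_right_zero)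
    qed (auto intro!: integral_nonneg_AE)
  qed
qed

text \<open>Gathering all requirements on the volatility in one quantity that vanishes in mean makes a single
  almost surely convergent subsequence suffice.\<close>

definition defect where
  "defect n \<omega> = (\<Sum>i=1..p. (exceed n i \<omega> - 1)\<^sup>2 + large n i \<omega> + (drift n i \<omega>)\<^sup>2)"

lemma defect_L1: "integrable M (defect n)" "(\<lambda>n. expectation (\<lambda>\<omega>. norm (defect n \<omega>))) \<longlonglongrightarrow> 0"
proof -
  have l0: "0 \<le> large n i \<omega>" for n i \<omega> unfolding large_def by (intro sum_nonneg) auto
  have d0: "0 \<le> defect n \<omega>" for n \<omega> unfolding defect_def using l0 by (intro sum_nonneg) auto
  have I: "integrable M (\<lambda>\<omega>. (exceed n i \<omega> - 1)\<^sup>2 + large n i \<omega> + (drift n i \<omega>)\<^sup>2)" if "i \<in> {1..p}" for n i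
    using that by (intro Bochner_Integration.integrable_add exceed_integrable large_integrable drift_L2)
  show "integrable M (defect n)" unfolding defect_def[abs_def] using I by (intro Bochner_Integration.integrable_sum) auto
  have "expectation (\<lambda>\<omega>. norm (defect n \<omega>)) = (\<Sum>i=1..p. expectation (\<lambda>\<omega>. (exceed n i \<omega> - 1)\<^sup>2) + expectation (large n i) + expectation (\<lambda>\<omega>. (drift n i \<omega>)\<^sup>2))" for n
  proof -
    have "expectation (\<lambda>\<omega>. norm (defect n \<omega>)) = expectation (defect n)" using d0 by simp
    also have "\<dots> = (\<Sum>i=1..p. expectation (\<lambda>\<omega>. (exceed n i \<omega> - 1)\<^sup>2 + large n i \<omega> + (drift n i \<omega>)\<^sup>2))"
      unfolding defect_def[abs_def] using I by (intro Bochner_Integration.integral_sum) auto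
    also have "\<dots> = (\<Sum>i=1..p. expectation (\<lambda>\<omega>. (exceed n i \<omega> - 1)\<^sup>2) + expectation (large n i) + expectation (\<lambda>\<omega>. (drift n i \<omega>)\<^sup>2))"
      using exceed_integrable large_integrable drift_L2(1) by (intro sum.cong) auto
    finally show ?thesis .
  qed
  moreover have "(\<lambda>n. \<Sum>i=1..p. expectation (\<lambda>\<omega>. (exceed n i \<omega> - 1)\<^sup>2) + expectation (large n i) + expectation (\<lambda>\<omega>. (drift n i \<omega>)\<^sup>2)) \<longlonglongrightarrow> (\<Sum>i=1..p. 0 + 0 + 0)"
    by (intro tendsto_sum tendsto_add exceed_L2 large_L1 drift_L2) auto
  ultimately show "(\<lambda>n. expectation (\<lambda>\<omega>. norm (defect n \<omega>))) \<longlonglongrightarrow> 0" by simp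
qed

end

section \<open>Subsequences and test functions of padded vectors\<close>

lemma LIMSEQ_subsubsequence:
  fixes X :: "nat \<Rightarrow> 'a::metric_space"
  assumes "\<And>s :: nat \<Rightarrow> nat. strict_mono s \<Longrightarrow> \<exists>r :: nat \<Rightarrow> nat. strict_mono r \<and> (\<lambda>n. X (s (r n))) \<longlonglongrightarrow> L"
  shows "X \<longlonglongrightarrow> L"
proof (rule ccontr)
  assume "\<not> X \<longlonglongrightarrow> L"
  then obtain e where e: "e > 0" "\<not> (\<forall>\<^sub>F n in sequentially. dist (X n) L < e)" by (auto simp: tendsto_iff)
  then have "\<forall>N. \<exists>n\<ge>N. \<not> dist (X n) L < e" unfolding eventually_sequentially by blast
  then have "infinite {n. \<not> dist (X n) L < e}" unfolding infinite_nat_iff_unbounded_le mem_Collect_eq .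
  from infinite_enumerate[OF this] obtain s :: "nat \<Rightarrow> nat" where s: "strict_mono s" and "\<forall>n. s n \<in> {n. \<not> dist (X n) L < e}"
    by metis
  then have sL: "\<not> dist (X (s n)) L < e" for n by simp
  obtain r where "(\<lambda>n. X (s (r n))) \<longlonglongrightarrow> L" using assms[OF s] by blast
  from tendstoD[OF this e(1)] show False using sL by simp
qed

lemma tendsto_fun_coordinatewise:
  fixes X :: "'b \<Rightarrow> 'i \<Rightarrow> 'c::topological_space"
  assumes "\<And>i. ((\<lambda>n. X n i) \<longlongrightarrow> x i) F"
  shows "(X \<longlongrightarrow> x) F"
proof -
  have "limitin (product_topology (\<lambda>i. euclidean) UNIV) X x F"
    using assms by (simp add: limitin_componentwise)
  then show ?thesis by (simp add: euclidean_product_topology)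
qed

text \<open>The index type is countable, so Borel measurability into the function space can be
  checked coordinate by coordinate.\<close>

lemma measurable_pad_vec:
  assumes "\<And>i. i \<in> {1..p} \<Longrightarrow> (\<lambda>x. f x i) \<in> borel_measurable N"
  shows "(\<lambda>x. pad_vec p (f x)) \<in> borel_measurable N"
proof (rule measurable_coordinatewise_then_product)
  show "(\<lambda>x. pad_vec p (f x) i) \<in> borel_measurable N" for i
    using assms by (cases "i \<in> {1..p}") (auto simp: pad_vec_def)
qed

lemma borel_measurable_continuous_pad_vec:
  fixes g :: "(nat \<Rightarrow> real) \<Rightarrow> real"
  assumes "continuous_on UNIV g" "\<And>i. i \<in> {1..p} \<Longrightarrow> (\<lambda>x. f x i) \<in> borel_measurable N"
  shows "(\<lambda>x. g (pad_vec p (f x))) \<in> borel_measurable N"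
  using measurable_compose[OF measurable_pad_vec borel_measurable_continuous_onI] assms by blast

lemma tendsto_continuous_pad_vec:
  fixes g :: "(nat \<Rightarrow> real) \<Rightarrow> real"
  assumes "continuous_on UNIV g" "\<And>i. i \<in> {1..p} \<Longrightarrow> (\<lambda>n. X n i) \<longlonglongrightarrow> x i"
  shows "(\<lambda>n. g (pad_vec p (X n))) \<longlonglongrightarrow> g (pad_vec p x)"
proof -
  have "(\<lambda>n. pad_vec p (X n)) \<longlonglongrightarrow> pad_vec p x"
  proof (rule tendsto_fun_coordinatewise)
    show "(\<lambda>n. pad_vec p (X n) i) \<longlonglongrightarrow> pad_vec p x i" for i
      using assms(2)[of i] by (cases "i \<in> {1..p}") (auto simp: pad_vec_def)
  qed
  moreover have "isCont g (pad_vec p x)" using assms(1) by (simp add: continuous_on_eq_continuous_at)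
  ultimately show ?thesis by (rule isCont_tendsto_compose[rotated])
qed

section \<open>Conditional laws and the limit\<close>

context sv_model
begin

text \<open>Volatility is read at \<open>\<omega>\<close>, noise at \<open>\<omega>'\<close>. For
  fixed \<open>\<omega>\<close> this is a sum of independent terms in \<open>\<omega>'\<close> plus
  a constant; on the diagonal it is the normalised sum of the theorem, by
  \<open>normalised_eq\<close>.\<close>

definition cond_sum where
  "cond_sum n \<omega> \<omega>' i = (\<Sum>t=1..n. w (int i) (int t) \<omega> / b n * ((Z (int i) (int t) \<omega>')\<^sup>2 - Y.centre)) + drift n i \<omega>"

lemma Z_sq_law: "distr M borel (\<lambda>\<omega>. (Z i t \<omega>)\<^sup>2) = Y_law"
proof -
  have "distr M borel (\<lambda>\<omega>. (Z i t \<omega>)\<^sup>2) = distr (distr M borel (Z i t)) borel (\<lambda>x. x\<^sup>2)" for i t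
    by (subst distr_distr) (auto simp: o_def)
  then show ?thesis unfolding Y_law_def using Z_ident by metis
qed

lemma centre_eq: "Y.centre = (if \<alpha> < 2 then 0 else expectation (\<lambda>\<omega>. (Z 0 0 \<omega>)\<^sup>2))"
proof -
  have "(\<integral>y. y \<partial>Y_law) = expectation (\<lambda>\<omega>. (Z 0 0 \<omega>)\<^sup>2)"
    unfolding Y_law_def by (rule integral_distr) auto
  moreover have "\<beta> < 1 \<longleftrightarrow> \<alpha> < 2" by (simp add: \<beta>_def)
  ultimately show ?thesis by (simp add: Y.centre_def)
qed

text \<open>By independence the mean of the squared product is \<open>Y.centre\<close> times the
  mean weight, when a mean is subtracted at all. Centring each squared noise term inside the sum
  instead changes the total by exactly \<open>drift\<close>.\<close>

lemma normalised_eq: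
  "(sv_S \<sigma> Z n i \<omega> - (if \<alpha> < 2 then 0 else real n * expectation (\<lambda>\<omega>'. (sv_X \<sigma> Z 0 0 \<omega>')\<^sup>2))) / (a n)\<^sup>2 = cond_sum n \<omega> \<omega> i"
proof -
  have S: "sv_S \<sigma> Z n i \<omega> = (\<Sum>t=1..n. w (int i) (int t) \<omega> * (Z (int i) (int t) \<omega>)\<^sup>2)"
    by (simp add: sv_S_def sv_X_sq)
  have E: "(if \<alpha> < 2 then 0 else real n * expectation (\<lambda>\<omega>'. (sv_X \<sigma> Z 0 0 \<omega>')\<^sup>2)) = real n * (Y.centre * expectation (w 0 0))"
  proof (cases "\<alpha> < 2")
    case False
    then have "1 < \<beta>" using \<alpha>_range by (auto simp: \<beta>_def)
    from Y.integrable_ident[OF this \<beta>(2)] have "integrable M (\<lambda>\<omega>. (Z 0 0 \<omega>)\<^sup>2)"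
      unfolding Y_law_def by (subst (asm) integrable_distr_eq) auto
    then have "expectation (\<lambda>\<omega>. (Z 0 0 \<omega>)\<^sup>2 * w 0 0 \<omega>) = Y.centre * expectation (w 0 0)"
      using False integrable_w1 indep_component[of 0 0 0 0] by (subst indep_var_lebesgue_integral) (auto simp: centre_eq)
    then show ?thesis using False by (simp add: sv_X_sq mult.commute)
  qed (simp add: centre_eq)
  have "cond_sum n \<omega> \<omega> i = (\<Sum>t=1..n. w (int i) (int t) \<omega> * ((Z (int i) (int t) \<omega>)\<^sup>2 - Y.centre)) / b n + drift n i \<omega>"
    by (simp add: cond_sum_def sum_divide_distrib)
  also have "\<dots> = ((\<Sum>t=1..n. w (int i) (int t) \<omega> * (Z (int i) (int t) \<omega>)\<^sup>2) - real n * (Y.centre * expectation (w 0 0))) / b n"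
    unfolding drift_def add_divide_distrib[symmetric]
    by (rule arg_cong2[where f = "(/)"])
       (simp_all add: right_diff_distrib sum_subtractf sum_distrib_left[symmetric] sum_distrib_right[symmetric] mult.commute mult.left_commute)
  finally show ?thesis unfolding S E b_def by simp
qed

text \<open>Independence is given for the noise field indexed by pairs, so sums along a row are
  rewritten as sums over lattice points.\<close>

definition block where "block n i = (\<lambda>t. (int i, int t)) ` {1..n}"

lemma sum_block: "(\<Sum>t=1..n. f (int i) (int t)) = (\<Sum>k\<in>block n i. f (fst k) (snd k))"
  unfolding block_def by (subst sum.reindex) (auto simp: inj_on_def)

lemma indep_block: "indep_vars (\<lambda>_. borel) (\<lambda>k \<omega>'. w (fst k) (snd k) \<omega> / b n * ((Z (fst k) (snd k) \<omega>')\<^sup>2 - Y.centre)) (block n i)"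
  using indep_vars_compose2[OF indep_vars_subset[OF Z_indep subset_UNIV], where Y = "\<lambda>k z. w (fst k) (snd k) \<omega> / b n * (z\<^sup>2 - Y.centre)" and N = "\<lambda>_. borel"]
  by (simp add: split_beta')

lemma cond_sum_meas [measurable]: "(\<lambda>\<omega>'. cond_sum n \<omega> \<omega>' i) \<in> borel_measurable M"
  unfolding cond_sum_def by measurable

lemma char_cond_sum:
  "char (distr M borel (\<lambda>\<omega>'. cond_sum n \<omega> \<omega>' i)) u =
     iexp (u * drift n i \<omega>) * (\<Prod>k\<in>block n i. 1 + Y.psi (u * (w (fst k) (snd k) \<omega> / b n)))"
proof -
  define T where "T \<omega>' = (\<Sum>k\<in>block n i. w (fst k) (snd k) \<omega> / b n * ((Z (fst k) (snd k) \<omega>')\<^sup>2 - Y.centre))" for \<omega>'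
  have [measurable]: "T \<in> borel_measurable M" unfolding T_def by measurable
  have eq: "cond_sum n \<omega> \<omega>' i = T \<omega>' + drift n i \<omega>" for \<omega>'
    unfolding cond_sum_def T_def by (simp only: sum_block[of "\<lambda>i t. w i t \<omega> / b n * ((Z i t \<omega>')\<^sup>2 - Y.centre)"])
  have "char (distr M borel (\<lambda>\<omega>'. cond_sum n \<omega> \<omega>' i)) u = expectation (\<lambda>\<omega>'. iexp (u * (T \<omega>' + drift n i \<omega>)))"
    unfolding char_def eq by (subst integral_distr) auto
  also have "\<dots> = expectation (\<lambda>\<omega>'. iexp (u * drift n i \<omega>) * iexp (u * T \<omega>'))"
    by (intro Bochner_Integration.integral_cong) (auto simp: exp_add[symmetric] algebra_simps)
  also have "\<dots> = iexp (u * drift n i \<omega>) * char (distr M borel T) u"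
    unfolding char_def by (subst integral_distr) auto
  also have "char (distr M borel T) u = (\<Prod>k\<in>block n i. char (distr M borel (\<lambda>\<omega>'. w (fst k) (snd k) \<omega> / b n * ((Z (fst k) (snd k) \<omega>')\<^sup>2 - Y.centre))) u)"
    unfolding T_def by (rule char_distr_sum[OF indep_block])
  also have "\<dots> = (\<Prod>k\<in>block n i. 1 + Y.psi (u * (w (fst k) (snd k) \<omega> / b n)))"
  proof (rule prod.cong)
    fix k assume "k \<in> block n i"
    define c where "c = w (fst k) (snd k) \<omega> / b n"
    have "char (distr M borel (\<lambda>\<omega>'. c * ((Z (fst k) (snd k) \<omega>')\<^sup>2 - Y.centre))) u = expectation (\<lambda>\<omega>'. iexp (u * c * ((Z (fst k) (snd k) \<omega>')\<^sup>2 - Y.centre)))"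
      unfolding char_def by (subst integral_distr) (auto simp: mult.assoc)
    also have "\<dots> = (\<integral>y. iexp (u * c * (y - Y.centre)) \<partial>Y_law)"
      unfolding Z_sq_law[of "fst k" "snd k", symmetric] by (subst integral_distr) auto
    finally show "char (distr M borel (\<lambda>\<omega>'. w (fst k) (snd k) \<omega> / b n * ((Z (fst k) (snd k) \<omega>')\<^sup>2 - Y.centre))) u =
      1 + Y.psi (u * (w (fst k) (snd k) \<omega> / b n))" by (simp add: c_def Y.psi_def)
  qed simp
  finally show ?thesis .
qed

lemma defect_components:
  assumes s: "(\<lambda>n. defect (s n) \<omega>) \<longlonglongrightarrow> 0" and i: "i \<in> {1..p}"
  shows "(\<lambda>n. exceed (s n) i \<omega>) \<longlonglongrightarrow> 1" "(\<lambda>n. large (s n) i \<omega>) \<longlonglongrightarrow> 0" "(\<lambda>n. drift (s n) i \<omega>) \<longlonglongrightarrow> 0"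
proof -
  have l0: "0 \<le> large n j \<omega>" for n j unfolding large_def by (intro sum_nonneg) auto
  have le: "(exceed n i \<omega> - 1)\<^sup>2 + large n i \<omega> + (drift n i \<omega>)\<^sup>2 \<le> defect n \<omega>" for n
    unfolding defect_def using i l0 by (intro member_le_sum) auto
  have sq: "f \<longlonglongrightarrow> 0" if "\<And>n. (f n)\<^sup>2 \<le> defect (s n) \<omega>" for f :: "nat \<Rightarrow> real"
  proof -
    have "(\<lambda>n. (f n)\<^sup>2) \<longlonglongrightarrow> 0"
      by (rule tendsto_sandwich[OF _ _ tendsto_const s]) (use that in \<open>auto intro!: always_eventually\<close>)
    then show ?thesis by simp
  qed
  have b1: "(exceed n i \<omega> - 1)\<^sup>2 \<le> defect n \<omega>" and b2: "large n i \<omega> \<le> defect n \<omega>" and b3: "(drift n i \<omega>)\<^sup>2 \<le> defect n \<omega>" for n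
    using le[of n] l0[of n i] zero_le_power2[of "exceed n i \<omega> - 1"] zero_le_power2[of "drift n i \<omega>"] by linarith+
  have "(\<lambda>n. exceed (s n) i \<omega> - 1) \<longlonglongrightarrow> 0" by (rule sq) (rule b1)
  then show "(\<lambda>n. exceed (s n) i \<omega>) \<longlonglongrightarrow> 1" by (simp add: LIM_zero_iff)
  show "(\<lambda>n. drift (s n) i \<omega>) \<longlonglongrightarrow> 0" by (rule sq) (rule b3)
  show "(\<lambda>n. large (s n) i \<omega>) \<longlonglongrightarrow> 0"
    by (rule tendsto_sandwich[OF _ _ tendsto_const s]) (use l0 b2 in \<open>auto intro!: always_eventually\<close>)
qed

lemma char_cond_sum_limit:
  assumes s: "(\<lambda>n. defect (s n) \<omega>) \<longlonglongrightarrow> 0" and i: "i \<in> {1..p}"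
  shows "(\<lambda>n. char (distr M borel (\<lambda>\<omega>'. cond_sum (s n) \<omega> \<omega>' i)) u) \<longlonglongrightarrow> exp (Y.stable_exponent u)"
proof -
  note d = defect_components[OF s i]
  have "(\<lambda>n. \<Prod>k\<in>block (s n) i. 1 + Y.psi (u * (w (fst k) (snd k) \<omega> / b (s n)))) \<longlonglongrightarrow> exp (Y.stable_exponent u)"
  proof (rule Y.prod_psi_limit[OF \<beta>(2,3)])
    show "0 \<le> w (fst k) (snd k) \<omega> / b (s n)" for n k by simp
    show "(\<lambda>n. \<Sum>k\<in>block (s n) i. Y.G (w (fst k) (snd k) \<omega> / b (s n))) \<longlonglongrightarrow> 1"
      using d(1) by (simp only: exceed_def sum_block[of "\<lambda>i t. Y.G (w i t \<omega> / b n)" for n])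
    fix e :: real assume e: "e > 0"
    \<comment> \<open>A single weight of size \<open>e\<close> or more would already contribute
      \<open>e powr \<kappa>\<close> to \<open>large\<close>.\<close>
    have "\<forall>\<^sub>F n in sequentially. large (s n) i \<omega> < e powr \<kappa>" using e by (intro order_tendstoD(2)[OF d(2)]) auto
    then show "\<forall>\<^sub>F n in sequentially. \<forall>k\<in>block (s n) i. w (fst k) (snd k) \<omega> / b (s n) < e"
    proof eventually_elim
      case (elim n)
      show ?case
      proof (rule ballI, rule ccontr)
        fix k assume k: "k \<in> block (s n) i" "\<not> w (fst k) (snd k) \<omega> / b (s n) < e"
        then have "e powr \<kappa> \<le> (w (fst k) (snd k) \<omega> / b (s n)) powr \<kappa>" using e \<kappa> by (intro powr_mono2) auto
        also have "\<dots> \<le> (\<Sum>k\<in>block (s n) i. (w (fst k) (snd k) \<omega> / b (s n)) powr \<kappa>)"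
          using k(1) by (intro member_le_sum[of k _ "\<lambda>k. (w (fst k) (snd k) \<omega> / b (s n)) powr \<kappa>"]) (auto simp: block_def)
        also have "\<dots> = large (s n) i \<omega>" by (simp only: large_def sum_block[of "\<lambda>i t. (w i t \<omega> / b (s n)) powr \<kappa>"])
        finally show False using elim by simp
      qed
    qed
  qed
  moreover have "(\<lambda>n. iexp (u * drift (s n) i \<omega>)) \<longlonglongrightarrow> iexp (u * 0)" by (intro tendsto_intros d)
  ultimately have "(\<lambda>n. iexp (u * drift (s n) i \<omega>) * (\<Prod>k\<in>block (s n) i. 1 + Y.psi (u * (w (fst k) (snd k) \<omega> / b (s n))))) \<longlonglongrightarrow> iexp (u * 0) * exp (Y.stable_exponent u)"
    by (intro tendsto_mult)
  then show ?thesis by (simp only: char_cond_sum) simp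
qed

lemma good_subsequence:
  fixes s :: "nat \<Rightarrow> nat"
  assumes s: "strict_mono s"
  obtains q where "strict_mono q" "AE \<omega> in M. (\<lambda>n. defect (s (q n)) \<omega>) \<longlonglongrightarrow> 0"
proof -
  have "(\<lambda>n. expectation (\<lambda>\<omega>. norm (defect (s n) \<omega>))) \<longlonglongrightarrow> 0"
    using LIMSEQ_subseq_LIMSEQ[OF defect_L1(2) s] by (simp add: o_def)
  then show ?thesis using tendsto_L1_AE_subseq[of M "\<lambda>n. defect (s n)"] defect_L1(1) that by blast
qed

lemma distr_cond_sum_real: "real_distribution (distr M borel (\<lambda>\<omega>'. cond_sum n \<omega> \<omega>' i))"
  by (rule real_distribution_distr) simp

text \<open>One volatility path along which \<open>defect\<close> vanishes on a subsequence is
  enough: the conditional characteristic functions of its first row, present because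
  \<open>p\<close> is at least 1, converge to a function continuous at 0.\<close>

lemma limit_law:
  obtains \<nu> where "stable_totally_right_skewed \<beta> \<nu>" "char \<nu> = (\<lambda>u. exp (Y.stable_exponent u))"
proof -
  have "strict_mono (id :: nat \<Rightarrow> nat)" by (simp add: strict_mono_def)
  from good_subsequence[OF this] obtain q where "AE \<omega> in M. (\<lambda>n. defect (id (q n)) \<omega>) \<longlonglongrightarrow> 0" by metis
  then have q: "AE \<omega> in M. (\<lambda>n. defect (q n) \<omega>) \<longlonglongrightarrow> 0" by simp
  then obtain \<omega> where \<omega>: "(\<lambda>n. defect (q n) \<omega>) \<longlonglongrightarrow> 0"
    using AE_contr[OF q] not_empty by (metis (mono_tags, lifting) AE_False eventually_mono)
  have cont: "isCont (\<lambda>u. exp (Y.stable_exponent u)) 0"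
  proof -
    have "((\<lambda>u. norm (Y.stable_exponent u)) \<longlongrightarrow> 0) (at 0)"
    proof -
      have "norm (Y.stable_exponent u) = \<bar>u\<bar> powr \<beta> * norm (stable_const \<beta>)" for u by (simp add: Y.stable_exponent_def norm_mult)
      moreover have "((\<lambda>u. \<bar>u\<bar> powr \<beta> * norm (stable_const \<beta>)) \<longlongrightarrow> \<bar>0\<bar> powr \<beta> * norm (stable_const \<beta>)) (at 0)"
        using \<beta> by (intro tendsto_mult tendsto_powr2 tendsto_rabs tendsto_const tendsto_ident_at) auto
      ultimately show ?thesis by simp
    qed
    then have "((\<lambda>u. Y.stable_exponent u) \<longlongrightarrow> 0) (at 0)" by (rule tendsto_norm_zero_cancel)
    moreover have "Y.stable_exponent 0 = 0" by (simp add: Y.stable_exponent_def)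
    ultimately have "isCont Y.stable_exponent 0" by (simp add: isCont_def)
    then show ?thesis by (intro continuous_intros)
  qed
  have "1 \<in> {1..p}" using p_ge by simp
  from levy_continuity_existence[OF distr_cond_sum_real char_cond_sum_limit[OF \<omega> this] cont]
  obtain \<nu> where \<nu>: "real_distribution \<nu>" "char \<nu> = (\<lambda>u. exp (Y.stable_exponent u))" by metis
  obtain c where c: "c > 0" "stable_const \<beta> = - of_real c * (1 - \<i> * of_real (tan (pi * \<beta> / 2)))"
    using stable_const_eq[OF \<beta>] by metis
  \<comment> \<open>The scale enters \<open>stable_law\<close> through its power \<beta>, hence the
    witness \<open>c powr (1 / \<beta>)\<close>; the shift is 0.\<close>
  have "char \<nu> u = exp (- complex_of_real ((c powr (1 / \<beta>)) powr \<beta> * \<bar>u\<bar> powr \<beta>)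
                  * (1 - \<i> * complex_of_real (1 * sgn u * tan (pi * \<beta> / 2)))
                + \<i> * complex_of_real (0 * u))" for u
  proof -
    have "(c powr (1 / \<beta>)) powr \<beta> = c" using c(1) \<beta> by (simp add: powr_powr)
    then have "Y.stable_exponent u = - complex_of_real ((c powr (1 / \<beta>)) powr \<beta> * \<bar>u\<bar> powr \<beta>)
                  * (1 - \<i> * complex_of_real (1 * sgn u * tan (pi * \<beta> / 2)))
                + \<i> * complex_of_real (0 * u)"
      by (cases "u < 0"; cases "u = 0") (auto simp: Y.stable_exponent_def c(2) sgn_if complex_eq_iff)
    then show ?thesis by (simp only: \<nu>(2))
  qed
  then have "stable_law \<beta> 1 \<nu>"
    unfolding stable_law_def using \<nu>(1) c(1) \<beta> by (intro conjI exI[of _ "c powr (1 / \<beta>)"] exI[of _ 0]) auto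
  then show ?thesis using that \<nu>(2) by (auto simp: stable_totally_right_skewed_def)
qed

text \<open>Different rows read disjoint blocks of one independent family; the volatility, frozen at
  \<open>\<omega>\<close>, contributes only constants.\<close>

lemma indep_cond_sum: "indep_vars (\<lambda>_. borel) (\<lambda>i \<omega>'. cond_sum n \<omega> \<omega>' i) {1..p}"
proof -
  have "indep_vars (\<lambda>j. PiM (block n j) (\<lambda>_. borel)) (\<lambda>j \<omega>'. restrict (\<lambda>k. (\<lambda>(i,t). Z i t) k \<omega>') (block n j)) {1..p}"
    by (rule indep_vars_restrict[OF Z_indep]) (auto simp: disjoint_family_on_def block_def)
  from indep_vars_compose2[OF this, where N = "\<lambda>_. borel" and
      Y = "\<lambda>j x. (\<Sum>t=1..n. w (int j) (int t) \<omega> / b n * ((x (int j, int t))\<^sup>2 - Y.centre)) + drift n j \<omega>"]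
  have "indep_vars (\<lambda>_. borel) (\<lambda>j \<omega>'. (\<Sum>t=1..n. w (int j) (int t) \<omega> / b n * ((restrict (\<lambda>k. (\<lambda>(i,t). Z i t) k \<omega>') (block n j) (int j, int t))\<^sup>2 - Y.centre)) + drift n j \<omega>) {1..p}"
    by (auto simp: block_def)
  then show ?thesis
    by (rule indep_vars_cong[THEN iffD1, rotated 3]) (auto simp: cond_sum_def block_def fun_eq_iff)
qed

lemma conditional_limit:
  fixes g :: "(nat \<Rightarrow> real) \<Rightarrow> real"
  assumes s: "(\<lambda>n. defect (s n) \<omega>) \<longlonglongrightarrow> 0" and \<nu>: "real_distribution \<nu>" "char \<nu> = (\<lambda>u. exp (Y.stable_exponent u))"
    and g: "continuous_on UNIV g" "\<And>x. \<bar>g x\<bar> \<le> B"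
  shows "(\<lambda>n. expectation (\<lambda>\<omega>'. g (pad_vec p (cond_sum (s n) \<omega> \<omega>')))) \<longlonglongrightarrow> (\<integral>x. g (pad_vec p x) \<partial>PiM {1..p} (\<lambda>_. \<nu>))"
proof -
  \<comment> \<open>Constant outside \<open>{1..p}\<close>, because \<open>weak_conv_PiM\<close>
    asks for weak convergence at every index.\<close>
  define \<mu> where "\<mu> n i = (if i \<in> {1..p} then distr M borel (\<lambda>\<omega>'. cond_sum (s n) \<omega> \<omega>' i) else \<nu>)" for n i
  have \<mu>: "real_distribution (\<mu> n i)" for n i using distr_cond_sum_real \<nu>(1) by (simp add: \<mu>_def)
  have w: "weak_conv_m (\<lambda>n. \<mu> n i) \<nu>" for i
  proof (rule levy_continuity[OF \<mu> \<nu>(1)])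
    show "(\<lambda>n. char (\<mu> n i) u) \<longlonglongrightarrow> char \<nu> u" for u
      using char_cond_sum_limit[OF s, of i u] by (cases "i \<in> {1..p}") (auto simp: \<mu>_def \<nu>(2))
  qed
  have pad_restrict: "pad_vec p (restrict f {1..p}) = pad_vec p f" for f by (auto simp: pad_vec_def fun_eq_iff)
  have gm: "(\<lambda>x. g (pad_vec p x)) \<in> borel_measurable (PiM {1..p} (\<lambda>_. borel))"
    by (rule borel_measurable_continuous_pad_vec[OF g(1)]) auto
  have lim: "(\<lambda>n. \<integral>x. g (pad_vec p x) \<partial>PiM {1..p} (\<mu> n)) \<longlonglongrightarrow> (\<integral>x. g (pad_vec p x) \<partial>PiM {1..p} (\<lambda>_. \<nu>))"
    by (rule weak_conv_PiM[OF _ \<mu> \<nu>(1) w gm g(2)]) (auto simp: pad_restrict intro!: tendsto_continuous_pad_vec g(1))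
  have "(\<integral>x. g (pad_vec p x) \<partial>PiM {1..p} (\<mu> n)) = expectation (\<lambda>\<omega>'. g (pad_vec p (cond_sum (s n) \<omega> \<omega>')))" for n
  proof -
    have "PiM {1..p} (\<mu> n) = PiM {1..p} (\<lambda>i. distr M borel (\<lambda>\<omega>'. cond_sum (s n) \<omega> \<omega>' i))"
      by (intro PiM_cong) (auto simp: \<mu>_def)
    also have "\<dots> = distr M (PiM {1..p} (\<lambda>_. borel)) (\<lambda>\<omega>'. \<lambda>i\<in>{1..p}. cond_sum (s n) \<omega> \<omega>' i)"
      using indep_vars_iff_distr_eq_PiM'[of "{1..p}" "\<lambda>i \<omega>'. cond_sum (s n) \<omega> \<omega>' i" "\<lambda>_. borel"] indep_cond_sum p_ge by auto
    finally have "(\<integral>x. g (pad_vec p x) \<partial>PiM {1..p} (\<mu> n)) = expectation (\<lambda>\<omega>'. g (pad_vec p (\<lambda>i\<in>{1..p}. cond_sum (s n) \<omega> \<omega>' i)))"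
      by (simp only:) (rule integral_distr[OF _ gm], auto intro!: measurable_restrict)
    then show ?thesis by (simp only: pad_restrict)
  qed
  then show ?thesis using lim by simp
qed

lemma expectation_conditional:
  fixes g :: "(nat \<Rightarrow> real) \<Rightarrow> real"
  assumes g: "continuous_on UNIV g" "\<And>x. \<bar>g x\<bar> \<le> B"
  shows "expectation (\<lambda>\<omega>. g (pad_vec p (cond_sum n \<omega> \<omega>))) = expectation (\<lambda>\<omega>. expectation (\<lambda>\<omega>'. g (pad_vec p (cond_sum n \<omega> \<omega>'))))"
    and "(\<lambda>\<omega>. expectation (\<lambda>\<omega>'. g (pad_vec p (cond_sum n \<omega> \<omega>')))) \<in> borel_measurable M"
proof -
  \<comment> \<open>\<open>cond_sum\<close> as one measurable function of the pair of noise and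
    volatility fields, the form to which their independence applies.\<close>
  define \<Phi> where "\<Phi> = (\<lambda>zs :: (int \<times> int \<Rightarrow> real) \<times> (int \<times> int \<Rightarrow> real). \<lambda>i.
     (\<Sum>t=1..n. (snd zs (int i, int t))\<^sup>2 / b n * ((fst zs (int i, int t))\<^sup>2 - Y.centre))
     + Y.centre * ((\<Sum>t=1..n. (snd zs (int i, int t))\<^sup>2) - real n * expectation (w 0 0)) / b n)"
  have m: "(\<lambda>zs. g (pad_vec p (\<Phi> zs))) \<in> borel_measurable (PiM UNIV (\<lambda>_. borel) \<Otimes>\<^sub>M PiM UNIV (\<lambda>_. borel))"
    by (rule borel_measurable_continuous_pad_vec[OF g(1)]) (simp add: \<Phi>_def)
  have eq: "\<Phi> (\<lambda>(i, t). Z i t \<omega>', \<lambda>(i, t). \<sigma> i t \<omega>) = cond_sum n \<omega> \<omega>'" for \<omega> \<omega>'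
    by (simp add: \<Phi>_def fun_eq_iff cond_sum_def drift_def w_def)
  show "expectation (\<lambda>\<omega>. g (pad_vec p (cond_sum n \<omega> \<omega>))) = expectation (\<lambda>\<omega>. expectation (\<lambda>\<omega>'. g (pad_vec p (cond_sum n \<omega> \<omega>'))))"
    using indep_var_expectation_iterated(1)[OF Z_\<sigma>_indep m g(2)] by (simp only: eq)
  show "(\<lambda>\<omega>. expectation (\<lambda>\<omega>'. g (pad_vec p (cond_sum n \<omega> \<omega>')))) \<in> borel_measurable M"
    using indep_var_expectation_iterated(2)[OF Z_\<sigma>_indep m g(2)] by (simp only: eq)
qed

text \<open>Along a suitable further subsequence the conditional means of a test function converge
  almost surely to the constant \<open>L\<close>, and being bounded they converge in mean; so every
  subsequence has a further one with the same limit.\<close>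

lemma cond_sum_converges:
  assumes \<nu>: "real_distribution \<nu>" "char \<nu> = (\<lambda>u. exp (Y.stable_exponent u))"
  shows "conv_in_distr_vec M (\<lambda>n \<omega>. cond_sum n \<omega> \<omega>) p (PiM {1..p} (\<lambda>_. \<nu>))"
  unfolding conv_in_distr_vec_def
proof (intro allI impI)
  fix g :: "(nat \<Rightarrow> real) \<Rightarrow> real" assume g: "continuous_on UNIV g \<and> bounded (range g)"
  then obtain B where B: "\<And>x. \<bar>g x\<bar> \<le> B" by (auto simp: bounded_iff)
  have gc: "continuous_on UNIV g" using g by simp
  define L where "L = (\<integral>x. g (pad_vec p x) \<partial>PiM {1..p} (\<lambda>_. \<nu>))"
  have cond_bound: "norm (expectation (\<lambda>\<omega>'. g (pad_vec p (cond_sum n \<omega> \<omega>')))) \<le> B" for n \<omega>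
  proof -
    have m: "(\<lambda>\<omega>'. g (pad_vec p (cond_sum n \<omega> \<omega>'))) \<in> borel_measurable M"
      by (rule borel_measurable_continuous_pad_vec[OF gc]) simp
    have "norm (expectation (\<lambda>\<omega>'. g (pad_vec p (cond_sum n \<omega> \<omega>')))) \<le> expectation (\<lambda>\<omega>'. norm (g (pad_vec p (cond_sum n \<omega> \<omega>'))))"
      by (rule integral_norm_bound)
    also have "\<dots> \<le> B" using B m by (intro integral_le_const integrable_const_bound[where B = B]) auto
    finally show ?thesis .
  qed
  show "(\<lambda>n. expectation (\<lambda>\<omega>. g (pad_vec p (cond_sum n \<omega> \<omega>)))) \<longlonglongrightarrow> (\<integral>x. g (pad_vec p x) \<partial>PiM {1..p} (\<lambda>_. \<nu>))"
    unfolding L_def[symmetric]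
  proof (rule LIMSEQ_subsubsequence)
    fix s :: "nat \<Rightarrow> nat" assume s: "strict_mono s"
    obtain q where q: "strict_mono q" "AE \<omega> in M. (\<lambda>n. defect (s (q n)) \<omega>) \<longlonglongrightarrow> 0" using good_subsequence[OF s] .
    have "(\<lambda>n. expectation (\<lambda>\<omega>. expectation (\<lambda>\<omega>'. g (pad_vec p (cond_sum (s (q n)) \<omega> \<omega>'))))) \<longlonglongrightarrow> expectation (\<lambda>\<omega>. L)"
    proof (rule integral_dominated_convergence[where w = "\<lambda>_. B"])
      show "AE \<omega> in M. (\<lambda>n. expectation (\<lambda>\<omega>'. g (pad_vec p (cond_sum (s (q n)) \<omega> \<omega>')))) \<longlonglongrightarrow> L"
        using q(2)
      proof eventually_elim
        case (elim \<omega>)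
        show ?case unfolding L_def by (rule conditional_limit[OF elim \<nu> gc B])
      qed
    qed (use cond_bound expectation_conditional(2)[OF gc B] in auto)
    then have "(\<lambda>n. expectation (\<lambda>\<omega>. g (pad_vec p (cond_sum (s (q n)) \<omega> \<omega>)))) \<longlonglongrightarrow> L"
      using prob_space by (simp add: expectation_conditional(1)[OF gc B])
    then show "\<exists>r. strict_mono r \<and> (\<lambda>n. expectation (\<lambda>\<omega>. g (pad_vec p (cond_sum (s (r n)) \<omega> \<omega>)))) \<longlonglongrightarrow> L"
      using q(1) by blast
  qed
qed

end

theorem theorem3p2:
  fixes M :: "'a measure"
    and Z \<sigma> :: "int \<Rightarrow> int \<Rightarrow> 'a \<Rightarrow> real"
    and p :: nat and \<alpha> \<delta> \<epsilon> :: real and a :: "nat \<Rightarrow> real"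
  assumes M: "prob_space M"
    and Z_meas: "\<And>i t. Z i t \<in> borel_measurable M"
    and \<sigma>_meas: "\<And>i t. \<sigma> i t \<in> borel_measurable M"
    and Z_indep: "prob_space.indep_vars M (\<lambda>_. borel) (\<lambda>(i,t). Z i t) UNIV"
    and Z_ident: "\<And>i t. distr M borel (Z i t) = distr M borel (Z 0 0)"
    and \<sigma>_nonneg: "\<And>i t \<omega>. \<omega> \<in> space M \<Longrightarrow> \<sigma> i t \<omega> \<ge> 0"
    and \<sigma>_stat: "strictly_stationary_field M \<sigma>"
    and \<sigma>_erg: "ergodic_field M \<sigma>"
    and Z_\<sigma>_indep: "prob_space.indep_var M
          (PiM UNIV (\<lambda>_. borel)) (\<lambda>\<omega>. \<lambda>(i,t). Z i t \<omega>)
          (PiM UNIV (\<lambda>_. borel)) (\<lambda>\<omega>. \<lambda>(i,t). \<sigma> i t \<omega>)"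
    and p_ge: "p \<ge> 1"
    and \<alpha>_range: "0 < \<alpha>" "\<alpha> < 4" "\<alpha> \<noteq> 2"
    and Z_rv: "regularly_varying_rv M (Z 0 0) \<alpha>"
    and \<delta>_pos: "\<delta> > 0"
    and mixing: "\<exists>r. strongly_mixing_with_rate M \<sigma> p r \<and>
                     summable (\<lambda>h. r h powr (\<delta> / (2 + \<delta>)))"
    and \<epsilon>_pos: "\<epsilon> > 0"
    and moment: "integrable M (\<lambda>\<omega>. \<sigma> 0 0 \<omega> powr (2 * max (2 + \<delta>) (\<alpha> + \<epsilon>)))"
    and a_n: "(\<lambda>n. real n * measure M {\<omega> \<in> space M. \<bar>sv_X \<sigma> Z 0 0 \<omega>\<bar> > a n}) \<longlonglongrightarrow> 1"
  shows "\<exists>\<nu>. stable_totally_right_skewed (\<alpha> / 2) \<nu> \<and>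
           conv_in_distr_vec M
             (\<lambda>n \<omega> i. (sv_S \<sigma> Z n i \<omega>
                 - (if \<alpha> < 2 then 0
                    else real n * prob_space.expectation M (\<lambda>\<omega>'. (sv_X \<sigma> Z 0 0 \<omega>')\<^sup>2)))
                / (a n)\<^sup>2)
             p (PiM {1..p} (\<lambda>_. \<nu>))"
proof -
  obtain r where r: "strongly_mixing_with_rate M \<sigma> p r" "summable (\<lambda>h. r h powr (\<delta> / (2 + \<delta>)))"
    using mixing by blast
  interpret prob_space M by (rule M)
  interpret sv_model M Z \<sigma> p \<alpha> \<delta> \<epsilon> a r
    by unfold_locales (fact assms r)+
  obtain \<nu> where \<nu>: "stable_totally_right_skewed \<beta> \<nu>" "char \<nu> = (\<lambda>u. exp (Y.stable_exponent u))"
    using limit_law by metis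
  have "stable_totally_right_skewed (\<alpha> / 2) \<nu>" using \<nu>(1) by (simp only: \<beta>_def)
  moreover have "real_distribution \<nu>"
    using \<nu>(1) by (simp add: stable_totally_right_skewed_def stable_law_def)
  ultimately show ?thesis
    using cond_sum_converges[OF _ \<nu>(2)] by (intro exI[of _ \<nu>]) (simp only: normalised_eq simp_thms)
qed

end
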